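(* Let $P$ be a propositional proof system that simulates Extended Frege EF and such that for some constant $c\ge1$: (i) whenever $\sigma\in$ TAUT and $\sigma'$ is obtained from $\sigma$ by substituting constants $0$ or $1$ for some atoms, $s_P(\sigma')\le s_P(\sigma)^c$; and (ii) for all formulas $\alpha,\beta$, $s_P(\beta)\le (s_P(\alpha)+s_P(\alpha\to\beta))^c$. Assume there exists a polynomial-time function $g:\{0,1\}^*\to\{0,1\}^*$ stretching all inputs of size $n$ to size $m(n)>n$ which is $\bigvee$-hard for $P$. Then the gadget generator $\mathrm{Gad}_f$ based on $f=CV_{k^2,k}$ is $\bigvee$-hard (and hence also hard) for $P$.
   Context: A propositional proof system (pps) is a polynomial-time relation $P(x,y)$ with $\exists xP(x,y)$ iff $y\in$ TAUT; $s_P(\tau)$ is the minimal size of a $P$-proof of $\tau$. $P$ simulates $Q$ iff there is $c$ with $s_P(\sigma)\le s_Q(\sigma)^c$ for all $\sigma\in$ TAUT. For a generator $g$ (stretching size-$n$ inputs to size $m=m(n)>n$, $g_n$ computed by a circuit $C_n$ of size $m^{O(1)}$) and $b\in\{0,1\}^m$, $\tau(g_n)_b$ is the natural size-$m^{O(1)}$ propositional encoding of "$|x|=n\to C_n(x)\neq b$". $g$ is hard for $P$ if for every $c$ only finitely many tautologies $\tau(g_n)_b$ have $P$-proofs of size $\le |\tau(g_n)_b|^c$; $g$ is $\bigvee$-hard for $P$ if for every $c\ge1$ only finitely many disjunctions $\tau(g_n)_{b_1}\vee\dots\vee\tau(g_n)_{b_r}$ ($n,r\ge1$, $b_i\in\{0,1\}^m$,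 disjuncts in disjoint atoms) have $P$-proofs of size $\le m^c$. Gadget generator: for a p-time $f:\{0,1\}^\ell\times\{0,1\}^k\to\{0,1\}^{k+1}$, $\mathrm{Gad}_f:\{0,1\}^n\to\{0,1\}^{n+1}$ with $n=\ell+k(\ell+1)$ interprets its input as $v\in\{0,1\}^\ell$ and $u^1,\dots,u^{\ell+1}\in\{0,1\}^k$ and outputs the concatenation of $w^s=f(v,u^s)$, $s=1,\dots,\ell+1$. The circuit value function $CV_{a,k}(v,u)$ takes a size-$a$ description $v$ of a circuit with $k$ inputs and $k+1$ outputs and $u\in\{0,1\}^k$ and returns the circuit's output on $u$ (so here $\ell=k^2$).
   Formalization: The proof system's relation P(x,y) is required to be decidable in time polynomial in the proof length |x| alone, so a formula is at most polynomially longer than its proofs; with time polynomial in |x|+|y|, trivial proofs of gadget disjunctions could be added and the claim fails. *)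

theory Defs
  imports "HOL-Library.Extended_Nat"
begin

section \<open>Propositional formulas and their binary encoding\<close>

datatype (atoms: 'a) form =
    Cst bool
  | At 'a
  | Neg "'a form"
  | Con "'a form" "'a form"
  | Dis "'a form" "'a form"
  | Imp "'a form" "'a form"
  for map: rename

type_synonym fm = "nat form"

fun fm_eval :: "('a \<Rightarrow> bool) \<Rightarrow> 'a form \<Rightarrow> bool" where
  "fm_eval e (Cst b) = b"
| "fm_eval e (At a) = e a"
| "fm_eval e (Neg \<phi>) = (\<not> fm_eval e \<phi>)"
| "fm_eval e (Con \<phi> \<psi>) = (fm_eval e \<phi> \<and> fm_eval e \<psi>)"
| "fm_eval e (Dis \<phi> \<psi>) = (fm_eval e \<phi> \<or> fm_eval e \<psi>)"
| "fm_eval e (Imp \<phi> \<psi>) = (fm_eval e \<phi> \<longrightarrow> fm_eval e \<psi>)"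

definition tautology :: "fm \<Rightarrow> bool" where
  "tautology \<phi> \<longleftrightarrow> (\<forall>e. fm_eval e \<phi>)"

definition Iff :: "'a form \<Rightarrow> 'a form \<Rightarrow> 'a form" where
  "Iff \<phi> \<psi> = Con (Imp \<phi> \<psi>) (Imp \<psi> \<phi>)"

fun Conj :: "'a form list \<Rightarrow> 'a form" where
  "Conj [] = Cst True"
| "Conj [\<phi>] = \<phi>"
| "Conj (\<phi> # \<psi> # \<phi>s) = Con \<phi> (Conj (\<psi> # \<phi>s))"

fun Disj :: "'a form list \<Rightarrow> 'a form" where
  "Disj [] = Cst False"
| "Disj [\<phi>] = \<phi>"
| "Disj (\<phi> # \<psi> # \<phi>s) = Dis \<phi> (Disj (\<psi> # \<phi>s))"

text \<open>Substitution of constants for some of the atoms: atoms mapped to \<open>None\<close> are kept.\<close>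

fun inst :: "('a \<Rightarrow> bool option) \<Rightarrow> 'a form \<Rightarrow> 'a form" where
  "inst \<theta> (Cst b) = Cst b"
| "inst \<theta> (At a) = (case \<theta> a of None \<Rightarrow> At a | Some b \<Rightarrow> Cst b)"
| "inst \<theta> (Neg \<phi>) = Neg (inst \<theta> \<phi>)"
| "inst \<theta> (Con \<phi> \<psi>) = Con (inst \<theta> \<phi>) (inst \<theta> \<psi>)"
| "inst \<theta> (Dis \<phi> \<psi>) = Dis (inst \<theta> \<phi>) (inst \<theta> \<psi>)"
| "inst \<theta> (Imp \<phi> \<psi>) = Imp (inst \<theta> \<phi>) (inst \<theta> \<psi>)"

text \<open>A prefix-free binary code; indices of atoms are written in binary, each digit preceded by a
  continuation bit.\<close>

fun enc_nat :: "nat \<Rightarrow> bool list" where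
  "enc_nat n = (if n = 0 then [False] else True # odd n # enc_nat (n div 2))"

declare enc_nat.simps [simp del]

fun enc :: "fm \<Rightarrow> bool list" where
  "enc (Cst b) = [False, False, b]"
| "enc (At a) = [False, True, False] @ enc_nat a"
| "enc (Neg \<phi>) = [False, True, True] @ enc \<phi>"
| "enc (Con \<phi> \<psi>) = [True, False, False] @ enc \<phi> @ enc \<psi>"
| "enc (Dis \<phi> \<psi>) = [True, False, True] @ enc \<phi> @ enc \<psi>"
| "enc (Imp \<phi> \<psi>) = [True, True, False] @ enc \<phi> @ enc \<psi>"

definition TAUT :: "bool list set" where
  "TAUT = {enc \<phi> | \<phi>. tautology \<phi>}"

definition fm_size :: "fm \<Rightarrow> nat" where
  "fm_size \<phi> = length (enc \<phi>)"


section \<open>Polynomial time\<close>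

text \<open>Deterministic Turing machines with one tape, infinite to the right. The states are
  \<open>0, \<dots>, states M\<close>, of which \<open>0\<close> is initial and \<open>states M\<close> is the halting state. Symbol \<open>0\<close> is the
  blank, \<open>1\<close> and \<open>2\<close> stand for the two bits, and \<open>3\<close> separates the two arguments of a relation.\<close>

datatype move = Lft | Stay | Rgt

datatype tm = TM (states: nat) (symbols: nat) (delta: "nat \<Rightarrow> nat \<Rightarrow> nat \<times> nat \<times> move")

definition tm_wf :: "tm \<Rightarrow> bool" where
  "tm_wf M \<longleftrightarrow> 4 \<le> symbols M \<and>
     (\<forall>q < states M. \<forall>a < symbols M.
        case delta M q a of (q', a', _) \<Rightarrow> q' \<le> states M \<and> a' < symbols M)"

fun tm_step :: "tm \<Rightarrow> nat \<times> nat \<times> (nat \<Rightarrow> nat) \<Rightarrow> nat \<times> nat \<times> (nat \<Rightarrow> nat)" where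
  "tm_step M (q, h, t) =
     (if q < states M
      then case delta M q (t h) of (q', a, d) \<Rightarrow>
             (q', case d of Lft \<Rightarrow> h - 1 | Stay \<Rightarrow> h | Rgt \<Rightarrow> h + 1, t(h := a))
      else (q, h, t))"

definition tm_init :: "nat list \<Rightarrow> nat \<times> nat \<times> (nat \<Rightarrow> nat)" where
  "tm_init w = (0, 0, \<lambda>i. if i < length w then w ! i else 0)"

definition sym :: "bool \<Rightarrow> nat" where
  "sym b = (if b then 2 else 1)"

text \<open>The output is the bit string in front of the first blank.\<close>

definition tm_computes :: "tm \<Rightarrow> nat list \<Rightarrow> bool list \<Rightarrow> nat \<Rightarrow> bool" where
  "tm_computes M w out T \<longleftrightarrow>
     (case (tm_step M ^^ T) (tm_init w) of (q, h, t) \<Rightarrow>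
        q = states M \<and> (\<forall>i < length out. t i = sym (out ! i)) \<and> t (length out) = 0)"

definition ptime_fun :: "(bool list \<Rightarrow> bool list) \<Rightarrow> bool" where
  "ptime_fun g \<longleftrightarrow>
     (\<exists>M d. tm_wf M \<and> (\<forall>x. tm_computes M (map sym x) (g x) (length x ^ d + d)))"


section \<open>Propositional proof systems\<close>

text \<open>The running time of the verifier is measured in the length of the proof, as it is for a system
  given by a Cook--Reckhow function. Measured in the joint length, a single short string could be a
  proof of infinitely many, arbitrarily long, formulas, and the length of a formula would not be
  polynomially bounded by the length of its proofs.\<close>

definition ptime_verifiable :: "(bool list \<Rightarrow> bool list \<Rightarrow> bool) \<Rightarrow> bool" where
  "ptime_verifiable P \<longleftrightarrow>
     (\<exists>M d. tm_wf M \<and>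
        (\<forall>x y. tm_computes M (map sym x @ [3] @ map sym y) [P x y] (length x ^ d + d)))"

definition pps :: "(bool list \<Rightarrow> bool list \<Rightarrow> bool) \<Rightarrow> bool" where
  "pps P \<longleftrightarrow> ptime_verifiable P \<and> (\<forall>y. (\<exists>x. P x y) \<longleftrightarrow> y \<in> TAUT)"

text \<open>The minimal size of a proof; \<open>\<infinity>\<close> if there is none.\<close>

definition min_size :: "(bool list \<Rightarrow> bool list \<Rightarrow> bool) \<Rightarrow> fm \<Rightarrow> enat" where
  "min_size P \<phi> = (INF x \<in> {x. P x (enc \<phi>)}. enat (length x))"

definition simulates ::
  "(bool list \<Rightarrow> bool list \<Rightarrow> bool) \<Rightarrow> (bool list \<Rightarrow> bool list \<Rightarrow> bool) \<Rightarrow> bool" where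
  "simulates P Q \<longleftrightarrow> (\<exists>c. \<forall>\<sigma>. tautology \<sigma> \<longrightarrow> min_size P \<sigma> \<le> min_size Q \<sigma> ^ c)"


subsection \<open>Extended Frege\<close>

inductive frege_axiom :: "fm \<Rightarrow> bool" where
  "frege_axiom (Imp \<phi> (Imp \<psi> \<phi>))"
| "frege_axiom (Imp (Imp \<phi> (Imp \<psi> \<chi>)) (Imp (Imp \<phi> \<psi>) (Imp \<phi> \<chi>)))"
| "frege_axiom (Imp (Con \<phi> \<psi>) \<phi>)"
| "frege_axiom (Imp (Con \<phi> \<psi>) \<psi>)"
| "frege_axiom (Imp \<phi> (Imp \<psi> (Con \<phi> \<psi>)))"
| "frege_axiom (Imp \<phi> (Dis \<phi> \<psi>))"
| "frege_axiom (Imp \<psi> (Dis \<phi> \<psi>))"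
| "frege_axiom (Imp (Imp \<phi> \<chi>) (Imp (Imp \<psi> \<chi>) (Imp (Dis \<phi> \<psi>) \<chi>)))"
| "frege_axiom (Imp (Imp \<phi> \<psi>) (Imp (Imp \<phi> (Neg \<psi>)) (Neg \<phi>)))"
| "frege_axiom (Imp (Neg (Neg \<phi>)) \<phi>)"
| "frege_axiom (Cst True)"
| "frege_axiom (Imp (Cst False) \<phi>)"

definition ef_derivation :: "fm list \<Rightarrow> bool" where
  "ef_derivation \<pi> \<longleftrightarrow> \<pi> \<noteq> [] \<and>
     (\<forall>i < length \<pi>.
        frege_axiom (\<pi> ! i) \<or>
        (\<exists>j < i. \<exists>k < i. \<pi> ! k = Imp (\<pi> ! j) (\<pi> ! i)) \<or>
        (\<exists>q \<psi>. \<pi> ! i = Iff (At q) \<psi> \<and> q \<notin> atoms \<psi> \<and>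
               (\<forall>j < i. q \<notin> atoms (\<pi> ! j)) \<and> q \<notin> atoms (last \<pi>)))"

definition EF :: "bool list \<Rightarrow> bool list \<Rightarrow> bool" where
  "EF x y \<longleftrightarrow> (\<exists>\<pi>. ef_derivation \<pi> \<and> x = concat (map enc \<pi>) \<and> y = enc (last \<pi>))"


section \<open>Circuits\<close>

text \<open>The nodes of a circuit are its inputs followed by its gates, numbered from \<open>0\<close>. A reference to
  a node that is not available has the value \<open>0\<close>, so that every bit string describes a circuit.\<close>

datatype gate = GConst bool | GNot nat | GAnd nat nat | GOr nat nat

datatype circuit = Circuit (inputs: nat) (gates: "gate list") (outputs: "nat list")

definition at0 :: "bool list \<Rightarrow> nat \<Rightarrow> bool" where
  "at0 vs j \<longleftrightarrow> j < length vs \<and> vs ! j"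

fun gate_eval :: "(nat \<Rightarrow> bool) \<Rightarrow> gate \<Rightarrow> bool" where
  "gate_eval e (GConst b) = b"
| "gate_eval e (GNot i) = (\<not> e i)"
| "gate_eval e (GAnd i j) = (e i \<and> e j)"
| "gate_eval e (GOr i j) = (e i \<or> e j)"

definition nodes :: "circuit \<Rightarrow> bool list \<Rightarrow> bool list" where
  "nodes C x = foldl (\<lambda>vs g. vs @ [gate_eval (at0 vs) g]) x (gates C)"

definition run :: "circuit \<Rightarrow> bool list \<Rightarrow> bool list" where
  "run C x = map (at0 (nodes C x)) (outputs C)"


subsection \<open>Definition sequences and the formulas \<open>\<tau>\<close>\<close>

text \<open>A definition sequence is what the propositional encoding needs to know of a circuit: atoms
  \<open>0, \<dots>, arity D - 1\<close> are the inputs, atom \<open>arity D + i\<close> is defined by \<open>defs D ! i\<close> from atoms of smaller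
  index, and the outputs are formulas in these atoms.\<close>

datatype defseq = Defseq (arity: nat) (defs: "fm list") (outs: "fm list")

definition defseq_eval :: "defseq \<Rightarrow> bool list \<Rightarrow> bool list" where
  "defseq_eval D x =
     map (fm_eval (at0 (foldl (\<lambda>vs \<phi>. vs @ [fm_eval (at0 vs) \<phi>]) x (defs D)))) (outs D)"

definition defseq_size :: "defseq \<Rightarrow> nat" where
  "defseq_size D = sum_list (map fm_size (defs D)) + sum_list (map fm_size (outs D))"

definition num_atoms :: "defseq \<Rightarrow> nat" where
  "num_atoms D = arity D + length (defs D)"

definition tau :: "defseq \<Rightarrow> bool list \<Rightarrow> fm" where
  "tau D b =
     Imp (Conj (map (\<lambda>i. Iff (At (arity D + i)) (defs D ! i)) [0..<length (defs D)]))
         (Disj (map2 (\<lambda>\<phi> \<beta>. if \<beta> then Neg \<phi> else \<phi>) (outs D) b))"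

definition node_fm :: "nat \<Rightarrow> nat \<Rightarrow> fm" where
  "node_fm l j = (if j < l then At j else Cst False)"

fun gate_fm :: "nat \<Rightarrow> gate \<Rightarrow> fm" where
  "gate_fm l (GConst b) = Cst b"
| "gate_fm l (GNot i) = Neg (node_fm l i)"
| "gate_fm l (GAnd i j) = Con (node_fm l i) (node_fm l j)"
| "gate_fm l (GOr i j) = Dis (node_fm l i) (node_fm l j)"

definition defseq_of :: "circuit \<Rightarrow> defseq" where
  "defseq_of C =
     Defseq (inputs C)
       (map (\<lambda>i. gate_fm (inputs C + i) (gates C ! i)) [0..<length (gates C)])
       (map (node_fm (inputs C + length (gates C))) (outputs C))"


section \<open>Proof complexity generators\<close>

text \<open>A generator is a family of functions, computed by the members of a family of definition
  sequences; the latter fixes the formulas \<open>\<tau>\<close>. The members are indexed by \<open>k \<ge> 1\<close>: the input length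
  for a function on strings, the block length for a gadget generator.\<close>

definition generator :: "(nat \<Rightarrow> bool list \<Rightarrow> bool list) \<Rightarrow> (nat \<Rightarrow> defseq) \<Rightarrow> bool" where
  "generator G D \<longleftrightarrow>
     (\<forall>k \<ge> 1. arity (D k) < length (outs (D k)) \<and>
        (\<forall>x. length x = arity (D k) \<longrightarrow> defseq_eval (D k) x = G k x)) \<and>
     (\<exists>d. \<forall>k \<ge> 1. defseq_size (D k) \<le> length (outs (D k)) ^ d)"

definition hard :: "(bool list \<Rightarrow> bool list \<Rightarrow> bool) \<Rightarrow> (nat \<Rightarrow> defseq) \<Rightarrow> bool" where
  "hard P D \<longleftrightarrow>
     (\<forall>c. finite {\<phi>. \<exists>k b. k \<ge> 1 \<and> length b = length (outs (D k)) \<and> \<phi> = tau (D k) b \<and>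
                       min_size P \<phi> \<le> enat (fm_size \<phi> ^ c)})"

text \<open>The disjuncts may be written in any pairwise disjoint sets of atoms: \<open>\<rho> i\<close> names the atoms of
  the \<open>i\<close>-th disjunct. A proof system need not be closed under renaming of atoms.\<close>

definition vee_hard :: "(bool list \<Rightarrow> bool list \<Rightarrow> bool) \<Rightarrow> (nat \<Rightarrow> defseq) \<Rightarrow> bool" where
  "vee_hard P D \<longleftrightarrow>
     (\<forall>c \<ge> 1. finite {\<phi>. \<exists>k bs \<rho>. k \<ge> 1 \<and> bs \<noteq> [] \<and>
        (\<forall>b \<in> set bs. length b = length (outs (D k))) \<and>
        inj_on (\<lambda>(i, a). \<rho> i a) ({..<length bs} \<times> {..<num_atoms (D k)}) \<and>
        \<phi> = Disj (map (\<lambda>i. rename (\<rho> i) (tau (D k) (bs ! i))) [0..<length bs]) \<and>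
        min_size P \<phi> \<le> enat (length (outs (D k)) ^ c)})"


section \<open>The gadget generator of the circuit value function\<close>

definition gad :: "nat \<Rightarrow> nat \<Rightarrow> (bool list \<Rightarrow> bool list \<Rightarrow> bool list) \<Rightarrow> bool list \<Rightarrow> bool list" where
  "gad l k f x =
     concat (map (\<lambda>s. f (take l x) (take k (drop (l + s * k) x))) [0..<l + 1])"

text \<open>A description of \<open>a\<close> bits of a circuit with \<open>k\<close> inputs and \<open>k + 1\<close> outputs consists of the
  \<open>k + 1\<close> output nodes, followed by as many gates as fit. Node numbers are written in binary (least
  significant bit first) with \<open>addr_len a k\<close> bits; a gate is given by two bits for its kind and two
  node numbers. A constant gate takes its value from the first bit after the kind. Bits beyond the
  end of the description, which are needed only for small \<open>k\<close>, are read as \<open>0\<close>.\<close>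

definition addr_len :: "nat \<Rightarrow> nat \<Rightarrow> nat" where
  "addr_len a k = (LEAST w. a + k \<le> 2 ^ w)"

definition num_gates :: "nat \<Rightarrow> nat \<Rightarrow> nat" where
  "num_gates a k = (a - (k + 1) * addr_len a k) div (2 + 2 * addr_len a k)"

definition gate_pos :: "nat \<Rightarrow> nat \<Rightarrow> nat \<Rightarrow> nat" where
  "gate_pos a k i = (k + 1) * addr_len a k + i * (2 + 2 * addr_len a k)"

definition read_addr :: "bool list \<Rightarrow> nat \<Rightarrow> nat \<Rightarrow> nat" where
  "read_addr v w p = (\<Sum>j<w. of_bool (at0 v (p + j)) * 2 ^ j)"

definition read_gate :: "bool list \<Rightarrow> nat \<Rightarrow> nat \<Rightarrow> gate" where
  "read_gate v w p =
     (let i = read_addr v w (p + 2); j = read_addr v w (p + 2 + w) in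
      if at0 v p
      then (if at0 v (p + 1) then GConst (at0 v (p + 2)) else GOr i j)
      else (if at0 v (p + 1) then GAnd i j else GNot i))"

definition decode :: "nat \<Rightarrow> nat \<Rightarrow> bool list \<Rightarrow> circuit" where
  "decode a k v =
     Circuit k
       (map (\<lambda>i. read_gate v (addr_len a k) (gate_pos a k i)) [0..<num_gates a k])
       (map (\<lambda>t. read_addr v (addr_len a k) (t * addr_len a k)) [0..<k + 1])"

definition CV :: "nat \<Rightarrow> nat \<Rightarrow> bool list \<Rightarrow> bool list \<Rightarrow> bool list" where
  "CV a k v u = run (decode a k v) u"


subsection \<open>Its definition sequence\<close>

text \<open>The atoms are the bits of \<open>v\<close>, the bits of \<open>u\<^sup>1, \<dots>, u\<^bsup>a+1\<^esup>\<close>, and one atom for each gate of the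
  circuit described by \<open>v\<close>, for each of its \<open>a + 1\<close> evaluations. The decoding of the description is
  expressed by formulas, without atoms of its own: closure under substitution of constants alone gives no
  way to eliminate atoms that merely name subformulas.\<close>

definition desc_fm :: "nat \<Rightarrow> nat \<Rightarrow> fm" where
  "desc_fm a p = (if p < a then At p else Cst False)"

definition addr_fm :: "nat \<Rightarrow> nat \<Rightarrow> nat \<Rightarrow> nat \<Rightarrow> fm" where
  "addr_fm a w p j =
     Conj (map (\<lambda>t. if odd (j div 2 ^ t) then desc_fm a (p + t) else Neg (desc_fm a (p + t))) [0..<w])"

definition select_fm :: "nat \<Rightarrow> nat \<Rightarrow> nat \<Rightarrow> nat \<Rightarrow> (nat \<Rightarrow> fm) \<Rightarrow> fm" where
  "select_fm a w p l nd = Disj (map (\<lambda>j. Con (addr_fm a w p j) (nd j)) [0..<l])"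

definition cv_gate_fm :: "nat \<Rightarrow> nat \<Rightarrow> nat \<Rightarrow> nat \<Rightarrow> (nat \<Rightarrow> fm) \<Rightarrow> fm" where
  "cv_gate_fm a w p l nd =
     (let d = desc_fm a p; e = desc_fm a (p + 1);
          x = select_fm a w (p + 2) l nd; y = select_fm a w (p + 2 + w) l nd in
      Disj [Con (Con (Neg d) (Neg e)) (Neg x),
            Con (Con (Neg d) e) (Con x y),
            Con (Con d (Neg e)) (Dis x y),
            Con (Con d e) (desc_fm a (p + 2))])"

definition cv_node :: "nat \<Rightarrow> nat \<Rightarrow> nat \<Rightarrow> nat \<Rightarrow> fm" where
  "cv_node a k s j =
     At (if j < k then a + s * k + j else a + (a + 1) * k + s * num_gates a k + (j - k))"

definition gad_CV :: "nat \<Rightarrow> nat \<Rightarrow> defseq" where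
  "gad_CV a k =
     Defseq (a + (a + 1) * k)
       (concat (map (\<lambda>s. map (\<lambda>i. cv_gate_fm a (addr_len a k) (gate_pos a k i) (k + i) (cv_node a k s))
                             [0..<num_gates a k]) [0..<a + 1]))
       (concat (map (\<lambda>s. map (\<lambda>t. select_fm a (addr_len a k) (t * addr_len a k) (k + num_gates a k)
                                    (cv_node a k s)) [0..<k + 1]) [0..<a + 1]))"

end

theory Submission
  imports Defs
begin

text \<open>Let a disjunction of formulas \<open>\<tau>\<close> of the gadget generator for block length \<open>k\<close> have a short
  \<open>P\<close>-proof. Take the largest \<open>n\<close> such that a polynomial bound on the size of the circuit computing
  \<open>g\<close> on inputs of length \<open>n\<close> does not exceed \<open>k\<close>, so that \<open>k\<close> is polynomial in \<open>n\<close>. The first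
  \<open>n + 1\<close> outputs of that circuit, together with copies of \<open>k - n\<close> more inputs, form a circuit from
  \<open>k\<close> to \<open>k + 1\<close> bits that has a description of \<open>k\<^sup>2\<close> bits. Substitute this description for the
  gadget, the prescribed output bits for the copied inputs, and \<open>0\<close> for the gates that are not
  needed. What remains says that one of many strings is not a value of \<open>g\<close>, and Frege proves in
  polynomial size that it implies the corresponding disjunction of formulas \<open>\<tau>\<close> for \<open>g\<close>, in the very
  atoms of the original: each conjunct and each disjunct depends on at most three atoms once the
  constants are propagated. Short \<open>P\<close>-proofs for infinitely many \<open>k\<close> would thus give short
  \<open>P\<close>-proofs for infinitely many \<open>n\<close>. The number of disjuncts is under control because a proof
  cannot be much shorter than the formula it proves.\<close>

section \<open>Codes of formulas\<close>

lemma enc_nat_prefix_free: "enc_nat n @ xs = enc_nat n' @ ys \<Longrightarrow> n = n' \<and> xs = ys"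
proof (induction n arbitrary: n' rule: less_induct)
  case (less n)
  show ?case
  proof (cases "n = 0 \<or> n' = 0")
    case True
    then show ?thesis
      using less.prems by (auto simp: enc_nat.simps[of n] enc_nat.simps[of n'] split: if_splits)
  next
    case False
    then have parity: "odd n = odd n'" and tails: "enc_nat (n div 2) @ xs = enc_nat (n' div 2) @ ys"
      using less.prems by (simp_all add: enc_nat.simps[of n] enc_nat.simps[of n'])
    from tails have "n div 2 = n' div 2 \<and> xs = ys"
      using less.IH[of "n div 2" "n' div 2"] False by simp
    with parity show ?thesis
      by (metis odd_two_times_div_two_succ even_two_times_div_two)
  qed
qed

lemma enc_prefix_free: "enc \<phi> @ xs = enc \<psi> @ ys \<Longrightarrow> \<phi> = \<psi> \<and> xs = ys"
proof (induction \<phi> arbitrary: \<psi> xs ys)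
  case (Cst b)
  then show ?case by (cases \<psi>) auto
next
  case (At a)
  then show ?case by (cases \<psi>) (auto dest: enc_nat_prefix_free)
next
  case (Con \<phi>\<^sub>1 \<phi>\<^sub>2)
  from Con.prems show ?case by (cases \<psi>) (auto dest!: Con.IH)
next
  case (Dis \<phi>\<^sub>1 \<phi>\<^sub>2)
  from Dis.prems show ?case by (cases \<psi>) (auto dest!: Dis.IH)
next
  case (Imp \<phi>\<^sub>1 \<phi>\<^sub>2)
  from Imp.prems show ?case by (cases \<psi>) (auto dest!: Imp.IH)
next
  case (Neg \<phi>)
  then show ?case by (cases \<psi>) auto
qed

lemma enc_inject: "enc \<phi> = enc \<psi> \<longleftrightarrow> \<phi> = \<psi>"
  using enc_prefix_free[of \<phi> "[]" \<psi> "[]"] by auto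

lemma enc_in_TAUT_iff: "enc \<phi> \<in> TAUT \<longleftrightarrow> tautology \<phi>"
  by (auto simp: TAUT_def enc_inject)

lemma fm_size_simps [simp]:
  "fm_size (Cst b) = 3"
  "fm_size (At a) = length (enc_nat a) + 3"
  "fm_size (Neg \<phi>) = fm_size \<phi> + 3"
  "fm_size (Con \<phi> \<psi>) = fm_size \<phi> + fm_size \<psi> + 3"
  "fm_size (Dis \<phi> \<psi>) = fm_size \<phi> + fm_size \<psi> + 3"
  "fm_size (Imp \<phi> \<psi>) = fm_size \<phi> + fm_size \<psi> + 3"
  by (simp_all add: fm_size_def)

lemma finite_fm_size_le: "finite {\<phi>. fm_size \<phi> \<le> B}"
proof (rule finite_imageD)
  show "finite (enc ` {\<phi>. fm_size \<phi> \<le> B})"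
    by (rule finite_subset[OF _ finite_lists_length_le[of "UNIV :: bool set" B]])
       (auto simp: fm_size_def)
qed (simp add: inj_on_def enc_inject)

lemma length_enc_nat_le: "length (enc_nat n) \<le> 2 * n + 1"
proof (induction n rule: less_induct)
  case (less n)
  show ?case
  proof (cases "n = 0")
    case False
    then have "length (enc_nat n) \<le> 2 * (n div 2) + 1 + 2"
      using less[of "n div 2"] by (simp add: enc_nat.simps[of n])
    moreover have "n div 2 < n" using False by simp
    ultimately show ?thesis by linarith
  qed (simp add: enc_nat.simps)
qed

section \<open>Lengths of proofs\<close>

lemma min_size_le: "P x (enc \<phi>) \<Longrightarrow> min_size P \<phi> \<le> enat (length x)"
  unfolding min_size_def by (rule INF_lower) simp

lemma min_size_leE:
  assumes "min_size P \<phi> \<le> enat B"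
  obtains x where "P x (enc \<phi>)" "length x \<le> B"
proof -
  let ?S = "(\<lambda>x. enat (length x)) ` {x. P x (enc \<phi>)}"
  have "?S \<noteq> {}"
    using assms by (force simp: min_size_def top_enat_def)
  then have "Inf ?S \<in> ?S"
    by (auto simp: Inf_enat_def intro: LeastI)
  then show ?thesis
    using assms that by (auto simp: min_size_def)
qed

lemma enat_power: "enat x ^ c = enat (x ^ c)"
  by (induction c) (auto simp: one_enat_def)

lemma enat_power_le: "x \<le> enat y \<Longrightarrow> x ^ c \<le> enat (y ^ c)"
  by (cases x) (auto simp: enat_power power_mono)

lemma tm_steps_local:
  assumes "take T w = take T w'" "t \<le> T"
  shows "case ((tm_step M ^^ t) (tm_init w), (tm_step M ^^ t) (tm_init w')) of
           ((q, h, f), (q', h', f')) \<Rightarrow> q = q' \<and> h = h' \<and> h \<le> t \<and> (\<forall>i < T. f i = f' i)"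
  using assms(2)
proof (induction t)
  case 0
  have "snd (snd (tm_init w)) i = snd (snd (tm_init w')) i" if "i < T" for i
  proof -
    have "i < length w \<longleftrightarrow> i < length w'"
      using arg_cong[OF assms(1), of length] that by auto
    moreover have "w ! i = w' ! i"
      using arg_cong[OF assms(1), of "\<lambda>v. v ! i"] that by simp
    ultimately show ?thesis by (simp add: tm_init_def)
  qed
  then show ?case by (simp add: tm_init_def)
next
  case (Suc t)
  then show ?case
    by (auto simp: fun_upd_def split: prod.splits if_splits move.splits)
qed

lemma tm_computes_bit_local:
  assumes "tm_computes M w [b] T" "tm_computes M w' [b'] T" "take T w = take T w'" "0 < T"
  shows "b = b'"
proof -
  obtain q h f where run: "(tm_step M ^^ T) (tm_init w) = (q, h, f)"
    by (metis prod_cases3)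
  obtain q' h' f' where run': "(tm_step M ^^ T) (tm_init w') = (q', h', f')"
    by (metis prod_cases3)
  have "\<forall>i < T. f i = f' i"
    using tm_steps_local[OF assms(3) order.refl, of M] unfolding run run' by simp
  then have "f 0 = f' 0" using assms(4) by blast
  moreover have "f 0 = sym b" using assms(1) by (simp add: tm_computes_def run)
  moreover have "f' 0 = sym b'" using assms(2) by (simp add: tm_computes_def run')
  ultimately have "sym b = sym b'" by metis
  then show ?thesis by (simp add: sym_def split: if_splits)
qed

lemma tm_tape_nonblank:
  "case (tm_step M ^^ t) (tm_init w) of (q, h, f) \<Rightarrow>
     h \<le> t \<and> (\<forall>i. f i \<noteq> 0 \<longrightarrow> i < length w \<or> i < t)"
proof (induction t)
  case (Suc t)
  then show ?case
    by (auto simp: less_Suc_eq split: prod.splits if_splits move.splits)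
qed (auto simp: tm_init_def)

lemma tm_computes_length:
  assumes "tm_computes M w out T"
  shows "length out \<le> length w + T"
proof (cases "out = []")
  case False
  let ?i = "length out - 1"
  obtain q h f where run: "(tm_step M ^^ T) (tm_init w) = (q, h, f)"
    by (metis prod_cases3)
  have "\<forall>i < length out. f i = sym (out ! i)"
    using assms by (simp add: tm_computes_def run)
  moreover have "?i < length out" using False by simp
  ultimately have "f ?i = sym (out ! ?i)" by blast
  then have "f ?i \<noteq> 0" by (simp add: sym_def)
  then have "?i < length w \<or> ?i < T"
    using tm_tape_nonblank[where t = T and M = M and w = w] unfolding run by simp
  then show ?thesis by linarith
qed simp

lemma ptime_fun_length:
  assumes "ptime_fun g"
  shows "\<exists>d. \<forall>x. length (g x) \<le> length x + (length x ^ d + d)"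
proof -
  obtain M d where "\<And>x. tm_computes M (map sym x) (g x) (length x ^ d + d)"
    using assms by (auto simp: ptime_fun_def)
  from tm_computes_length[OF this] show ?thesis by auto
qed

text \<open>Since codes are prefix-free, a verifier that does not reach the end of a formula cannot tell
  it from a string that is not a formula.\<close>

lemma pps_fm_size:
  assumes "pps P"
  shows "\<exists>d. \<forall>\<phi> x. P x (enc \<phi>) \<longrightarrow> fm_size \<phi> \<le> length x ^ d + d"
proof -
  obtain M d where verifier:
      "\<And>x y. tm_computes M (map sym x @ [3] @ map sym y) [P x y] (length x ^ d + d)"
    using assms by (auto simp: pps_def ptime_verifiable_def)
  have "fm_size \<phi> \<le> length x ^ d + d" if proof_x: "P x (enc \<phi>)" for \<phi> x
  proof (rule ccontr)
    let ?T = "length x ^ d + d"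
    let ?w = "\<lambda>y. map sym x @ [3] @ map sym y"
    assume "\<not> fm_size \<phi> \<le> ?T"
    then have "?T - length (?w (enc \<phi>)) = 0" by (simp add: fm_size_def)
    moreover have "?w (enc \<phi> @ [False]) = ?w (enc \<phi>) @ [sym False]" by simp
    ultimately have "take ?T (?w (enc \<phi>)) = take ?T (?w (enc \<phi> @ [False]))"
      by (simp only: take_append take_0 append_Nil2)
    moreover have "0 < ?T" by (cases d) auto
    ultimately have "P x (enc \<phi>) = P x (enc \<phi> @ [False])"
      by (rule tm_computes_bit_local[OF verifier verifier])
    then have "enc \<phi> @ [False] \<in> TAUT" using assms proof_x by (auto simp: pps_def)
    then obtain \<psi> where "enc \<phi> @ [False] = enc \<psi> @ []" by (auto simp: TAUT_def)
    then show False using enc_prefix_free by blast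
  qed
  then show ?thesis by blast
qed

section \<open>Polynomial bounds\<close>

text \<open>Small arguments are left out, so that a constant factor can be absorbed in the exponent.\<close>

definition poly_bounded :: "(nat \<Rightarrow> nat) \<Rightarrow> bool" where
  "poly_bounded p \<longleftrightarrow> (\<exists>d. \<forall>n \<ge> 2. p n \<le> n ^ d)"

named_theorems poly_bounded_intros

lemma poly_bounded_id [poly_bounded_intros]: "poly_bounded (\<lambda>n. n)"
  unfolding poly_bounded_def by (rule exI[of _ 1]) simp

lemma poly_bounded_const [poly_bounded_intros]: "poly_bounded (\<lambda>_. c)"
  unfolding poly_bounded_def
proof (intro exI[of _ c] allI impI)
  fix n :: nat assume "2 \<le> n"
  then have "2 ^ c \<le> n ^ c" by (rule power_mono) simp
  then show "c \<le> n ^ c" using less_exp[of c] by linarith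
qed

lemma poly_bounded_mult [poly_bounded_intros]:
  assumes "poly_bounded p" "poly_bounded q"
  shows "poly_bounded (\<lambda>n. p n * q n)"
proof -
  obtain i j where "\<forall>n \<ge> 2. p n \<le> n ^ i" "\<forall>n \<ge> 2. q n \<le> n ^ j"
    using assms by (auto simp: poly_bounded_def)
  then have "\<forall>n \<ge> 2. p n * q n \<le> n ^ (i + j)"
    by (simp add: power_add mult_mono)
  then show ?thesis unfolding poly_bounded_def ..
qed

lemma poly_bounded_add [poly_bounded_intros]:
  assumes "poly_bounded p" "poly_bounded q"
  shows "poly_bounded (\<lambda>n. p n + q n)"
proof -
  obtain i j where ij: "\<forall>n \<ge> 2. p n \<le> n ^ i" "\<forall>n \<ge> 2. q n \<le> n ^ j"
    using assms by (auto simp: poly_bounded_def)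
  have "p n + q n \<le> n ^ Suc (i + j)" if "n \<ge> 2" for n
  proof -
    have "n ^ i \<le> n ^ (i + j)" "n ^ j \<le> n ^ (i + j)"
      using that by (auto intro: power_increasing)
    moreover have "p n \<le> n ^ i" "q n \<le> n ^ j" using ij that by auto
    ultimately have "p n + q n \<le> 2 * n ^ (i + j)" by linarith
    also have "\<dots> \<le> n ^ Suc (i + j)" using that by simp
    finally show ?thesis .
  qed
  then show ?thesis unfolding poly_bounded_def by blast
qed

lemma poly_bounded_power [poly_bounded_intros]: "poly_bounded p \<Longrightarrow> poly_bounded (\<lambda>n. p n ^ c)"
  by (induction c) (auto intro: poly_bounded_intros)

lemma poly_bounded_mono: "poly_bounded q \<Longrightarrow> (\<And>n. 2 \<le> n \<Longrightarrow> p n \<le> q n) \<Longrightarrow> poly_bounded p"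
  unfolding poly_bounded_def by (meson le_trans)

lemma poly_boundedE:
  assumes "poly_bounded p"
  obtains d where "1 \<le> d" "\<And>n. 2 \<le> n \<Longrightarrow> p n \<le> n ^ d"
proof -
  obtain d where d: "\<forall>n \<ge> 2. p n \<le> n ^ d" using assms by (auto simp: poly_bounded_def)
  have "p n \<le> n ^ Suc d" if "2 \<le> n" for n
  proof -
    have "n ^ d \<le> n ^ Suc d" using that by (intro power_increasing) auto
    then show ?thesis using d that le_trans by blast
  qed
  then show ?thesis using that[of "Suc d"] by simp
qed

section \<open>Frege proofs\<close>

fun num_symbols :: "'a form \<Rightarrow> nat" where
  "num_symbols (Cst b) = 1"
| "num_symbols (At a) = 1"
| "num_symbols (Neg \<phi>) = num_symbols \<phi> + 1"
| "num_symbols (Con \<phi> \<psi>) = num_symbols \<phi> + num_symbols \<psi> + 1"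
| "num_symbols (Dis \<phi> \<psi>) = num_symbols \<phi> + num_symbols \<psi> + 1"
| "num_symbols (Imp \<phi> \<psi>) = num_symbols \<phi> + num_symbols \<psi> + 1"

fun fm_subst :: "('a \<Rightarrow> 'b form) \<Rightarrow> 'a form \<Rightarrow> 'b form" where
  "fm_subst \<sigma> (Cst b) = Cst b"
| "fm_subst \<sigma> (At a) = \<sigma> a"
| "fm_subst \<sigma> (Neg \<phi>) = Neg (fm_subst \<sigma> \<phi>)"
| "fm_subst \<sigma> (Con \<phi> \<psi>) = Con (fm_subst \<sigma> \<phi>) (fm_subst \<sigma> \<psi>)"
| "fm_subst \<sigma> (Dis \<phi> \<psi>) = Dis (fm_subst \<sigma> \<phi>) (fm_subst \<sigma> \<psi>)"
| "fm_subst \<sigma> (Imp \<phi> \<psi>) = Imp (fm_subst \<sigma> \<phi>) (fm_subst \<sigma> \<psi>)"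

lemma num_symbols_pos [simp]: "0 < num_symbols \<phi>" "Suc 0 \<le> num_symbols \<phi>"
  by (induction \<phi>) auto

lemma num_symbols_fm_subst_le:
  assumes "\<And>a. num_symbols (\<sigma> a) \<le> M"
  shows "num_symbols (fm_subst \<sigma> \<phi>) \<le> num_symbols \<phi> * M"
proof -
  have "1 \<le> M" using assms num_symbols_pos(1) by (metis One_nat_def Suc_leI le_trans)
  then show ?thesis
    by (induction \<phi>) (auto simp: assms algebra_simps)
qed

lemma num_symbols_le_fm_subst: "a \<in> atoms \<phi> \<Longrightarrow> num_symbols (\<sigma> a) \<le> num_symbols (fm_subst \<sigma> \<phi>)"
  by (induction \<phi>) auto

lemma rename_eq_fm_subst: "rename f \<phi> = fm_subst (\<lambda>a. At (f a)) \<phi>"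
  by (induction \<phi>) auto

lemma num_symbols_rename [simp]: "num_symbols (rename f \<phi>) = num_symbols \<phi>"
  by (induction \<phi>) auto

lemma num_symbols_inst [simp]: "num_symbols (inst \<theta> \<phi>) = num_symbols \<phi>"
  by (induction \<phi>) (auto split: option.splits)

lemma fm_subst_cong: "(\<And>a. a \<in> atoms \<phi> \<Longrightarrow> \<sigma> a = \<sigma>' a) \<Longrightarrow> fm_subst \<sigma> \<phi> = fm_subst \<sigma>' \<phi>"
  by (induction \<phi>) auto

lemma fm_subst_At [simp]: "fm_subst At \<phi> = \<phi>"
  by (induction \<phi>) auto

lemma atoms_fm_subst: "atoms (fm_subst \<sigma> \<phi>) = (\<Union>a \<in> atoms \<phi>. atoms (\<sigma> a))"
  by (induction \<phi>) auto

lemma num_symbols_le_fm_size: "num_symbols \<phi> \<le> fm_size \<phi>"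
  by (induction \<phi>) auto

lemma fm_size_le_num_symbols:
  "(\<And>a. a \<in> atoms \<phi> \<Longrightarrow> length (enc_nat a) \<le> L) \<Longrightarrow> fm_size \<phi> \<le> num_symbols \<phi> * (L + 3)"
  by (induction \<phi>) (fastforce simp: algebra_simps)+

lemma length_enc_nat_le_fm_size: "a \<in> atoms \<phi> \<Longrightarrow> length (enc_nat a) \<le> fm_size \<phi>"
  by (induction \<phi>) auto

lemma frege_axiom_fm_subst: "frege_axiom \<phi> \<Longrightarrow> frege_axiom (fm_subst \<sigma> \<phi>)"
  by (induction rule: frege_axiom.induct) (auto intro: frege_axiom.intros)

definition literal :: "bool \<Rightarrow> 'a form \<Rightarrow> 'a form" where
  "literal b \<phi> = (if b then \<phi> else Neg \<phi>)"

subsection \<open>Completeness\<close>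

inductive derivable :: "fm set \<Rightarrow> fm \<Rightarrow> bool" for \<Gamma> where
  derivable_axiom: "frege_axiom \<phi> \<Longrightarrow> derivable \<Gamma> \<phi>"
| derivable_hyp: "\<phi> \<in> \<Gamma> \<Longrightarrow> derivable \<Gamma> \<phi>"
| derivable_mp: "derivable \<Gamma> \<phi> \<Longrightarrow> derivable \<Gamma> (Imp \<phi> \<psi>) \<Longrightarrow> derivable \<Gamma> \<psi>"

lemma derivable_mono: "derivable \<Gamma> \<phi> \<Longrightarrow> \<Gamma> \<subseteq> \<Delta> \<Longrightarrow> derivable \<Delta> \<phi>"
  by (induction rule: derivable.induct) (auto intro: derivable.intros)

lemma derivable_insert: "derivable \<Gamma> \<phi> \<Longrightarrow> derivable (insert \<psi> \<Gamma>) \<phi>"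
  by (rule derivable_mono) auto

lemma derivable_weaken: "derivable \<Gamma> \<psi> \<Longrightarrow> derivable \<Gamma> (Imp \<phi> \<psi>)"
  by (rule derivable_mp[OF _ derivable_axiom]) (auto intro: frege_axiom.intros)

lemma derivable_refl: "derivable \<Gamma> (Imp \<phi> \<phi>)"
proof -
  have "derivable \<Gamma> (Imp (Imp \<phi> (Imp \<phi> \<phi>)) (Imp \<phi> \<phi>))"
    by (rule derivable_mp[of _ "Imp \<phi> (Imp (Imp \<phi> \<phi>) \<phi>)"])
       (auto intro!: derivable_axiom frege_axiom.intros)
  then show ?thesis
    by (rule derivable_mp[rotated]) (auto intro!: derivable_axiom frege_axiom.intros)
qed

lemma deduction_theorem: "derivable (insert \<phi> \<Gamma>) \<psi> \<Longrightarrow> derivable \<Gamma> (Imp \<phi> \<psi>)"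
proof (induction rule: derivable.induct)
  case (derivable_axiom \<psi>)
  then show ?case by (intro derivable_weaken derivable.derivable_axiom)
next
  case (derivable_hyp \<psi>)
  then show ?case by (auto intro: derivable_refl derivable_weaken derivable.derivable_hyp)
next
  case (derivable_mp \<chi> \<psi>)
  have "derivable \<Gamma> (Imp (Imp \<phi> (Imp \<chi> \<psi>)) (Imp (Imp \<phi> \<chi>) (Imp \<phi> \<psi>)))"
    by (intro derivable.derivable_axiom frege_axiom.intros)
  then show ?case
    by (rule derivable.derivable_mp[OF derivable_mp.IH(1) derivable.derivable_mp[OF derivable_mp.IH(2)]])
qed

lemma derivable_NegI:
  assumes "derivable (insert \<phi> \<Gamma>) \<psi>" "derivable (insert \<phi> \<Gamma>) (Neg \<psi>)"
  shows "derivable \<Gamma> (Neg \<phi>)"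
proof -
  have "derivable \<Gamma> (Imp (Imp \<phi> \<psi>) (Imp (Imp \<phi> (Neg \<psi>)) (Neg \<phi>)))"
    by (intro derivable_axiom frege_axiom.intros)
  from derivable_mp[OF deduction_theorem[OF assms(2)] derivable_mp[OF deduction_theorem[OF assms(1)] this]]
  show ?thesis .
qed

lemma derivable_ccontr:
  assumes "derivable (insert (Neg \<phi>) \<Gamma>) \<psi>" "derivable (insert (Neg \<phi>) \<Gamma>) (Neg \<psi>)"
  shows "derivable \<Gamma> \<phi>"
proof -
  have "derivable \<Gamma> (Imp (Neg (Neg \<phi>)) \<phi>)"
    by (intro derivable_axiom frege_axiom.intros)
  from derivable_mp[OF derivable_NegI[OF assms] this] show ?thesis .
qed

lemma derivable_NegE: "derivable \<Gamma> \<phi> \<Longrightarrow> derivable \<Gamma> (Neg \<phi>) \<Longrightarrow> derivable \<Gamma> \<psi>"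
  by (rule derivable_ccontr[of _ _ \<phi>]) (simp_all add: derivable_insert)

lemma derivable_cases:
  assumes "derivable (insert \<phi> \<Gamma>) \<chi>" "derivable (insert (Neg \<phi>) \<Gamma>) \<chi>"
  shows "derivable \<Gamma> \<chi>"
proof (rule derivable_ccontr)
  show "derivable (insert (Neg \<chi>) \<Gamma>) (Neg \<phi>)"
    by (rule derivable_NegI[of _ _ \<chi>]) (auto intro: derivable_hyp derivable_mono[OF assms(1)])
  show "derivable (insert (Neg \<chi>) \<Gamma>) (Neg (Neg \<phi>))"
    by (rule derivable_NegI[of _ _ \<chi>]) (auto intro: derivable_hyp derivable_mono[OF assms(2)])
qed

lemma derivable_literal_Cst: "derivable \<Gamma> (literal b (Cst b))"
proof (cases b)
  case True
  then show ?thesis by (auto simp: literal_def intro: derivable_axiom frege_axiom.intros)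
next
  case False
  have "derivable \<Gamma> (Neg (Cst False))"
  proof (rule derivable_NegI[of _ _ "Cst True"])
    show "derivable (insert (Cst False) \<Gamma>) (Neg (Cst True))"
      by (rule derivable_mp[of _ "Cst False"]) (auto intro: derivable.intros frege_axiom.intros)
  qed (auto intro: derivable.intros frege_axiom.intros)
  with False show ?thesis by (simp add: literal_def)
qed

lemma derivable_literal_Neg: "derivable \<Gamma> (literal b \<phi>) \<Longrightarrow> derivable \<Gamma> (literal (\<not> b) (Neg \<phi>))"
  using derivable_NegI[OF derivable_insert, of \<Gamma> \<phi> "Neg \<phi>"]
  by (cases b) (simp_all add: literal_def derivable_hyp)

lemma derivable_literal_Con:
  assumes "derivable \<Gamma> (literal b \<phi>)" "derivable \<Gamma> (literal c \<psi>)"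
  shows "derivable \<Gamma> (literal (b \<and> c) (Con \<phi> \<psi>))"
proof -
  consider "b" "c" | "\<not> b" | "\<not> c" by blast
  then show ?thesis
  proof cases
    case 1
    have "derivable \<Gamma> (Imp \<phi> (Imp \<psi> (Con \<phi> \<psi>)))" by (intro derivable_axiom frege_axiom.intros)
    from derivable_mp[OF _ derivable_mp[OF _ this]] assms 1 show ?thesis by (simp add: literal_def)
  next
    case 2
    have "derivable (insert (Con \<phi> \<psi>) \<Gamma>) \<phi>"
      by (rule derivable_mp[of _ "Con \<phi> \<psi>"]) (auto intro: derivable.intros frege_axiom.intros)
    with assms(1) 2 show ?thesis
      by (auto simp: literal_def intro: derivable_NegI derivable_insert)
  next
    case 3
    have "derivable (insert (Con \<phi> \<psi>) \<Gamma>) \<psi>"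
      by (rule derivable_mp[of _ "Con \<phi> \<psi>"]) (auto intro: derivable.intros frege_axiom.intros)
    with assms(2) 3 show ?thesis
      by (auto simp: literal_def intro: derivable_NegI derivable_insert)
  qed
qed

lemma derivable_DisE:
  assumes "derivable (insert \<phi> \<Gamma>) \<chi>" "derivable (insert \<psi> \<Gamma>) \<chi>" "derivable \<Gamma> (Dis \<phi> \<psi>)"
  shows "derivable \<Gamma> \<chi>"
proof -
  have "derivable \<Gamma> (Imp (Imp \<phi> \<chi>) (Imp (Imp \<psi> \<chi>) (Imp (Dis \<phi> \<psi>) \<chi>)))"
    by (intro derivable_axiom frege_axiom.intros)
  from derivable_mp[OF assms(3) derivable_mp[OF deduction_theorem[OF assms(2)]
      derivable_mp[OF deduction_theorem[OF assms(1)] this]]]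
  show ?thesis .
qed

lemma derivable_literal_Dis:
  assumes "derivable \<Gamma> (literal b \<phi>)" "derivable \<Gamma> (literal c \<psi>)"
  shows "derivable \<Gamma> (literal (b \<or> c) (Dis \<phi> \<psi>))"
proof -
  consider "b" | "c" | "\<not> b" "\<not> c" by blast
  then show ?thesis
  proof cases
    case 1
    have "derivable \<Gamma> (Imp \<phi> (Dis \<phi> \<psi>))" by (intro derivable_axiom frege_axiom.intros)
    from derivable_mp[OF _ this] assms(1) 1 show ?thesis by (simp add: literal_def)
  next
    case 2
    have "derivable \<Gamma> (Imp \<psi> (Dis \<phi> \<psi>))" by (intro derivable_axiom frege_axiom.intros)
    from derivable_mp[OF _ this] assms(2) 2 show ?thesis by (simp add: literal_def)
  next
    case 3
    with assms have negs: "derivable \<Gamma> (Neg \<phi>)" "derivable \<Gamma> (Neg \<psi>)" by (simp_all add: literal_def)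
    have "derivable (insert (Dis \<phi> \<psi>) \<Gamma>) \<chi>" for \<chi>
    proof (rule derivable_DisE)
      show "derivable (insert \<phi> (insert (Dis \<phi> \<psi>) \<Gamma>)) \<chi>"
        by (rule derivable_NegE[of _ \<phi>]) (simp_all add: derivable_hyp derivable_insert negs)
      show "derivable (insert \<psi> (insert (Dis \<phi> \<psi>) \<Gamma>)) \<chi>"
        by (rule derivable_NegE[of _ \<psi>]) (simp_all add: derivable_hyp derivable_insert negs)
    qed (simp add: derivable_hyp)
    from derivable_NegI[OF this this] 3 show ?thesis by (simp add: literal_def)
  qed
qed

lemma derivable_literal_Imp:
  assumes "derivable \<Gamma> (literal b \<phi>)" "derivable \<Gamma> (literal c \<psi>)"
  shows "derivable \<Gamma> (literal (b \<longrightarrow> c) (Imp \<phi> \<psi>))"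
proof -
  consider "\<not> b" | "c" | "b" "\<not> c" by blast
  then show ?thesis
  proof cases
    case 1
    with assms(1) have "derivable (insert \<phi> \<Gamma>) \<psi>"
      by - (rule derivable_NegE[of _ \<phi>]; simp add: literal_def derivable_hyp derivable_insert)
    with 1 show ?thesis by (simp add: literal_def deduction_theorem)
  next
    case 2
    with assms(2) show ?thesis by (simp add: literal_def derivable_weaken)
  next
    case 3
    with assms have "derivable \<Gamma> \<phi>" "derivable \<Gamma> (Neg \<psi>)" by (simp_all add: literal_def)
    moreover from this(1) have "derivable (insert (Imp \<phi> \<psi>) \<Gamma>) \<psi>"
      by (rule derivable_mp[OF derivable_insert derivable_hyp]) simp
    ultimately show ?thesis
      using derivable_NegI[OF _ derivable_insert] 3 by (simp add: literal_def)
  qed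
qed

abbreviation literals :: "(nat \<Rightarrow> bool) \<Rightarrow> nat set \<Rightarrow> fm set" where
  "literals e A \<equiv> (\<lambda>a. literal (e a) (At a)) ` A"

lemma kalmar: "atoms \<phi> \<subseteq> A \<Longrightarrow> derivable (literals e A) (literal (fm_eval e \<phi>) \<phi>)"
  by (induction \<phi>)
     (auto intro: derivable_hyp derivable_literal_Cst derivable_literal_Neg derivable_literal_Con
        derivable_literal_Dis derivable_literal_Imp)

lemma derivable_if_derivable_literals:
  assumes "finite A" "\<And>e. derivable (literals e A) \<phi>"
  shows "derivable {} \<phi>"
  using assms
proof (induction A rule: finite_induct)
  case (insert x A)
  have "derivable (literals e A) \<phi>" for e
  proof (rule derivable_cases)
    have literals_upd: "literals (e(x := b)) A = literals e A" for b
      using insert.hyps by (intro image_cong) auto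
    show "derivable (insert (At x) (literals e A)) \<phi>"
      using insert.prems[of "e(x := True)"] by (simp only: image_insert literals_upd) (simp add: literal_def)
    show "derivable (insert (Neg (At x)) (literals e A)) \<phi>"
      using insert.prems[of "e(x := False)"] by (simp only: image_insert literals_upd) (simp add: literal_def)
  qed
  then show ?case by (rule insert.IH)
qed simp

lemma frege_complete:
  assumes "tautology \<phi>"
  shows "derivable {} \<phi>"
proof (rule derivable_if_derivable_literals)
  show "finite (atoms \<phi>)" by (induction \<phi>) auto
  show "derivable (literals e (atoms \<phi>)) \<phi>" for e
    using kalmar[of \<phi> "atoms \<phi>" e] assms by (simp add: tautology_def literal_def)
qed

subsection \<open>Proofs with a bound on the number and the size of the lines\<close>

definition frege_proof :: "fm list \<Rightarrow> bool" where
  "frege_proof \<pi> \<longleftrightarrow>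
     (\<forall>i < length \<pi>. frege_axiom (\<pi> ! i) \<or>
        (\<exists>\<phi> \<in> set (take i \<pi>). Imp \<phi> (\<pi> ! i) \<in> set (take i \<pi>)))"

definition frege_provable :: "nat \<Rightarrow> nat \<Rightarrow> fm \<Rightarrow> bool" where
  "frege_provable s n \<phi> \<longleftrightarrow>
     (\<exists>\<pi>. frege_proof \<pi> \<and> \<pi> \<noteq> [] \<and> last \<pi> = \<phi> \<and> length \<pi> \<le> n \<and> (\<forall>\<psi> \<in> set \<pi>. num_symbols \<psi> \<le> s))"

lemma frege_proof_append:
  assumes "frege_proof \<pi>" "frege_proof \<pi>'"
  shows "frege_proof (\<pi> @ \<pi>')"
  unfolding frege_proof_def
proof (intro allI impI)
  fix i assume i: "i < length (\<pi> @ \<pi>')"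
  show "frege_axiom ((\<pi> @ \<pi>') ! i) \<or>
      (\<exists>\<phi> \<in> set (take i (\<pi> @ \<pi>')). Imp \<phi> ((\<pi> @ \<pi>') ! i) \<in> set (take i (\<pi> @ \<pi>')))"
  proof (cases "i < length \<pi>")
    case True
    then show ?thesis using assms(1) by (simp add: frege_proof_def nth_append)
  next
    case False
    then have "frege_axiom (\<pi>' ! (i - length \<pi>)) \<or>
        (\<exists>\<phi> \<in> set (take (i - length \<pi>) \<pi>'). Imp \<phi> (\<pi>' ! (i - length \<pi>)) \<in> set (take (i - length \<pi>) \<pi>'))"
      using assms(2) i by (simp add: frege_proof_def)
    with False show ?thesis by (auto simp: nth_append)
  qed
qed

lemma frege_proof_mp:
  assumes "frege_proof \<pi>" "\<phi> \<in> set \<pi>" "Imp \<phi> \<psi> \<in> set \<pi>"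
  shows "frege_proof (\<pi> @ [\<psi>])"
  using assms by (auto simp: frege_proof_def nth_append less_Suc_eq)

lemma frege_proof_map_fm_subst: "frege_proof \<pi> \<Longrightarrow> frege_proof (map (fm_subst \<sigma>) \<pi>)"
  unfolding frege_proof_def
  by (fastforce simp: take_map intro: frege_axiom_fm_subst image_eqI[of _ "fm_subst \<sigma>" "Imp _ _"])

lemma ef_derivation_if_frege_proof:
  assumes "frege_proof \<pi>" "\<pi> \<noteq> []"
  shows "ef_derivation \<pi>"
  unfolding ef_derivation_def
proof (intro conjI allI impI)
  fix i assume "i < length \<pi>"
  then consider "frege_axiom (\<pi> ! i)"
    | \<phi> where "\<phi> \<in> set (take i \<pi>)" "Imp \<phi> (\<pi> ! i) \<in> set (take i \<pi>)"
    using assms(1) by (auto simp: frege_proof_def)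
  then show "frege_axiom (\<pi> ! i) \<or> (\<exists>j < i. \<exists>k < i. \<pi> ! k = Imp (\<pi> ! j) (\<pi> ! i)) \<or>
    (\<exists>q \<psi>. \<pi> ! i = Iff (At q) \<psi> \<and> q \<notin> atoms \<psi> \<and> (\<forall>j < i. q \<notin> atoms (\<pi> ! j)) \<and> q \<notin> atoms (last \<pi>))"
    by cases (force simp: in_set_conv_nth)+
qed (rule assms(2))

lemma frege_proof_sound:
  assumes "frege_proof \<pi>" "\<phi> \<in> set \<pi>"
  shows "tautology \<phi>"
proof -
  have "tautology (\<pi> ! i)" if "i < length \<pi>" for i
    using that
  proof (induction i rule: less_induct)
    case (less i)
    have earlier: "tautology \<psi>" if "\<psi> \<in> set (take i \<pi>)" for \<psi>
      using that less by (auto simp: in_set_conv_nth)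
    consider "frege_axiom (\<pi> ! i)"
      | \<psi> where "\<psi> \<in> set (take i \<pi>)" "Imp \<psi> (\<pi> ! i) \<in> set (take i \<pi>)"
      using assms(1) less.prems by (auto simp: frege_proof_def)
    then show ?case
    proof cases
      case 1
      then show ?thesis by (induction rule: frege_axiom.induct) (auto simp: tautology_def)
    next
      case 2
      from earlier[OF 2(1)] earlier[OF 2(2)] show ?thesis by (simp add: tautology_def)
    qed
  qed
  with assms(2) show ?thesis by (auto simp: in_set_conv_nth)
qed

lemma frege_provable_sound: "frege_provable s n \<phi> \<Longrightarrow> tautology \<phi>"
  unfolding frege_provable_def using frege_proof_sound by (metis last_in_set)

lemma frege_provable_axiom: "frege_axiom \<phi> \<Longrightarrow> num_symbols \<phi> \<le> s \<Longrightarrow> 1 \<le> n \<Longrightarrow> frege_provable s n \<phi>"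
  unfolding frege_provable_def frege_proof_def by (rule exI[of _ "[\<phi>]"]) simp

lemma frege_provable_mono:
  assumes "frege_provable s n \<phi>" "s \<le> s'" "n \<le> n'"
  shows "frege_provable s' n' \<phi>"
proof -
  obtain \<pi> where "frege_proof \<pi>" "\<pi> \<noteq> []" "last \<pi> = \<phi>" "length \<pi> \<le> n" "\<forall>\<psi> \<in> set \<pi>. num_symbols \<psi> \<le> s"
    using assms(1) by (auto simp: frege_provable_def)
  with assms(2,3) show ?thesis
    unfolding frege_provable_def by (intro exI[of _ \<pi>]) auto
qed

lemma frege_provable_mp:
  assumes "frege_provable s p \<phi>" "frege_provable s q (Imp \<phi> \<psi>)"
  shows "frege_provable s (p + q + 1) \<psi>"
proof -
  obtain \<pi> where \<pi>: "frege_proof \<pi>" "\<pi> \<noteq> []" "last \<pi> = \<phi>" "length \<pi> \<le> p"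
      "\<forall>\<chi> \<in> set \<pi>. num_symbols \<chi> \<le> s"
    using assms(1) by (auto simp: frege_provable_def)
  obtain \<pi>' where \<pi>': "frege_proof \<pi>'" "\<pi>' \<noteq> []" "last \<pi>' = Imp \<phi> \<psi>" "length \<pi>' \<le> q"
      "\<forall>\<chi> \<in> set \<pi>'. num_symbols \<chi> \<le> s"
    using assms(2) by (auto simp: frege_provable_def)
  have "\<phi> \<in> set \<pi>" "Imp \<phi> \<psi> \<in> set \<pi>'"
    using \<pi>(2,3) \<pi>'(2,3) last_in_set by metis+
  then have "frege_proof ((\<pi> @ \<pi>') @ [\<psi>])"
    by (intro frege_proof_mp[OF frege_proof_append[OF \<pi>(1) \<pi>'(1)], of \<phi>]) auto
  moreover have "num_symbols \<psi> \<le> s" using \<open>Imp \<phi> \<psi> \<in> set \<pi>'\<close> \<pi>'(5) by fastforce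
  ultimately show ?thesis
    unfolding frege_provable_def using \<pi>(4,5) \<pi>'(4,5)
    by (intro exI[of _ "(\<pi> @ \<pi>') @ [\<psi>]"]) auto
qed

lemma frege_provable_fm_subst:
  assumes "frege_provable s n \<phi>" "\<And>a. num_symbols (\<sigma> a) \<le> M"
  shows "frege_provable (s * M) n (fm_subst \<sigma> \<phi>)"
proof -
  obtain \<pi> where \<pi>: "frege_proof \<pi>" "\<pi> \<noteq> []" "last \<pi> = \<phi>" "length \<pi> \<le> n"
      "\<forall>\<psi> \<in> set \<pi>. num_symbols \<psi> \<le> s"
    using assms(1) by (auto simp: frege_provable_def)
  have "num_symbols (fm_subst \<sigma> \<psi>) \<le> s * M" if "\<psi> \<in> set \<pi>" for \<psi>
    using num_symbols_fm_subst_le[of \<sigma> M \<psi>, OF assms(2)] \<pi>(5) that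
    by (meson le_trans mult_le_mono1)
  with \<pi> frege_proof_map_fm_subst show ?thesis
    unfolding frege_provable_def by (intro exI[of _ "map (fm_subst \<sigma>) \<pi>"]) (auto simp: last_map)
qed

lemma frege_provable_if_derivable: "derivable {} \<phi> \<Longrightarrow> \<exists>K. frege_provable K K \<phi>"
proof (induction rule: derivable.induct)
  case (derivable_axiom \<phi>)
  then show ?case by (intro exI[of _ "num_symbols \<phi>"] frege_provable_axiom) auto
next
  case (derivable_mp \<phi> \<psi>)
  then obtain p q where "frege_provable p p \<phi>" "frege_provable q q (Imp \<phi> \<psi>)" by blast
  then have "frege_provable (p + q + 1) p \<phi>" "frege_provable (p + q + 1) q (Imp \<phi> \<psi>)"
    by (auto elim: frege_provable_mono)
  then show ?case by (blast intro: frege_provable_mp)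
qed simp

lemma min_size_EF_le:
  assumes "frege_provable s n \<phi>" "\<And>a. a \<in> atoms \<phi> \<Longrightarrow> length (enc_nat a) \<le> L"
  shows "min_size EF \<phi> \<le> enat (n * (s * (L + 3)))"
proof -
  text \<open>Atoms that do not occur in \<^term>\<open>\<phi>\<close>, whose names may be long, are replaced by a constant.\<close>
  define \<sigma> where "\<sigma> = (\<lambda>a. if a \<in> atoms \<phi> then At a else Cst True)"
  obtain \<pi> where \<pi>: "frege_proof \<pi>" "\<pi> \<noteq> []" "last \<pi> = \<phi>" "length \<pi> \<le> n"
      "\<forall>\<psi> \<in> set \<pi>. num_symbols \<psi> \<le> s"
    using assms(1) by (auto simp: frege_provable_def)
  let ?\<pi> = "map (fm_subst \<sigma>) \<pi>"
  have "last ?\<pi> = \<phi>"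
    using fm_subst_cong[of \<phi> \<sigma> At] \<pi>(2,3) by (simp add: last_map \<sigma>_def)
  moreover have "ef_derivation ?\<pi>"
    using ef_derivation_if_frege_proof[OF frege_proof_map_fm_subst[OF \<pi>(1)]] \<pi>(2) by simp
  ultimately have "EF (concat (map enc ?\<pi>)) (enc \<phi>)" unfolding EF_def by metis
  then have "min_size EF \<phi> \<le> enat (length (concat (map enc ?\<pi>)))" by (rule min_size_le)
  also have "length (concat (map enc ?\<pi>)) \<le> n * (s * (L + 3))"
  proof -
    have line: "fm_size (fm_subst \<sigma> \<psi>) \<le> s * (L + 3)" if "\<psi> \<in> set \<pi>" for \<psi>
    proof -
      have "fm_size (fm_subst \<sigma> \<psi>) \<le> num_symbols (fm_subst \<sigma> \<psi>) * (L + 3)"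
        using assms(2)
        by (intro fm_size_le_num_symbols) (auto simp: atoms_fm_subst \<sigma>_def split: if_splits)
      also have "num_symbols (fm_subst \<sigma> \<psi>) \<le> num_symbols \<psi> * 1"
        by (rule num_symbols_fm_subst_le) (simp add: \<sigma>_def)
      also have "num_symbols \<psi> * 1 \<le> s" using \<pi>(5) that by simp
      finally show ?thesis by simp
    qed
    have "length (concat (map enc ?\<pi>)) = (\<Sum>\<psi>\<leftarrow>\<pi>. fm_size (fm_subst \<sigma> \<psi>))"
      by (simp add: length_concat comp_def fm_size_def)
    also have "\<dots> \<le> (\<Sum>\<psi>\<leftarrow>\<pi>. s * (L + 3))" by (rule sum_list_mono) (rule line)
    also have "\<dots> = length \<pi> * (s * (L + 3))" by (simp add: sum_list_triv)
    also have "\<dots> \<le> n * (s * (L + 3))" using \<pi>(4) by (rule mult_right_mono) simp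
    finally show ?thesis .
  qed
  finally show ?thesis by simp
qed

section \<open>Entailment with short Frege proofs\<close>

text \<open>One constant serves for all instances of all propositional rules of bounded size, as these are
  finitely many; the rules used below fit into \<open>200\<close> bits. The summand \<open>2\<close> pays for two applications
  of modus ponens.\<close>

definition scheme_cost :: nat where
  "scheme_cost =
     (LEAST K. \<forall>T. tautology T \<and> fm_size T \<le> 200 \<longrightarrow> frege_provable K K T) + 2"

text \<open>The parameter \<^term>\<open>M\<close> bounds the formulas that are combined; measuring proofs in units of
  \<^const>\<open>scheme_cost\<close> turns every rule into a single step.\<close>

definition entails :: "nat \<Rightarrow> nat \<Rightarrow> fm \<Rightarrow> fm \<Rightarrow> bool" where
  "entails M n \<phi> \<psi> \<longleftrightarrow> num_symbols \<phi> \<le> M \<and> num_symbols \<psi> \<le> M \<and>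
     frege_provable (scheme_cost * M) (scheme_cost * n) (Imp \<phi> \<psi>)"

lemma frege_provable_small_tautology:
  assumes "tautology T" "fm_size T \<le> 200"
  shows "frege_provable (scheme_cost - 2) (scheme_cost - 2) T"
proof -
  have "\<exists>K. \<forall>T \<in> S. frege_provable K K T" if "finite S" "\<forall>T \<in> S. tautology T" for S
    using that
  proof (induction S rule: finite_induct)
    case (insert T S)
    then obtain K K' where "\<forall>T \<in> S. frege_provable K K T" "frege_provable K' K' T"
      using frege_provable_if_derivable frege_complete by (metis insert_iff)
    then show ?case
      by (intro exI[of _ "max K K'"]) (auto intro: frege_provable_mono[OF _ max.cobounded1 max.cobounded1]
          frege_provable_mono[OF _ max.cobounded2 max.cobounded2])
  qed simp
  moreover have "finite {T. tautology T \<and> fm_size T \<le> 200}"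
    by (rule finite_subset[OF _ finite_fm_size_le[of 200]]) auto
  ultimately have "\<exists>K. \<forall>T. tautology T \<and> fm_size T \<le> 200 \<longrightarrow> frege_provable K K T"
    by (metis (mono_tags, lifting) mem_Collect_eq)
  from LeastI_ex[OF this] assms show ?thesis by (simp add: scheme_cost_def)
qed

lemma scheme_cost_ge_2: "2 \<le> scheme_cost"
  by (simp add: scheme_cost_def)

lemma frege_provable_scheme:
  assumes "tautology T" "fm_size T \<le> 200" "\<And>a. a \<in> atoms T \<Longrightarrow> num_symbols (\<sigma> a) \<le> M" "1 \<le> M"
  shows "frege_provable (scheme_cost * M) (scheme_cost - 2) (fm_subst \<sigma> T)"
proof -
  define \<sigma>' where "\<sigma>' a = (if a \<in> atoms T then \<sigma> a else Cst True)" for a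
  have "frege_provable ((scheme_cost - 2) * M) (scheme_cost - 2) (fm_subst \<sigma>' T)"
    using assms by (intro frege_provable_fm_subst frege_provable_small_tautology) (auto simp: \<sigma>'_def)
  moreover have "fm_subst \<sigma>' T = fm_subst \<sigma> T"
    by (rule fm_subst_cong) (simp add: \<sigma>'_def)
  ultimately show ?thesis by (auto elim: frege_provable_mono)
qed

lemma frege_provable_discharge_entailments:
  assumes "\<forall>(p, A, B) \<in> set prems. entails M p (fm_subst \<sigma> A) (fm_subst \<sigma> B)"
    and "frege_provable (scheme_cost * M) n (fm_subst \<sigma> (foldr (\<lambda>(p, A, B). Imp (Imp A B)) prems C))"
  shows "frege_provable (scheme_cost * M)
    (n + scheme_cost * (\<Sum>(p, A, B) \<leftarrow> prems. p) + length prems) (fm_subst \<sigma> C)"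
  using assms
proof (induction prems arbitrary: n)
  case (Cons prem prems)
  obtain p A B where prem: "prem = (p, A, B)" by (cases prem)
  have "frege_provable (scheme_cost * M) (scheme_cost * p + n + 1)
      (fm_subst \<sigma> (foldr (\<lambda>(p, A, B). Imp (Imp A B)) prems C))"
    using Cons.prems by (intro frege_provable_mp) (auto simp: prem entails_def)
  from Cons.IH[OF _ this] Cons.prems(1) show ?case
    by (simp add: prem algebra_simps)
qed simp

lemma entails_scheme:
  fixes prems :: "(nat \<times> fm \<times> fm) list" and S T :: fm
  defines "rule \<equiv> foldr (\<lambda>(p, A, B). Imp (Imp A B)) prems (Imp S T)"
  assumes "length prems \<le> 2" "\<forall>(p, A, B) \<in> set prems. entails M p (fm_subst \<sigma> A) (fm_subst \<sigma> B)"
    and "tautology rule" "fm_size rule \<le> 200"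
    and "num_symbols (fm_subst \<sigma> S) \<le> M" "num_symbols (fm_subst \<sigma> T) \<le> M"
  shows "entails M ((\<Sum>(p, A, B) \<leftarrow> prems. p) + 1) (fm_subst \<sigma> S) (fm_subst \<sigma> T)"
proof -
  let ?K = scheme_cost and ?p = "\<Sum>(p, A, B) \<leftarrow> prems. p"
  have atoms_rule: "a \<in> atoms S \<union> atoms T \<union> (\<Union>(p, A, B) \<in> set prems. atoms A \<union> atoms B)"
    if "a \<in> atoms rule" for a
    using that unfolding rule_def by (induction prems) auto
  have "frege_provable (?K * M) (?K - 2) (fm_subst \<sigma> rule)"
  proof (rule frege_provable_scheme)
    show "num_symbols (\<sigma> a) \<le> M" if "a \<in> atoms rule" for a
      using atoms_rule[OF that] num_symbols_le_fm_subst[of a _ \<sigma>] assms(3,6,7)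
      by (fastforce simp: entails_def intro: le_trans)
    show "1 \<le> M" using assms(6) num_symbols_pos(2)[of "fm_subst \<sigma> S"] by linarith
  qed (fact assms)+
  then have "frege_provable (?K * M) (?K - 2 + ?K * ?p + length prems) (fm_subst \<sigma> (Imp S T))"
    unfolding rule_def by (rule frege_provable_discharge_entailments[OF assms(3)])
  moreover have "?K - 2 + ?K * ?p + length prems \<le> ?K * (?p + 1)"
    using assms(2) scheme_cost_ge_2 by simp
  ultimately show ?thesis
    using assms(6,7) by (auto simp: entails_def elim: frege_provable_mono)
qed

lemma entails_mono: "entails M p \<phi> \<psi> \<Longrightarrow> p \<le> q \<Longrightarrow> entails M q \<phi> \<psi>"
  by (auto simp: entails_def elim!: frege_provable_mono)

lemma entails_rename:
  assumes "entails M p \<phi> \<psi>"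
  shows "entails M p (rename f \<phi>) (rename f \<psi>)"
  using assms frege_provable_fm_subst[of "scheme_cost * M" "scheme_cost * p" "Imp \<phi> \<psi>" "\<lambda>a. At (f a)" 1]
  by (simp add: entails_def rename_eq_fm_subst[symmetric])

lemma entails_sound: "entails M p \<phi> \<psi> \<Longrightarrow> tautology (Imp \<phi> \<psi>)"
  unfolding entails_def by (blast intro: frege_provable_sound)

subsection \<open>Derived rules\<close>

definition subst3 :: "fm \<Rightarrow> fm \<Rightarrow> fm \<Rightarrow> nat \<Rightarrow> fm" where
  "subst3 A B C a = (if a = 0 then A else if a = 1 then B else C)"

lemma subst3_simps [simp]:
  "subst3 A B C 0 = A" "subst3 A B C (Suc 0) = B" "subst3 A B C 2 = C"
  by (simp_all add: subst3_def)

lemmas scheme_simps = tautology_def enc_nat.simps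

abbreviation (input) "X\<^sub>0 \<equiv> At (0::nat)"
abbreviation (input) "X\<^sub>1 \<equiv> At (1::nat)"
abbreviation (input) "X\<^sub>2 \<equiv> At (2::nat)"

lemma entails_size: "entails M p A B \<Longrightarrow> num_symbols A \<le> M \<and> num_symbols B \<le> M"
  by (simp add: entails_def)

lemma entails_refl: "num_symbols A \<le> M \<Longrightarrow> entails M 1 A A"
  using entails_scheme[of "[]" M "subst3 A A A" X\<^sub>0 X\<^sub>0]
  by (auto simp: scheme_simps dest: entails_size)

lemma entails_True: "num_symbols A \<le> M \<Longrightarrow> entails M 1 A (Cst True)"
  using entails_scheme[of "[]" M "subst3 A A A" X\<^sub>0 "Cst True"]
  by (auto simp: scheme_simps intro: le_trans[OF num_symbols_pos(2)])

lemma entails_False: "num_symbols A \<le> M \<Longrightarrow> entails M 1 (Cst False) A"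
  using entails_scheme[of "[]" M "subst3 A A A" "Cst False" X\<^sub>0]
  by (auto simp: scheme_simps intro: le_trans[OF num_symbols_pos(2)])

lemma entails_Con1: "num_symbols (Con A B) \<le> M \<Longrightarrow> entails M 1 (Con A B) A"
  using entails_scheme[of "[]" M "subst3 A B B" "Con X\<^sub>0 X\<^sub>1" X\<^sub>0]
  by (auto simp: scheme_simps dest: entails_size)

lemma entails_Con2: "num_symbols (Con A B) \<le> M \<Longrightarrow> entails M 1 (Con A B) B"
  using entails_scheme[of "[]" M "subst3 A B B" "Con X\<^sub>0 X\<^sub>1" X\<^sub>1]
  by (auto simp: scheme_simps dest: entails_size)

lemma entails_Dis1: "num_symbols (Dis A B) \<le> M \<Longrightarrow> entails M 1 A (Dis A B)"
  using entails_scheme[of "[]" M "subst3 A B B" X\<^sub>0 "Dis X\<^sub>0 X\<^sub>1"]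
  by (auto simp: scheme_simps dest: entails_size)

lemma entails_Dis2: "num_symbols (Dis A B) \<le> M \<Longrightarrow> entails M 1 B (Dis A B)"
  using entails_scheme[of "[]" M "subst3 A B B" X\<^sub>1 "Dis X\<^sub>0 X\<^sub>1"]
  by (auto simp: scheme_simps dest: entails_size)

lemma entails_trans: "entails M p A B \<Longrightarrow> entails M q B C \<Longrightarrow> entails M (p + q + 1) A C"
  using entails_scheme[of "[(p, X\<^sub>0, X\<^sub>1), (q, X\<^sub>1, X\<^sub>2)]" M "subst3 A B C" X\<^sub>0 X\<^sub>2]
  by (auto simp: scheme_simps dest: entails_size)

lemma entails_ConI:
  "entails M p A B \<Longrightarrow> entails M q A C \<Longrightarrow> num_symbols (Con B C) \<le> M \<Longrightarrow>
   entails M (p + q + 1) A (Con B C)"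
  using entails_scheme[of "[(p, X\<^sub>0, X\<^sub>1), (q, X\<^sub>0, X\<^sub>2)]" M "subst3 A B C" X\<^sub>0 "Con X\<^sub>1 X\<^sub>2"]
  by (auto simp: scheme_simps dest: entails_size)

lemma entails_DisE:
  "entails M p A C \<Longrightarrow> entails M q B C \<Longrightarrow> num_symbols (Dis A B) \<le> M \<Longrightarrow>
   entails M (p + q + 1) (Dis A B) C"
  using entails_scheme[of "[(p, X\<^sub>0, X\<^sub>2), (q, X\<^sub>1, X\<^sub>2)]" M "subst3 A B C" "Dis X\<^sub>0 X\<^sub>1" X\<^sub>2]
  by (auto simp: scheme_simps dest: entails_size)

lemma entails_cases:
  "entails M p (Con A B) C \<Longrightarrow> entails M q (Con A (Neg B)) C \<Longrightarrow> entails M (p + q + 1) A C"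
  using entails_scheme[of "[(p, Con X\<^sub>0 X\<^sub>1, X\<^sub>2), (q, Con X\<^sub>0 (Neg X\<^sub>1), X\<^sub>2)]" M "subst3 A B C" X\<^sub>0 X\<^sub>2]
    entails_size[of M p "Con A B" C]
  by (auto simp: scheme_simps)

lemma entails_ImpE:
  "entails M p (Neg C) A \<Longrightarrow> entails M q B C \<Longrightarrow> num_symbols (Imp A B) \<le> M \<Longrightarrow>
   entails M (p + q + 1) (Imp A B) C"
  using entails_scheme[of "[(p, Neg X\<^sub>2, X\<^sub>0), (q, X\<^sub>1, X\<^sub>2)]" M "subst3 A B C" "Imp X\<^sub>0 X\<^sub>1" X\<^sub>2]
  by (auto simp: scheme_simps dest: entails_size)

lemma entails_ImpD1:
  "entails M p (Imp A B) C \<Longrightarrow> num_symbols (Neg C) \<le> M \<Longrightarrow> entails M (p + 1) (Neg C) A"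
  using entails_scheme[of "[(p, Imp X\<^sub>0 X\<^sub>1, X\<^sub>2)]" M "subst3 A B C" "Neg X\<^sub>2" X\<^sub>0]
    entails_size[of M p "Imp A B" C]
  by (auto simp: scheme_simps)

lemma entails_ImpD2: "entails M p (Imp A B) C \<Longrightarrow> entails M (p + 1) B C"
  using entails_scheme[of "[(p, Imp X\<^sub>0 X\<^sub>1, X\<^sub>2)]" M "subst3 A B C" X\<^sub>1 X\<^sub>2]
  by (auto simp: scheme_simps dest: entails_size)

lemma entails_if_True_entails_Imp: "entails M p (Cst True) (Imp A B) \<Longrightarrow> entails M (p + 1) A B"
  using entails_scheme[of "[(p, Cst True, Imp X\<^sub>0 X\<^sub>1)]" M "subst3 A B B" X\<^sub>0 X\<^sub>1]
  by (auto simp: scheme_simps dest: entails_size)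

lemma length_le_num_symbols_Disj: "length \<Psi> \<le> num_symbols (Disj \<Psi>)"
  by (induction \<Psi> rule: Disj.induct) (auto simp: Suc_le_eq)

lemma num_symbols_le_Conj: "\<psi> \<in> set \<Psi> \<Longrightarrow> num_symbols \<psi> \<le> num_symbols (Conj \<Psi>)"
  by (induction \<Psi> rule: Conj.induct) auto

lemma num_symbols_le_Disj: "\<psi> \<in> set \<Psi> \<Longrightarrow> num_symbols \<psi> \<le> num_symbols (Disj \<Psi>)"
  by (induction \<Psi> rule: Disj.induct) auto

lemma entails_ConjI:
  assumes "num_symbols A \<le> M" "num_symbols (Conj \<Psi>) \<le> M" "\<And>\<psi>. \<psi> \<in> set \<Psi> \<Longrightarrow> entails M p A \<psi>"
  shows "entails M (num_symbols (Conj \<Psi>) * (p + 1)) A (Conj \<Psi>)"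
  using assms(2,3)
proof (induction \<Psi> rule: Conj.induct)
  case 1
  show ?case using entails_mono[OF entails_True[OF assms(1)]] by simp
next
  case (2 \<phi>)
  have "p \<le> num_symbols \<phi> * (p + 1)"
    using mult_le_mono1[OF num_symbols_pos(2), of "p + 1" \<phi>] by simp
  with 2 show ?case by (auto elim: entails_mono)
next
  case (3 \<phi> \<psi> \<Phi>)
  then have "entails M (p + num_symbols (Conj (\<psi> # \<Phi>)) * (p + 1) + 1) A (Con \<phi> (Conj (\<psi> # \<Phi>)))"
    by (intro entails_ConI) auto
  then show ?case
    unfolding Conj.simps
    by (rule entails_mono) (use num_symbols_pos(2)[of \<phi>] in \<open>simp add: algebra_simps\<close>)
qed

lemma entails_DisjE:
  assumes "num_symbols A \<le> M" "num_symbols (Disj \<Psi>) \<le> M" "\<And>\<psi>. \<psi> \<in> set \<Psi> \<Longrightarrow> entails M p \<psi> A"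
  shows "entails M (num_symbols (Disj \<Psi>) * (p + 1)) (Disj \<Psi>) A"
  using assms(2,3)
proof (induction \<Psi> rule: Disj.induct)
  case 1
  show ?case using entails_mono[OF entails_False[OF assms(1)]] by simp
next
  case (2 \<phi>)
  have "p \<le> num_symbols \<phi> * (p + 1)"
    using mult_le_mono1[OF num_symbols_pos(2), of "p + 1" \<phi>] by simp
  with 2 show ?case by (auto elim: entails_mono)
next
  case (3 \<phi> \<psi> \<Phi>)
  then have "entails M (p + num_symbols (Disj (\<psi> # \<Phi>)) * (p + 1) + 1) (Dis \<phi> (Disj (\<psi> # \<Phi>))) A"
    by (intro entails_DisE) auto
  then show ?case
    unfolding Disj.simps
    by (rule entails_mono) (use num_symbols_pos(2)[of \<phi>] in \<open>simp add: algebra_simps\<close>)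
qed

lemma entails_ConjD:
  "\<psi> \<in> set \<Psi> \<Longrightarrow> num_symbols (Conj \<Psi>) \<le> M \<Longrightarrow> entails M (num_symbols (Conj \<Psi>)) (Conj \<Psi>) \<psi>"
proof (induction \<Psi> rule: Conj.induct)
  case (2 \<phi>)
  then show ?case using entails_mono[OF entails_refl[of \<phi> M]] by simp
next
  case (3 \<phi> \<chi> \<Phi>)
  let ?T = "Conj (\<chi> # \<Phi>)"
  have size: "num_symbols (Con \<phi> ?T) \<le> M" using 3 by simp
  consider "\<psi> = \<phi>" | "\<psi> \<in> set (\<chi> # \<Phi>)" using 3 by auto
  then show ?case
  proof cases
    case 1
    with entails_mono[OF entails_Con1[OF size]] show ?thesis by simp
  next
    case 2
    with 3 have "entails M (1 + num_symbols ?T + 1) (Con \<phi> ?T) \<psi>"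
      by (intro entails_trans[OF entails_Con2[OF size]]) auto
    then show ?thesis unfolding Conj.simps by (rule entails_mono) simp
  qed
qed simp

lemma entails_DisjI:
  "\<psi> \<in> set \<Psi> \<Longrightarrow> num_symbols (Disj \<Psi>) \<le> M \<Longrightarrow> entails M (num_symbols (Disj \<Psi>)) \<psi> (Disj \<Psi>)"
proof (induction \<Psi> rule: Disj.induct)
  case (2 \<phi>)
  then show ?case using entails_mono[OF entails_refl[of \<phi> M]] by simp
next
  case (3 \<phi> \<chi> \<Phi>)
  let ?T = "Disj (\<chi> # \<Phi>)"
  have size: "num_symbols (Dis \<phi> ?T) \<le> M" using 3 by simp
  consider "\<psi> = \<phi>" | "\<psi> \<in> set (\<chi> # \<Phi>)" using 3 by auto
  then show ?case
  proof cases
    case 1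
    with entails_mono[OF entails_Dis1[OF size]] show ?thesis by simp
  next
    case 2
    with 3 have "entails M (num_symbols ?T + 1 + 1) \<psi> (Dis \<phi> ?T)"
      by (intro entails_trans[OF _ entails_Dis2[OF size]]) auto
    then show ?thesis unfolding Disj.simps by (rule entails_mono) simp
  qed
qed simp

lemma entails_Imp_Conj_Disj:
  assumes size: "num_symbols (Imp (Conj \<Delta>) (Disj \<Omega>)) \<le> M" "num_symbols (Neg Y) \<le> M"
    and Y: "\<And>s. s \<in> S \<Longrightarrow> entails M p (Imp (Conj (D s)) (Disj (E s))) Y"
    and \<Delta>: "\<And>\<delta>. \<delta> \<in> set \<Delta> \<Longrightarrow> entails M p (Cst True) \<delta> \<or> (\<exists>s \<in> S. \<exists>\<delta>' \<in> set (D s). entails M p \<delta>' \<delta>)"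
    and \<Omega>: "\<And>\<omega>. \<omega> \<in> set \<Omega> \<Longrightarrow> entails M p \<omega> (Cst False) \<or> (\<exists>s \<in> S. \<exists>\<omega>' \<in> set (E s). entails M p \<omega> \<omega>')"
  shows "entails M (M * (2 * p + M + 4)) (Imp (Conj \<Delta>) (Disj \<Omega>)) Y"
proof -
  let ?q = "2 * p + M + 3"
  have conjunct: "entails M ?q (Neg Y) \<delta>" if "\<delta> \<in> set \<Delta>" for \<delta>
    using \<Delta>[OF that]
  proof (elim disjE bexE)
    assume "entails M p (Cst True) \<delta>"
    from entails_trans[OF entails_True[OF size(2)] this] show ?thesis
      by (rule entails_mono) simp
  next
    fix s \<delta>' assume s: "s \<in> S" "\<delta>' \<in> set (D s)" and \<delta>': "entails M p \<delta>' \<delta>"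
    have sizeD: "num_symbols (Conj (D s)) \<le> M" using entails_size[OF Y[OF s(1)]] by simp
    from entails_trans[OF entails_trans[OF entails_ImpD1[OF Y[OF s(1)] size(2)]
          entails_ConjD[OF s(2) sizeD]] \<delta>']
    show ?thesis by (rule entails_mono) (use sizeD in simp)
  qed
  have disjunct: "entails M ?q \<omega> Y" if "\<omega> \<in> set \<Omega>" for \<omega>
    using \<Omega>[OF that]
  proof (elim disjE bexE)
    assume "entails M p \<omega> (Cst False)"
    moreover have "num_symbols Y \<le> M" using size(2) by simp
    ultimately have "entails M (p + 1 + 1) \<omega> Y" by (intro entails_trans[OF _ entails_False])
    then show ?thesis by (rule entails_mono) simp
  next
    fix s \<omega>' assume s: "s \<in> S" "\<omega>' \<in> set (E s)" and \<omega>': "entails M p \<omega> \<omega>'"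
    have sizeE: "num_symbols (Disj (E s)) \<le> M" using entails_size[OF Y[OF s(1)]] by simp
    from entails_trans[OF \<omega>' entails_trans[OF entails_DisjI[OF s(2) sizeE] entails_ImpD2[OF Y[OF s(1)]]]]
    show ?thesis by (rule entails_mono) (use sizeE in simp)
  qed
  let ?d = "num_symbols (Conj \<Delta>)" and ?w = "num_symbols (Disj \<Omega>)"
  have "entails M (?d * (?q + 1) + ?w * (?q + 1) + 1) (Imp (Conj \<Delta>) (Disj \<Omega>)) Y"
    using size by (intro entails_ImpE entails_ConjI entails_DisjE conjunct disjunct) auto
  then show ?thesis
  proof (rule entails_mono)
    have "?d * (?q + 1) + ?w * (?q + 1) + 1 \<le> (?d + ?w + 1) * (?q + 1)"
      by (simp add: algebra_simps)
    also have "\<dots> \<le> M * (?q + 1)" using size(1) by (intro mult_right_mono) auto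
    finally show "?d * (?q + 1) + ?w * (?q + 1) + 1 \<le> M * (2 * p + M + 4)"
      by (simp add: algebra_simps)
  qed
qed

subsection \<open>Formulas decided by few atoms\<close>

text \<open>Kleene's strong three-valued evaluation. A formula that it makes true under all assignments
  to a bounded number of atoms has short proofs, no matter how many other atoms it contains.\<close>

fun kleene_eval :: "('a \<Rightarrow> bool option) \<Rightarrow> 'a form \<Rightarrow> bool option" where
  "kleene_eval e (Cst b) = Some b"
| "kleene_eval e (At a) = e a"
| "kleene_eval e (Neg \<phi>) = map_option Not (kleene_eval e \<phi>)"
| "kleene_eval e (Con \<phi> \<psi>) =
     (if kleene_eval e \<phi> = Some False \<or> kleene_eval e \<psi> = Some False then Some False
      else if kleene_eval e \<phi> = Some True \<and> kleene_eval e \<psi> = Some True then Some True else None)"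
| "kleene_eval e (Dis \<phi> \<psi>) =
     (if kleene_eval e \<phi> = Some True \<or> kleene_eval e \<psi> = Some True then Some True
      else if kleene_eval e \<phi> = Some False \<and> kleene_eval e \<psi> = Some False then Some False else None)"
| "kleene_eval e (Imp \<phi> \<psi>) =
     (if kleene_eval e \<phi> = Some False \<or> kleene_eval e \<psi> = Some True then Some True
      else if kleene_eval e \<phi> = Some True \<and> kleene_eval e \<psi> = Some False then Some False else None)"

fun known :: "bool option \<Rightarrow> 'a form \<Rightarrow> 'a form" where
  "known None \<phi> = Cst True"
| "known (Some b) \<phi> = literal b \<phi>"

lemma num_symbols_known_le: "num_symbols \<phi> < M \<Longrightarrow> num_symbols (known v \<phi>) \<le> M"
  by (cases v) (auto simp: literal_def Suc_le_eq)

lemma fm_subst_known [simp]: "fm_subst \<sigma> (known v \<phi>) = known v (fm_subst \<sigma> \<phi>)"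
  by (cases v) (auto simp: literal_def)

lemma fm_size_known_le: "fm_size (known v \<phi>) \<le> fm_size \<phi> + 3"
  by (cases v) (auto simp: literal_def)

lemma fm_eval_known: "fm_eval e (known v \<phi>) \<longleftrightarrow> v = None \<or> v = Some (fm_eval e \<phi>)"
  by (cases v) (auto simp: literal_def)

lemma entails_known:
  assumes "entails M p H (known v \<phi>)" "entails M q H (known w \<psi>)"
    and "\<And>e. fm_eval e (known v X\<^sub>1) \<Longrightarrow> fm_eval e (known w X\<^sub>2) \<Longrightarrow> fm_eval e (known u T)"
    and "fm_size T \<le> 20" "num_symbols (fm_subst (subst3 H \<phi> \<psi>) T) < M"
  shows "entails M (p + q + 1) H (known u (fm_subst (subst3 H \<phi> \<psi>) T))"
  using entails_scheme[of "[(p, X\<^sub>0, known v X\<^sub>1), (q, X\<^sub>0, known w X\<^sub>2)]" M "subst3 H \<phi> \<psi>" X\<^sub>0 "known u T"]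
    assms entails_size[OF assms(1)] num_symbols_known_le[OF assms(5)] 
    fm_size_known_le[of v X\<^sub>1] fm_size_known_le[of w X\<^sub>2] fm_size_known_le[of u T]
  by (simp add: scheme_simps)

lemma entails_kleene:
  assumes known_atoms: "\<And>a. entails M p H (known (e a) (At a))"
  shows "num_symbols \<phi> < M \<Longrightarrow>
    entails M (num_symbols \<phi> * (p + 1)) H (known (kleene_eval e \<phi>) \<phi>)"
proof (induction \<phi>)
  case (Cst b)
  have "entails M 1 H (known (Some b) (Cst b))"
    using entails_scheme[of "[]" M "subst3 H H H" X\<^sub>0 "known (Some b) (Cst b)"]
      entails_size[OF known_atoms] num_symbols_known_le[OF Cst, of "Some b"]
    by (auto simp: scheme_simps literal_def)
  then show ?case by (auto elim: entails_mono)
next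
  case (At a)
  from entails_mono[OF known_atoms] show ?case by simp
next
  case (Neg \<phi>)
  let ?v = "kleene_eval e \<phi>" and ?p = "num_symbols \<phi> * (p + 1)"
  have "fm_size (known ?v X\<^sub>1) \<le> 20" "fm_size (known (map_option Not ?v) (Neg X\<^sub>1)) \<le> 20"
    using fm_size_known_le[of ?v X\<^sub>1] fm_size_known_le[of "map_option Not ?v" "Neg X\<^sub>1"]
    by (simp_all add: scheme_simps)
  with Neg have "entails M (?p + 1) H (known (map_option Not ?v) (Neg \<phi>))"
    using entails_scheme[of "[(?p, X\<^sub>0, known ?v X\<^sub>1)]" M "subst3 H \<phi> \<phi>" X\<^sub>0
        "known (map_option Not ?v) (Neg X\<^sub>1)"]
      entails_size[OF known_atoms] num_symbols_known_le[OF Neg.prems]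
    by (auto simp: scheme_simps fm_eval_known map_option_case split: option.splits)
  then show ?case by (auto elim: entails_mono)
next
  case (Con \<phi> \<psi>)
  then have "entails M (num_symbols \<phi> * (p + 1) + num_symbols \<psi> * (p + 1) + 1) H
      (known (kleene_eval e (Con \<phi> \<psi>)) (fm_subst (subst3 H \<phi> \<psi>) (Con X\<^sub>1 X\<^sub>2)))"
    by (intro entails_known) (auto simp: fm_eval_known scheme_simps split: if_splits)
  from entails_mono[OF this] show ?case by (simp add: algebra_simps del: kleene_eval.simps)
next
  case (Dis \<phi> \<psi>)
  then have "entails M (num_symbols \<phi> * (p + 1) + num_symbols \<psi> * (p + 1) + 1) H
      (known (kleene_eval e (Dis \<phi> \<psi>)) (fm_subst (subst3 H \<phi> \<psi>) (Dis X\<^sub>1 X\<^sub>2)))"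
    by (intro entails_known) (auto simp: fm_eval_known scheme_simps split: if_splits)
  from entails_mono[OF this] show ?case by (simp add: algebra_simps del: kleene_eval.simps)
next
  case (Imp \<phi> \<psi>)
  then have "entails M (num_symbols \<phi> * (p + 1) + num_symbols \<psi> * (p + 1) + 1) H
      (known (kleene_eval e (Imp \<phi> \<psi>)) (fm_subst (subst3 H \<phi> \<psi>) (Imp X\<^sub>1 X\<^sub>2)))"
    by (intro entails_known) (auto simp: fm_eval_known scheme_simps split: if_splits)
  from entails_mono[OF this] show ?case by (simp add: algebra_simps del: kleene_eval.simps)
qed

lemma entails_kleene_cases:
  assumes "\<And>a. entails M p H (known (e a) (At a))"
    and "num_symbols H + 3 * length xs \<le> M" "num_symbols \<phi> < M"
    and "\<And>f. kleene_eval (\<lambda>a. if a \<in> set xs then Some (f a) else e a) \<phi> = Some True"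
  shows "entails M (2 ^ length xs * (num_symbols \<phi> * (p + 2 * length xs + 1) + length xs)) H \<phi>"
  using assms
proof (induction xs arbitrary: e p H)
  case Nil
  then show ?case using entails_kleene[of M p H e \<phi>] by (simp add: literal_def)
next
  case (Cons x xs)
  let ?s = "num_symbols \<phi> * (p + 2 + 2 * length xs + 1) + length xs"
  have case_x: "entails M (2 ^ length xs * ?s) (Con H (literal v (At x))) \<phi>" for v
  proof (rule Cons.IH[where e = "e(x := Some v)"])
    have size: "num_symbols (Con H (literal v (At x))) \<le> M"
      using Cons.prems(2) by (auto simp: literal_def)
    show "entails M (p + 2) (Con H (literal v (At x))) (known ((e(x := Some v)) a) (At a))" for a
    proof (cases "a = x")
      case True
      with entails_mono[OF entails_Con2[OF size]] show ?thesis by simp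
    next
      case False
      with entails_mono[OF entails_trans[OF entails_Con1[OF size] Cons.prems(1)]] show ?thesis by simp
    qed
    show "num_symbols (Con H (literal v (At x))) + 3 * length xs \<le> M"
      using Cons.prems(2) by (auto simp: literal_def)
    show "num_symbols \<phi> < M" by fact
    fix f
    have "(\<lambda>a. if a \<in> set xs then Some (f a) else (e(x := Some v)) a) =
      (\<lambda>a. if a \<in> set (x # xs) then Some ((if x \<in> set xs then f else f(x := v)) a) else e a)"
      by (auto simp: fun_eq_iff)
    then show "kleene_eval (\<lambda>a. if a \<in> set xs then Some (f a) else (e(x := Some v)) a) \<phi> = Some True"
      using Cons.prems(4) by presburger
  qed
  have "entails M (2 ^ length xs * ?s + 2 ^ length xs * ?s + 1) H \<phi>"
    using case_x[of True] case_x[of False]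
    by (intro entails_cases[of _ _ _ "At x"]) (simp_all add: literal_def)
  then show ?case
  proof (rule entails_mono)
    have "1 \<le> 2 ^ length (x # xs) * (1::nat)" by simp
    then show "2 ^ length xs * ?s + 2 ^ length xs * ?s + 1 \<le>
      2 ^ length (x # xs) * (num_symbols \<phi> * (p + 2 * length (x # xs) + 1) + length (x # xs))"
      by (simp add: algebra_simps)
  qed
qed

text \<open>The summand \<^term>\<open>10::nat\<close> makes room for the hypotheses on three atoms in the case distinction.\<close>

lemma entails_if_kleene:
  assumes "length xs \<le> 3" "num_symbols (Imp \<phi> \<psi>) + 10 \<le> M"
    and "\<And>f. kleene_eval (\<lambda>a. if a \<in> set xs then Some (f a) else None) (Imp \<phi> \<psi>) = Some True"
  shows "entails M (64 * M) \<phi> \<psi>"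
proof -
  let ?l = "length xs" and ?s = "num_symbols (Imp \<phi> \<psi>)"
  have "entails M (2 ^ ?l * (?s * (1 + 2 * ?l + 1) + ?l)) (Cst True) (Imp \<phi> \<psi>)"
  proof (rule entails_kleene_cases)
    show "entails M 1 (Cst True) (known None (At a))" for a :: nat
      using entails_refl[of "Cst True" M] assms(2) by simp
  qed (use assms in simp_all)
  then have "entails M (2 ^ ?l * (?s * (1 + 2 * ?l + 1) + ?l) + 1) \<phi> \<psi>"
    by (rule entails_if_True_entails_Imp)
  then show ?thesis
  proof (rule entails_mono)
    have "(2::nat) ^ ?l \<le> 2 ^ 3" using assms(1) by (intro power_increasing) auto
    then have "2 ^ ?l * (?s * (1 + 2 * ?l + 1) + ?l) \<le> 8 * (?s * 8 + 3)"
      using assms(1) by (intro mult_mono add_mono) auto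
    also have "8 * (?s * 8 + 3) < 64 * M" using assms(2) by simp
    finally show "2 ^ ?l * (?s * (1 + 2 * ?l + 1) + ?l) + 1 \<le> 64 * M" by simp
  qed
qed

section \<open>The formulas \<open>\<tau>\<close>\<close>

lemma inst_Conj: "inst \<theta> (Conj xs) = Conj (map (inst \<theta>) xs)"
  by (induction xs rule: Conj.induct) auto

lemma inst_Disj: "inst \<theta> (Disj xs) = Disj (map (inst \<theta>) xs)"
  by (induction xs rule: Disj.induct) auto

lemma rename_Conj: "rename f (Conj xs) = Conj (map (rename f) xs)"
  by (induction xs rule: Conj.induct) auto

lemma rename_Disj: "rename f (Disj xs) = Disj (map (rename f) xs)"
  by (induction xs rule: Disj.induct) auto

lemma atoms_Conj: "atoms (Conj xs) = (\<Union>x \<in> set xs. atoms x)"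
  by (induction xs rule: Conj.induct) auto

lemma atoms_Disj: "atoms (Disj xs) = (\<Union>x \<in> set xs. atoms x)"
  by (induction xs rule: Disj.induct) auto

lemma atoms_literal [simp]: "atoms (literal b \<phi>) = atoms \<phi>"
  by (simp add: literal_def)

lemma inst_rename: "(\<And>x. x \<in> atoms \<phi> \<Longrightarrow> \<theta> (f x) = \<eta> x) \<Longrightarrow> inst \<theta> (rename f \<phi>) = rename f (inst \<eta> \<phi>)"
  by (induction \<phi>) (auto split: option.splits)

lemma atoms_inst: "atoms (inst \<theta> \<phi>) \<subseteq> atoms \<phi>"
  by (induction \<phi>) (auto split: option.splits)

definition def_fms :: "defseq \<Rightarrow> fm list" where
  "def_fms D = map (\<lambda>i. Iff (At (arity D + i)) (defs D ! i)) [0..<length (defs D)]"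

definition out_fms :: "defseq \<Rightarrow> bool list \<Rightarrow> fm list" where
  "out_fms D b = map2 (\<lambda>\<phi> \<beta>. literal (\<not> \<beta>) \<phi>) (outs D) b"

lemma tau_eq: "tau D b = Imp (Conj (def_fms D)) (Disj (out_fms D b))"
proof -
  have "(\<lambda>(\<phi> :: fm) \<beta>. literal (\<not> \<beta>) \<phi>) = (\<lambda>\<phi> \<beta>. if \<beta> then Neg \<phi> else \<phi>)"
    by (simp add: fun_eq_iff literal_def)
  then show ?thesis by (simp add: tau_def def_fms_def out_fms_def)
qed

definition wf_defseq :: "defseq \<Rightarrow> bool" where
  "wf_defseq D \<longleftrightarrow> (\<forall>\<phi> \<in> set (defs D) \<union> set (outs D). atoms \<phi> \<subseteq> {..<num_atoms D})"

lemma atoms_tau: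
  assumes "wf_defseq D"
  shows "atoms (tau D b) \<subseteq> {..<num_atoms D}"
proof -
  have "atoms \<phi> \<subseteq> {..<num_atoms D}" if mem: "\<phi> \<in> set (def_fms D)" for \<phi>
  proof -
    obtain i where i: "i < length (defs D)" "\<phi> = Iff (At (arity D + i)) (defs D ! i)"
      using mem by (auto simp: def_fms_def)
    then have "atoms (defs D ! i) \<subseteq> {..<num_atoms D}" using assms by (simp add: wf_defseq_def)
    with i show ?thesis by (simp add: Iff_def num_atoms_def)
  qed
  moreover have "atoms \<phi> \<subseteq> {..<num_atoms D}" if "\<phi> \<in> set (out_fms D b)" for \<phi>
    using that assms by (fastforce simp: out_fms_def wf_defseq_def dest!: set_zip_leftD)
  ultimately show ?thesis unfolding tau_eq form.set atoms_Conj atoms_Disj by blast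
qed

lemma fm_size_Conj_le: "fm_size (Conj xs) \<le> (\<Sum>x\<leftarrow>xs. fm_size x + 3) + 3"
  by (induction xs rule: Conj.induct) auto

lemma fm_size_Disj_le: "fm_size (Disj xs) \<le> (\<Sum>x\<leftarrow>xs. fm_size x + 3) + 3"
  by (induction xs rule: Disj.induct) auto

lemma length_le_sum_list_fm_size: "length xs \<le> sum_list (map fm_size xs)"
proof (induction xs)
  case (Cons \<phi> xs)
  have "1 \<le> fm_size \<phi>" by (cases \<phi>) auto
  with Cons show ?case by simp
qed simp

lemma fm_size_tau_le:
  "fm_size (tau D b) \<le> defseq_size D * (4 * (arity D + defseq_size D) + 18) + 9"
proof -
  let ?s = "defseq_size D" and ?A = "num_atoms D"
  have lengths: "length (defs D) + length (outs D) \<le> ?s"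
    using length_le_sum_list_fm_size[of "defs D"] length_le_sum_list_fm_size[of "outs D"]
    by (simp add: defseq_size_def)
  have def_fm: "fm_size (Iff (At (arity D + i)) (defs D ! i)) + 3 \<le> 2 * fm_size (defs D ! i) + (4 * ?A + 16)"
    if "i < length (defs D)" for i
    using length_enc_nat_le[of "arity D + i"] that by (simp add: Iff_def num_atoms_def)
  have "fm_size (Conj (def_fms D)) \<le>
      (\<Sum>i\<leftarrow>[0..<length (defs D)]. fm_size (Iff (At (arity D + i)) (defs D ! i)) + 3) + 3"
    using fm_size_Conj_le[of "def_fms D"] by (simp add: def_fms_def comp_def)
  also have "\<dots> \<le> (\<Sum>i\<leftarrow>[0..<length (defs D)]. 2 * fm_size (defs D ! i) + (4 * ?A + 16)) + 3"
    by (intro add_mono sum_list_mono def_fm) auto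
  also have "\<dots> = 2 * (\<Sum>i\<leftarrow>[0..<length (defs D)]. fm_size (defs D ! i)) + length (defs D) * (4 * ?A + 16) + 3"
    by (simp add: sum_list_addf sum_list_const_mult sum_list_triv add_mult_distrib2)
  also have "map (\<lambda>i. fm_size (defs D ! i)) [0..<length (defs D)] = map fm_size (defs D)"
    by (rule nth_equalityI) auto
  finally have "fm_size (Conj (def_fms D)) \<le>
      2 * sum_list (map fm_size (defs D)) + length (defs D) * (4 * ?A + 16) + 3" .
  moreover have "fm_size (Disj (out_fms D b)) \<le>
      sum_list (map fm_size (outs D)) + length (outs D) * 6 + 3"
  proof -
    have "(\<Sum>x\<leftarrow>map2 (\<lambda>\<phi> \<beta>. literal (\<not> \<beta>) \<phi>) xs ys. fm_size x + 3) \<le> sum_list (map fm_size xs) + length xs * 6"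
      for xs :: "fm list" and ys
      by (induction xs ys rule: list_induct2') (auto simp: literal_def)
    then show ?thesis
      using fm_size_Disj_le[of "out_fms D b"] unfolding out_fms_def by (meson add_le_mono1 le_trans)
  qed
  ultimately have "fm_size (tau D b) \<le>
      2 * ?s + (length (defs D) * (4 * ?A + 16) + length (outs D) * 6) + 9"
    unfolding tau_eq defseq_size_def by simp
  also have "\<dots> \<le> 2 * ?s + (length (defs D) + length (outs D)) * (4 * ?A + 16) + 9"
    by (simp add: algebra_simps)
  also have "\<dots> \<le> 2 * ?s + ?s * (4 * (arity D + ?s) + 16) + 9"
    using lengths by (intro add_mono mult_mono) (auto simp: num_atoms_def)
  finally show ?thesis by (simp add: algebra_simps)
qed

text \<open>With a single output, the polynomial bound on the size would be \<open>1\<close>.\<close>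

lemma generator_length_outs:
  assumes "generator G D" "1 \<le> k"
  shows "2 \<le> length (outs (D k))"
proof (rule ccontr)
  assume "\<not> ?thesis"
  moreover obtain d where "arity (D k) < length (outs (D k))"
    "defseq_size (D k) \<le> length (outs (D k)) ^ d"
    using assms by (auto simp: generator_def)
  ultimately have "length (outs (D k)) = 1" by linarith
  moreover from this have "defseq_size (D k) \<le> 1"
    using \<open>defseq_size (D k) \<le> length (outs (D k)) ^ d\<close> by simp
  moreover from \<open>length (outs (D k)) = 1\<close> obtain \<phi> where "outs (D k) = [\<phi>]"
    by (auto simp: length_Suc_conv)
  moreover have "2 \<le> fm_size \<phi>" by (cases \<phi>) auto
  ultimately show False by (simp add: defseq_size_def)
qed

lemma generator_fm_size_tau:
  assumes "generator G D"
  obtains d where "\<And>k b. 1 \<le> k \<Longrightarrow> fm_size (tau (D k) b) \<le> length (outs (D k)) ^ d"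
proof -
  obtain s where s: "\<And>k. 1 \<le> k \<Longrightarrow> defseq_size (D k) \<le> length (outs (D k)) ^ s"
    using assms by (auto simp: generator_def)
  have "poly_bounded (\<lambda>m::nat. m ^ s * (4 * (m + m ^ s) + 18) + 9)"
    by (intro poly_bounded_intros)
  then obtain d where d: "\<And>m::nat. 2 \<le> m \<Longrightarrow> m ^ s * (4 * (m + m ^ s) + 18) + 9 \<le> m ^ d"
    using poly_boundedE by blast
  have "fm_size (tau (D k) b) \<le> length (outs (D k)) ^ d" if k: "1 \<le> k" for k b
  proof -
    let ?m = "length (outs (D k))"
    have "arity (D k) < ?m" using assms k by (simp add: generator_def)
    then have "fm_size (tau (D k) b) \<le> ?m ^ s * (4 * (?m + ?m ^ s) + 18) + 9"
      using s[OF k] by (intro order_trans[OF fm_size_tau_le] add_mono mult_mono) auto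
    also have "\<dots> \<le> ?m ^ d" by (rule d[OF generator_length_outs[OF assms k]])
    finally show ?thesis .
  qed
  then show ?thesis by (rule that)
qed

subsection \<open>Disjunctions\<close>

definition tau_disj :: "defseq \<Rightarrow> bool list list \<Rightarrow> (nat \<Rightarrow> nat \<Rightarrow> nat) \<Rightarrow> fm" where
  "tau_disj D bs \<rho> = Disj (map (\<lambda>i. rename (\<rho> i) (tau D (bs ! i))) [0..<length bs])"

definition disjoint_names :: "defseq \<Rightarrow> bool list list \<Rightarrow> (nat \<Rightarrow> nat \<Rightarrow> nat) \<Rightarrow> bool" where
  "disjoint_names D bs \<rho> \<longleftrightarrow>
     bs \<noteq> [] \<and> (\<forall>b \<in> set bs. length b = length (outs D)) \<and>
     inj_on (\<lambda>(i, a). \<rho> i a) ({..<length bs} \<times> {..<num_atoms D})"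

definition easy_tau_disjs :: "(bool list \<Rightarrow> bool list \<Rightarrow> bool) \<Rightarrow> (nat \<Rightarrow> defseq) \<Rightarrow> nat \<Rightarrow> fm set" where
  "easy_tau_disjs P D c = {\<phi>. \<exists>k bs \<rho>. k \<ge> 1 \<and> disjoint_names (D k) bs \<rho> \<and> \<phi> = tau_disj (D k) bs \<rho> \<and>
     min_size P \<phi> \<le> enat (length (outs (D k)) ^ c)}"

lemma vee_hard_iff: "vee_hard P D \<longleftrightarrow> (\<forall>c \<ge> 1. finite (easy_tau_disjs P D c))"
  unfolding vee_hard_def easy_tau_disjs_def disjoint_names_def tau_disj_def by (simp only: conj_assoc)

lemma vee_hard_imp_hard:
  assumes "generator G D" "vee_hard P D"
  shows "hard P D"
  unfolding hard_def
proof
  fix c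
  obtain d where d: "\<And>k b. 1 \<le> k \<Longrightarrow> fm_size (tau (D k) b) \<le> length (outs (D k)) ^ d"
    using generator_fm_size_tau[OF assms(1)] by blast
  show "finite {\<phi>. \<exists>k b. k \<ge> 1 \<and> length b = length (outs (D k)) \<and> \<phi> = tau (D k) b \<and>
      min_size P \<phi> \<le> enat (fm_size \<phi> ^ c)}" (is "finite ?easy")
  proof (rule finite_subset)
    show "finite (easy_tau_disjs P D (d * c + 1))" using assms(2) by (simp add: vee_hard_iff)
    show "?easy \<subseteq> easy_tau_disjs P D (d * c + 1)"
    proof
      fix \<phi> assume "\<phi> \<in> ?easy"
      then obtain k b where k: "1 \<le> k" and b: "length b = length (outs (D k))" "\<phi> = tau (D k) b"
        and min: "min_size P \<phi> \<le> enat (fm_size \<phi> ^ c)" by auto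
      let ?m = "length (outs (D k))"
      have "fm_size \<phi> ^ c \<le> (?m ^ d) ^ c" unfolding b(2) by (intro power_mono d k) simp
      also have "\<dots> \<le> ?m ^ (d * c + 1)"
        using generator_length_outs[OF assms(1) k]
        unfolding power_mult[symmetric] by (intro power_increasing) auto
      finally have "min_size P \<phi> \<le> enat (?m ^ (d * c + 1))"
        using min by (meson enat_ord_simps(1) order_trans)
      moreover have "\<phi> = tau_disj (D k) [b] (\<lambda>_ x. x)"
        by (simp add: tau_disj_def b(2) form.map_ident)
      moreover have "disjoint_names (D k) [b] (\<lambda>_ x. x)"
        using b(1) by (auto simp: disjoint_names_def inj_on_def)
      ultimately show "\<phi> \<in> easy_tau_disjs P D (d * c + 1)"
        using k unfolding easy_tau_disjs_def by blast
    qed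
  qed
qed

lemma vee_hard_if_reduces:
  assumes "vee_hard P D"
    and "\<And>c. 1 \<le> c \<Longrightarrow> \<exists>c' \<ge> 1. \<exists>B h. \<forall>\<phi> \<in> easy_tau_disjs P D' c.
           fm_size \<phi> \<le> B \<or> (\<exists>\<psi> \<in> easy_tau_disjs P D c'. fm_size \<phi> \<le> h \<psi>)"
  shows "vee_hard P D'"
  unfolding vee_hard_iff
proof (intro allI impI)
  fix c :: nat assume "1 \<le> c"
  from assms(2)[OF this] obtain c' B h where "1 \<le> c'"
    and "\<forall>\<phi> \<in> easy_tau_disjs P D' c. fm_size \<phi> \<le> B \<or> (\<exists>\<psi> \<in> easy_tau_disjs P D c'. fm_size \<phi> \<le> h \<psi>)"
    by blast
  then have "easy_tau_disjs P D' c \<subseteq>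
      {\<phi>. fm_size \<phi> \<le> B} \<union> (\<Union>\<psi> \<in> easy_tau_disjs P D c'. {\<phi>. fm_size \<phi> \<le> h \<psi>})"
    by blast
  moreover have "finite (easy_tau_disjs P D c')"
    using assms(1) \<open>1 \<le> c'\<close> by (simp add: vee_hard_iff)
  ultimately show "finite (easy_tau_disjs P D' c)"
    by (auto intro: finite_subset finite_fm_size_le)
qed

lemma length_outs_le_num_symbols_tau_disj:
  assumes "disjoint_names D bs \<rho>"
  shows "length (outs D) \<le> num_symbols (tau_disj D bs \<rho>)"
proof -
  have bs: "0 < length bs" "length (bs ! 0) = length (outs D)"
    using assms by (auto simp: disjoint_names_def)
  then have "length (outs D) \<le> num_symbols (Disj (out_fms D (bs ! 0)))"
    using length_le_num_symbols_Disj[of "out_fms D (bs ! 0)"] by (simp add: out_fms_def)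
  also have "\<dots> \<le> num_symbols (rename (\<rho> 0) (tau D (bs ! 0)))" by (simp add: tau_eq)
  also have "\<dots> \<le> num_symbols (tau_disj D bs \<rho>)"
    unfolding tau_disj_def using bs(1) by (intro num_symbols_le_Disj) auto
  finally show ?thesis .
qed

lemma num_symbols_Disj_le:
  "(\<And>x. x \<in> set xs \<Longrightarrow> num_symbols x \<le> B) \<Longrightarrow> num_symbols (Disj xs) \<le> length xs * (B + 1) + 1"
proof (induction xs rule: Disj.induct)
  case (2 x)
  then have "num_symbols x \<le> B" by simp
  then show ?case by simp
next
  case (3 x y xs)
  then have "num_symbols x \<le> B" "num_symbols (Disj (y # xs)) \<le> length (y # xs) * (B + 1) + 1" by auto
  then show ?case by simp
qed simp

lemma inst_tau_disj:
  assumes "wf_defseq D" "disjoint_names D bs \<rho>"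
  obtains \<theta> where "inst \<theta> (tau_disj D bs \<rho>) =
    Disj (map (\<lambda>i. rename (\<rho> i) (inst (\<eta> i) (tau D (bs ! i)))) [0..<length bs])"
proof -
  let ?names = "\<lambda>(i, a). \<rho> i a" and ?I = "{..<length bs} \<times> {..<num_atoms D}"
  define \<theta> where "\<theta> y = (case inv_into ?I ?names y of (i, x) \<Rightarrow> \<eta> i x)" for y
  have \<theta>: "\<theta> (\<rho> i x) = \<eta> i x" if "i < length bs" "x < num_atoms D" for i x
    using assms(2) inv_into_f_f[of ?names ?I "(i, x)"] that by (simp add: \<theta>_def disjoint_names_def)
  have "inst \<theta> (rename (\<rho> i) (tau D (bs ! i))) = rename (\<rho> i) (inst (\<eta> i) (tau D (bs ! i)))"
    if "i < length bs" for i
    using atoms_tau[OF assms(1)] \<theta>[OF that] by (intro inst_rename) auto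
  then have "inst \<theta> (tau_disj D bs \<rho>) =
      Disj (map (\<lambda>i. rename (\<rho> i) (inst (\<eta> i) (tau D (bs ! i)))) [0..<length bs])"
    unfolding tau_disj_def inst_Disj map_map comp_def
    by (intro arg_cong[where f = Disj] map_cong) auto
  then show ?thesis by (rule that)
qed

section \<open>Kleene evaluation of the gadget\<close>

lemma kleene_eval_total: "kleene_eval (\<lambda>a. Some (e a)) \<phi> = Some (fm_eval e \<phi>)"
  by (induction \<phi>) auto

lemma kleene_eval_inst:
  "kleene_eval e (inst \<theta> \<phi>) = kleene_eval (\<lambda>a. case \<theta> a of None \<Rightarrow> e a | Some b \<Rightarrow> Some b) \<phi>"
  by (induction \<phi>) (auto split: option.splits)

lemma kleene_eval_rename: "kleene_eval e (rename f \<phi>) = kleene_eval (\<lambda>a. e (f a)) \<phi>"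
  by (induction \<phi>) auto

lemma kleene_eval_literal: "kleene_eval e \<phi> = Some c \<Longrightarrow> kleene_eval e (literal b \<phi>) = Some (c = b)"
  by (simp add: literal_def)

lemma kleene_eval_Iff:
  "kleene_eval e \<phi> = Some b \<Longrightarrow> kleene_eval e \<psi> = Some c \<Longrightarrow> kleene_eval e (Iff \<phi> \<psi>) = Some (b = c)"
  by (auto simp: Iff_def)

lemma kleene_eval_Conj_map:
  "(\<And>x. x \<in> set xs \<Longrightarrow> kleene_eval e (F x) = Some (P x)) \<Longrightarrow>
   kleene_eval e (Conj (map F xs)) = Some (\<forall>x \<in> set xs. P x)"
  by (induction xs rule: induct_list012) auto

lemma kleene_eval_Disj_map:
  "(\<And>x. x \<in> set xs \<Longrightarrow> kleene_eval e (F x) = Some (P x)) \<Longrightarrow>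
   kleene_eval e (Disj (map F xs)) = Some (\<exists>x \<in> set xs. P x)"
  by (induction xs rule: induct_list012) auto

fun gate_refs :: "gate \<Rightarrow> nat list" where
  "gate_refs (GConst b) = []"
| "gate_refs (GNot i) = [i]"
| "gate_refs (GAnd i j) = [i, j]"
| "gate_refs (GOr i j) = [i, j]"

lemma gate_eval_cong: "(\<And>j. j \<in> set (gate_refs g) \<Longrightarrow> e j = e' j) \<Longrightarrow> gate_eval e g = gate_eval e' g"
  by (cases g) auto

lemma kleene_eval_gate_fm:
  assumes "\<And>j. j \<in> set (gate_refs g) \<Longrightarrow> j < l \<Longrightarrow> e j = Some (f j)"
  shows "kleene_eval e (gate_fm l g) = Some (gate_eval (\<lambda>j. j < l \<and> f j) g)"
  using assms by (cases g) (auto simp: node_fm_def)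

lemma read_addr_eq_horner_sum:
  "read_addr v w p = horner_sum of_bool 2 (map (\<lambda>j. at0 v (p + j)) [0..<w])"
  by (simp add: read_addr_def horner_sum_eq_sum lessThan_atLeast0)

lemma eq_read_addr_iff:
  assumes "j < 2 ^ w"
  shows "j = read_addr v w p \<longleftrightarrow> (\<forall>t < w. odd (j div 2 ^ t) = at0 v (p + t))"
proof -
  have "t < w" if "bit j t" for t
  proof -
    have "bit (take_bit w j) t" using assms that by (simp add: take_bit_nat_eq_self)
    then show ?thesis by (simp add: bit_take_bit_iff)
  qed
  moreover have "bit (read_addr v w p) t \<longleftrightarrow> t < w \<and> at0 v (p + t)" for t
    unfolding read_addr_eq_horner_sum bit_horner_sum_bit_iff by (simp cong: conj_cong)
  ultimately have "j = read_addr v w p \<longleftrightarrow> (\<forall>t < w. bit j t = at0 v (p + t))"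
    by (metis bit_eq_iff)
  then show ?thesis by (simp only: bit_iff_odd)
qed

context
  fixes e :: "nat \<Rightarrow> bool option" and a :: nat and v :: "bool list"
  assumes desc: "\<And>p. kleene_eval e (desc_fm a p) = Some (at0 v p)"
begin

lemma kleene_eval_addr_fm:
  assumes "j < 2 ^ w"
  shows "kleene_eval e (addr_fm a w p j) = Some (j = read_addr v w p)"
  unfolding addr_fm_def eq_read_addr_iff[OF assms]
  by (subst kleene_eval_Conj_map[where P = "\<lambda>t. odd (j div 2 ^ t) = at0 v (p + t)"])
     (auto simp: desc)

lemma kleene_eval_select_fm:
  assumes "l \<le> 2 ^ w" and "read_addr v w p < l \<Longrightarrow> kleene_eval e (nd (read_addr v w p)) = Some b"
  shows "kleene_eval e (select_fm a w p l nd) = Some (read_addr v w p < l \<and> b)"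
  unfolding select_fm_def using assms
  by (subst kleene_eval_Disj_map[where P = "\<lambda>j. j = read_addr v w p \<and> b"])
     (auto simp: kleene_eval_addr_fm)

lemma kleene_eval_cv_gate_fm:
  assumes "l \<le> 2 ^ w"
    and "\<And>j. j \<in> set (gate_refs (read_gate v w p)) \<Longrightarrow> j < l \<Longrightarrow> kleene_eval e (nd j) = Some (f j)"
  shows "kleene_eval e (cv_gate_fm a w p l nd) =
    Some (gate_eval (\<lambda>j. j < l \<and> f j) (read_gate v w p))"
proof -
  have select: "kleene_eval e (select_fm a w q l nd) = Some (read_addr v w q < l \<and> f (read_addr v w q))"
    if "read_addr v w q \<in> set (gate_refs (read_gate v w p))" for q
    using assms that by (intro kleene_eval_select_fm) auto
  show ?thesis
    using select[of "p + 2"] select[of "p + 2 + w"]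
    by (cases "at0 v p"; cases "at0 v (p + 1)")
       (simp_all add: cv_gate_fm_def read_gate_def Let_def desc)
qed

end

section \<open>The definition sequence of the gadget generator\<close>

lemma concat_map_map_upt:
  "concat (map (\<lambda>s. map (f s) [0..<c]) [0..<r]) = map (\<lambda>q. f (q div c) (q mod c)) [0..<r * c]"
proof (induction r)
  case (Suc r)
  have "map (\<lambda>q. f (q div c) (q mod c)) [r * c..<r * c + c] = map (f r) [0..<c]"
    by (rule nth_equalityI) auto
  moreover have "[0..<Suc r * c] = [0..<r * c] @ [r * c..<r * c + c]"
    using upt_add_eq_append[of 0 "r * c" c] by (simp add: add.commute[of c])
  ultimately show ?case using Suc by simp
qed simp

lemma block_less:
  assumes "s \<le> a" "j < (k::nat)"
  shows "s * k + j < (a + 1) * k"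
proof -
  have "s * k + j < (s + 1) * k" using assms(2) by simp
  also have "\<dots> \<le> (a + 1) * k" using assms(1) by (intro mult_right_mono) auto
  finally show ?thesis .
qed

lemma block_div_mod:
  assumes "j < (k::nat)"
  shows "(s * k + j) div k = s" "(s * k + j) mod k = j"
  using assms by simp_all

lemma block_inject:
  assumes "s * k + j = s' * k + j'" "j < k" "j' < (k::nat)"
  shows "s = s' \<and> j = j'"
  using assms block_div_mod by metis

lemma div_mod_block:
  assumes "q < (a + 1) * (k::nat)"
  shows "q div k \<le> a" "q mod k < k"
proof -
  show "q div k \<le> a" using less_mult_imp_div_less[OF assms] by simp
  show "q mod k < k" using assms by (cases k) auto
qed

lemma addr_len_ge: "a + k \<le> 2 ^ addr_len a k"
  unfolding addr_len_def by (rule LeastI[of _ "a + k"]) (simp add: less_imp_le)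

lemma addr_len_le: "a + k \<le> 2 ^ w \<Longrightarrow> addr_len a k \<le> w"
  unfolding addr_len_def by (rule Least_le)

lemma num_gates_le: "num_gates a k \<le> a"
  unfolding num_gates_def by (meson diff_le_self div_le_dividend le_trans)

lemma nodes_le_addr: "k + num_gates a k \<le> 2 ^ addr_len a k"
  using addr_len_ge[of a k] num_gates_le[of a k] by linarith

definition cv_atom :: "nat \<Rightarrow> nat \<Rightarrow> nat \<Rightarrow> nat \<Rightarrow> nat" where
  "cv_atom a k s j =
     (if j < k then a + s * k + j else a + (a + 1) * k + s * num_gates a k + (j - k))"

lemma cv_node_eq: "cv_node a k s j = At (cv_atom a k s j)"
  by (simp add: cv_node_def cv_atom_def)

lemma arity_gad_CV [simp]: "arity (gad_CV a k) = a + (a + 1) * k"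
  by (simp add: gad_CV_def)

lemma defs_gad_CV:
  "defs (gad_CV a k) =
     map (\<lambda>q. cv_gate_fm a (addr_len a k) (gate_pos a k (q mod num_gates a k)) (k + q mod num_gates a k)
                (cv_node a k (q div num_gates a k))) [0..<(a + 1) * num_gates a k]"
  by (simp add: gad_CV_def concat_map_map_upt del: mult_Suc upt_Suc)

lemma outs_gad_CV:
  "outs (gad_CV a k) =
     map (\<lambda>q. select_fm a (addr_len a k) (q mod (k + 1) * addr_len a k) (k + num_gates a k)
                (cv_node a k (q div (k + 1)))) [0..<(a + 1) * (k + 1)]"
  by (simp add: gad_CV_def concat_map_map_upt del: mult_Suc upt_Suc mult_Suc_right)

lemma length_defs_gad_CV [simp]: "length (defs (gad_CV a k)) = (a + 1) * num_gates a k"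
  by (simp add: defs_gad_CV del: mult_Suc mult_Suc_right)

lemma length_outs_gad_CV [simp]: "length (outs (gad_CV a k)) = (a + 1) * (k + 1)"
  by (simp add: outs_gad_CV del: mult_Suc mult_Suc_right)

lemma num_atoms_gad_CV: "num_atoms (gad_CV a k) = a + (a + 1) * k + (a + 1) * num_gates a k"
  by (simp add: num_atoms_def del: mult_Suc)

lemma nth_defs_gad_CV:
  assumes "s \<le> a" "i < num_gates a k"
  shows "defs (gad_CV a k) ! (s * num_gates a k + i) =
    cv_gate_fm a (addr_len a k) (gate_pos a k i) (k + i) (cv_node a k s)"
  using assms block_less[OF assms] by (simp add: defs_gad_CV del: mult_Suc)

lemma cv_atom_less:
  assumes "s \<le> a" "j < k + i"
  shows "cv_atom a k s j < a + (a + 1) * k + (s * num_gates a k + i)"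
  using assms block_less[of s a j k] by (auto simp: cv_atom_def)

lemma cv_atom_less_num_atoms:
  assumes "s \<le> a" "j < k + num_gates a k"
  shows "cv_atom a k s j < num_atoms (gad_CV a k)"
proof -
  have "s * num_gates a k + num_gates a k \<le> (a + 1) * num_gates a k"
    using mult_right_mono[of "s + 1" "a + 1" "num_gates a k"] assms(1) by simp
  then show ?thesis
    using cv_atom_less[OF assms] unfolding num_atoms_gad_CV by linarith
qed

lemma cv_atom_inject:
  assumes "s \<le> a" "s' \<le> a" "j < k + num_gates a k" "j' < k + num_gates a k"
    and eq: "cv_atom a k s j = cv_atom a k s' j'"
  shows "s = s' \<and> j = j'"
proof -
  have input_iff: "cv_atom a k s j < a + (a + 1) * k \<longleftrightarrow> j < k" if "s \<le> a" for s j
    using block_less[OF that, of j k] by (auto simp: cv_atom_def add.assoc simp del: mult_Suc)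
  then consider "j < k" "j' < k" | "k \<le> j" "k \<le> j'"
    using assms(1,2) eq by (metis linorder_not_less)
  then show ?thesis
  proof cases
    case 1
    with eq have "s * k + j = s' * k + j'" by (simp add: cv_atom_def)
    then show ?thesis using 1 by (rule block_inject)
  next
    case 2
    with eq have "s * num_gates a k + (j - k) = s' * num_gates a k + (j' - k)"
      by (simp add: cv_atom_def)
    with 2 assms(3,4) show ?thesis using block_inject[of s _ "j - k" s' "j' - k"] by force
  qed
qed

subsection \<open>Atoms\<close>

lemma atoms_desc_fm: "atoms (desc_fm a p) \<subseteq> {..<a}"
  by (simp add: desc_fm_def)

lemma atoms_addr_fm: "atoms (addr_fm a w p j) \<subseteq> {..<a}"
  unfolding addr_fm_def atoms_Conj
  by (intro UN_least) (auto simp: desc_fm_def split: if_splits)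

lemma atoms_select_fm: "atoms (select_fm a w p l nd) \<subseteq> {..<a} \<union> (\<Union>j<l. atoms (nd j))"
  unfolding select_fm_def atoms_Disj
  by (rule UN_least) (use atoms_addr_fm in force)

lemma atoms_cv_gate_fm: "atoms (cv_gate_fm a w p l nd) \<subseteq> {..<a} \<union> (\<Union>j<l. atoms (nd j))"
proof -
  have "atoms (cv_gate_fm a w p l nd) \<subseteq> atoms (desc_fm a p) \<union> atoms (desc_fm a (p + 1)) \<union>
    atoms (desc_fm a (p + 2)) \<union> atoms (select_fm a w (p + 2) l nd) \<union> atoms (select_fm a w (p + 2 + w) l nd)"
    by (auto simp: cv_gate_fm_def Let_def)
  also have "\<dots> \<subseteq> {..<a} \<union> (\<Union>j<l. atoms (nd j))"
    by (intro Un_least atoms_select_fm le_supI1 atoms_desc_fm)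
  finally show ?thesis .
qed

lemma atoms_cv_gate_fm_cv_node:
  assumes "s \<le> a"
  shows "atoms (cv_gate_fm a w p (k + i) (cv_node a k s)) \<subseteq> {..<a + (a + 1) * k + (s * num_gates a k + i)}"
  using cv_atom_less[OF assms, of _ k i]
  by (intro order_trans[OF atoms_cv_gate_fm] Un_least) (auto simp: cv_node_eq simp del: mult_Suc)

lemma wf_defseq_gad_CV: "wf_defseq (gad_CV a k)"
  unfolding wf_defseq_def
proof (rule ballI, elim UnE)
  fix \<phi> assume "\<phi> \<in> set (defs (gad_CV a k))"
  then obtain q where q: "q < (a + 1) * num_gates a k"
    "\<phi> = cv_gate_fm a (addr_len a k) (gate_pos a k (q mod num_gates a k)) (k + q mod num_gates a k)
                (cv_node a k (q div num_gates a k))"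
    unfolding defs_gad_CV by auto
  have "q div num_gates a k * num_gates a k + q mod num_gates a k = q" by (rule div_mult_mod_eq)
  with q(1) have "a + (a + 1) * k + (q div num_gates a k * num_gates a k + q mod num_gates a k)
      \<le> num_atoms (gad_CV a k)"
    unfolding num_atoms_gad_CV by linarith
  then show "atoms \<phi> \<subseteq> {..<num_atoms (gad_CV a k)}"
    unfolding q(2) using atoms_cv_gate_fm_cv_node[OF div_mod_block(1)[OF q(1)]] by fastforce
next
  fix \<phi> assume "\<phi> \<in> set (outs (gad_CV a k))"
  then obtain q where q: "q < (a + 1) * (k + 1)"
    "\<phi> = select_fm a (addr_len a k) (q mod (k + 1) * addr_len a k) (k + num_gates a k)
                (cv_node a k (q div (k + 1)))"
    unfolding outs_gad_CV by (auto simp del: upt_Suc mult_Suc mult_Suc_right add_Suc_right)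
  then show "atoms \<phi> \<subseteq> {..<num_atoms (gad_CV a k)}"
    using cv_atom_less_num_atoms[OF div_mod_block(1)[OF q(1)]] unfolding q(2)
    by (intro order_trans[OF atoms_select_fm] Un_least)
       (auto simp: cv_node_eq num_atoms_gad_CV simp del: mult_Suc)
qed

subsection \<open>Correctness\<close>

lemma at0_take: "at0 (take n vs) j \<longleftrightarrow> j < n \<and> at0 vs j"
  by (auto simp: at0_def)

lemma
  fixes h :: "'a list \<Rightarrow> 'b \<Rightarrow> 'a"
  defines "extend \<equiv> foldl (\<lambda>vs y. vs @ [h vs y])"
  shows length_foldl_snoc: "length (extend xs ys) = length xs + length ys"
    and nth_foldl_snoc_prefix: "j < length xs \<Longrightarrow> extend xs ys ! j = xs ! j"
    and nth_foldl_snoc_step: "i < length ys \<Longrightarrow>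
      extend xs ys ! (length xs + i) = h (take (length xs + i) (extend xs ys)) (ys ! i)"
proof -
  have "length (extend xs ys) = length xs + length ys \<and> (\<forall>j < length xs. extend xs ys ! j = xs ! j) \<and>
    (\<forall>i < length ys. extend xs ys ! (length xs + i) = h (take (length xs + i) (extend xs ys)) (ys ! i))"
    unfolding extend_def by (induction ys rule: rev_induct) (auto simp: nth_append less_Suc_eq)
  then show "length (extend xs ys) = length xs + length ys"
    "j < length xs \<Longrightarrow> extend xs ys ! j = xs ! j"
    "i < length ys \<Longrightarrow> extend xs ys ! (length xs + i) = h (take (length xs + i) (extend xs ys)) (ys ! i)"
    by auto
qed

definition defseq_nodes :: "defseq \<Rightarrow> bool list \<Rightarrow> bool list" where
  "defseq_nodes D x = foldl (\<lambda>vs \<phi>. vs @ [fm_eval (at0 vs) \<phi>]) x (defs D)"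

lemma defseq_eval_eq: "defseq_eval D x = map (fm_eval (at0 (defseq_nodes D x))) (outs D)"
  by (simp add: defseq_eval_def defseq_nodes_def)

lemma fm_eval_cong: "(\<And>a. a \<in> atoms \<phi> \<Longrightarrow> e a = e' a) \<Longrightarrow> fm_eval e \<phi> = fm_eval e' \<phi>"
  by (induction \<phi>) auto

lemma at0_defseq_nodes_input: "j < length x \<Longrightarrow> at0 (defseq_nodes D x) j = at0 x j"
  by (simp add: defseq_nodes_def at0_def length_foldl_snoc nth_foldl_snoc_prefix)

lemma at0_defseq_nodes_def:
  assumes "i < length (defs D)" "atoms (defs D ! i) \<subseteq> {..<length x + i}"
  shows "at0 (defseq_nodes D x) (length x + i) = fm_eval (at0 (defseq_nodes D x)) (defs D ! i)"
proof -
  have "at0 (defseq_nodes D x) (length x + i) =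
      fm_eval (at0 (take (length x + i) (defseq_nodes D x))) (defs D ! i)"
    using assms(1) by (simp add: defseq_nodes_def at0_def length_foldl_snoc nth_foldl_snoc_step)
  also have "\<dots> = fm_eval (at0 (defseq_nodes D x)) (defs D ! i)"
    using assms(2) by (intro fm_eval_cong) (auto simp: at0_take)
  finally show ?thesis .
qed

lemma length_nodes: "length (nodes C x) = length x + length (gates C)"
  unfolding nodes_def by (rule length_foldl_snoc)

lemma at0_nodes_input: "j < length x \<Longrightarrow> at0 (nodes C x) j = at0 x j"
  by (simp add: nodes_def at0_def length_foldl_snoc nth_foldl_snoc_prefix)

lemma at0_nodes_gate:
  assumes "i < length (gates C)"
  shows "at0 (nodes C x) (length x + i) =
    gate_eval (\<lambda>j. j < length x + i \<and> at0 (nodes C x) j) (gates C ! i)"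
  using assms nth_foldl_snoc_step[OF assms, of "\<lambda>vs. gate_eval (at0 vs)" x] length_nodes[of C x]
  unfolding nodes_def by (simp add: at0_def[of _ "length x + i"] at0_take[abs_def])

context
  fixes a k :: nat and x v :: "bool list" and u :: "nat \<Rightarrow> bool list" and val :: "nat \<Rightarrow> bool"
  assumes length_x: "length x = a + (a + 1) * k"
  defines "v \<equiv> take a x" and "u \<equiv> \<lambda>s. take k (drop (a + s * k) x)"
    and "val \<equiv> at0 (defseq_nodes (gad_CV a k) x)"
begin

lemma kleene_eval_desc_fm_val: "kleene_eval (\<lambda>j. Some (val j)) (desc_fm a p) = Some (at0 v p)"
  using at0_defseq_nodes_input[of p x "gad_CV a k"] length_x
  by (auto simp: desc_fm_def v_def val_def at0_take)

lemma
  assumes "s \<le> a"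
  shows length_block: "length (u s) = k"
    and nth_block: "j < k \<Longrightarrow> at0 (u s) j = at0 x (cv_atom a k s j)"
proof -
  have "a + s * k + k \<le> length x"
    using mult_right_mono[of "s + 1" "a + 1" k] assms length_x by simp
  then show "length (u s) = k" "j < k \<Longrightarrow> at0 (u s) j = at0 x (cv_atom a k s j)"
    by (auto simp: u_def at0_def cv_atom_def)
qed

lemma val_cv_atom:
  assumes s: "s \<le> a"
  shows "j < k + num_gates a k \<Longrightarrow> val (cv_atom a k s j) = at0 (nodes (decode a k v) (u s)) j"
proof (induction j rule: less_induct)
  case (less j)
  let ?nodes = "at0 (nodes (decode a k v) (u s))" and ?N = "num_gates a k" and ?w = "addr_len a k"
  consider "j < k" | i where "j = k + i" "i < ?N"
    using less.prems by (metis add_less_cancel_left le_Suc_ex linorder_not_le)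
  then show ?case
  proof cases
    case 1
    then have "cv_atom a k s j < length x"
      using cv_atom_less[OF s, of j k 0] block_less[OF s 1] length_x by (simp add: cv_atom_def)
    with 1 s show ?thesis
      by (simp add: val_def at0_defseq_nodes_input nth_block[symmetric] at0_nodes_input length_block)
  next
    case 2
    let ?q = "s * ?N + i"
    have q: "?q < length (defs (gad_CV a k))" using block_less[OF s 2(2)] by simp
    have "val (cv_atom a k s j) = val (length x + ?q)"
      using 2 by (simp add: cv_atom_def length_x add.assoc)
    also have "\<dots> = fm_eval val (cv_gate_fm a ?w (gate_pos a k i) (k + i) (cv_node a k s))"
      using at0_defseq_nodes_def[OF q, of x]
        atoms_cv_gate_fm_cv_node[OF s, of ?w "gate_pos a k i" k i]
      unfolding nth_defs_gad_CV[OF s 2(2)] val_def length_x by blast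
    also have "\<dots> = gate_eval (\<lambda>j. j < k + i \<and> ?nodes j) (read_gate v ?w (gate_pos a k i))"
    proof -
      have "kleene_eval (\<lambda>j. Some (val j)) (cv_gate_fm a ?w (gate_pos a k i) (k + i) (cv_node a k s)) =
          Some (gate_eval (\<lambda>j. j < k + i \<and> ?nodes j) (read_gate v ?w (gate_pos a k i)))"
        using less.IH 2 nodes_le_addr[of k a]
        by (intro kleene_eval_cv_gate_fm kleene_eval_desc_fm_val) (auto simp: cv_node_eq)
      then show ?thesis by (simp add: kleene_eval_total)
    qed
    also have "\<dots> = ?nodes j"
      using at0_nodes_gate[of i "decode a k v" "u s"] 2 length_block[OF s] by (simp add: decode_def)
    finally show ?thesis .
  qed
qed

lemma defseq_eval_gad_CV: "defseq_eval (gad_CV a k) x = gad a k (CV a k) x"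
proof -
  let ?w = "addr_len a k" and ?N = "num_gates a k"
  let ?nodes = "\<lambda>s. nodes (decode a k v) (u s)"
  have select: "fm_eval val (select_fm a ?w (t * ?w) (k + ?N) (cv_node a k s)) =
      at0 (?nodes s) (read_addr v ?w (t * ?w))" if s: "s \<le> a" for s t
  proof -
    let ?j = "read_addr v ?w (t * ?w)"
    have "kleene_eval (\<lambda>j. Some (val j)) (select_fm a ?w (t * ?w) (k + ?N) (cv_node a k s)) =
        Some (?j < k + ?N \<and> at0 (?nodes s) ?j)"
      using val_cv_atom[OF s] nodes_le_addr
      by (intro kleene_eval_select_fm kleene_eval_desc_fm_val) (auto simp: cv_node_eq)
    moreover have "length (?nodes s) = k + ?N"
      using length_block[OF s] by (simp add: length_nodes decode_def)
    ultimately show ?thesis by (auto simp: kleene_eval_total at0_def)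
  qed
  have "defseq_eval (gad_CV a k) x = concat (map (\<lambda>s. map (\<lambda>t. fm_eval val
      (select_fm a ?w (t * ?w) (k + ?N) (cv_node a k s))) [0..<k + 1]) [0..<a + 1])"
    by (simp only: defseq_eval_eq val_def gad_CV_def defseq.sel map_concat map_map comp_def)
  also have "\<dots> = concat (map (\<lambda>s. map (\<lambda>t. at0 (?nodes s) (read_addr v ?w (t * ?w)))
      [0..<k + 1]) [0..<a + 1])"
    by (intro arg_cong[where f = concat] map_cong refl select) (auto simp del: upt_Suc)
  also have "\<dots> = gad a k (CV a k) x"
    by (simp add: gad_def CV_def run_def decode_def v_def u_def comp_def del: upt_Suc)
  finally show ?thesis .
qed

end

subsection \<open>Size\<close>

lemma num_symbols_Conj_le:
  "(\<And>x. x \<in> set xs \<Longrightarrow> num_symbols x \<le> B) \<Longrightarrow> num_symbols (Conj xs) \<le> length xs * (B + 1) + 1"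
proof (induction xs rule: Conj.induct)
  case (2 x)
  then have "num_symbols x \<le> B" by simp
  then show ?case by simp
next
  case (3 x y xs)
  then have "num_symbols x \<le> B" "num_symbols (Conj (y # xs)) \<le> length (y # xs) * (B + 1) + 1" by auto
  then show ?case by simp
qed simp

lemma num_symbols_desc_fm [simp]: "num_symbols (desc_fm a p) = 1"
  by (simp add: desc_fm_def)

lemma num_symbols_addr_fm_le: "num_symbols (addr_fm a w p j) \<le> 3 * w + 1"
  unfolding addr_fm_def by (rule order_trans[OF num_symbols_Conj_le[where B = 2]]) auto

lemma num_symbols_select_fm_le:
  "num_symbols (select_fm a w p l (cv_node a k s)) \<le> l * (3 * w + 4) + 1"
proof -
  let ?xs = "map (\<lambda>j. Con (addr_fm a w p j) (cv_node a k s j)) [0..<l]"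
  have "num_symbols x \<le> 3 * w + 3" if x: "x \<in> set ?xs" for x
  proof -
    obtain j where "x = Con (addr_fm a w p j) (cv_node a k s j)" using x by auto
    with num_symbols_addr_fm_le[of a w p j] show ?thesis by (simp add: cv_node_eq)
  qed
  from num_symbols_Disj_le[of ?xs, OF this] show ?thesis by (simp add: select_fm_def add.commute)
qed

lemma num_symbols_cv_gate_fm_le:
  "num_symbols (cv_gate_fm a w p l (cv_node a k s)) \<le> 5 * (l * (3 * w + 4)) + 40"
  using num_symbols_select_fm_le[of a w "p + 2" l k s] num_symbols_select_fm_le[of a w "p + 2 + w" l k s]
  by (simp add: cv_gate_fm_def Let_def)

lemma num_symbols_gad_CV_le:
  assumes "\<phi> \<in> set (defs (gad_CV a k)) \<union> set (outs (gad_CV a k))"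
  shows "num_symbols \<phi> \<le> 5 * ((k + num_gates a k) * (3 * addr_len a k + 4)) + 40"
  using assms
proof
  assume "\<phi> \<in> set (defs (gad_CV a k))"
  then obtain q where q: "q < (a + 1) * num_gates a k"
    and \<phi>: "\<phi> = cv_gate_fm a (addr_len a k) (gate_pos a k (q mod num_gates a k))
      (k + q mod num_gates a k) (cv_node a k (q div num_gates a k))"
    unfolding defs_gad_CV by auto
  have "num_symbols \<phi> \<le> 5 * ((k + q mod num_gates a k) * (3 * addr_len a k + 4)) + 40"
    unfolding \<phi> by (rule num_symbols_cv_gate_fm_le)
  also have "\<dots> \<le> 5 * ((k + num_gates a k) * (3 * addr_len a k + 4)) + 40"
    using div_mod_block(2)[OF q] by (intro add_mono mult_mono) auto
  finally show ?thesis .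
next
  assume "\<phi> \<in> set (outs (gad_CV a k))"
  then have "num_symbols \<phi> \<le> (k + num_gates a k) * (3 * addr_len a k + 4) + 1"
    unfolding outs_gad_CV using num_symbols_select_fm_le by auto
  then show ?thesis by simp
qed

lemma fm_size_le_if_atoms_bounded:
  assumes "atoms \<phi> \<subseteq> {..<n}"
  shows "fm_size \<phi> \<le> num_symbols \<phi> * (2 * n + 4)"
proof -
  have "length (enc_nat a) \<le> 2 * n + 1" if "a \<in> atoms \<phi>" for a
    using length_enc_nat_le[of a] assms that by fastforce
  then show ?thesis using fm_size_le_num_symbols[of \<phi> "2 * n + 1"] by (simp add: add.commute)
qed

lemma defseq_size_gad_CV_le:
  assumes "1 \<le> k"
  defines "m \<equiv> (k\<^sup>2 + 1) * (k + 1)"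
  shows "defseq_size (gad_CV (k\<^sup>2) k) \<le>
    (m * m + m) * ((5 * (m * (3 * m + 4)) + 40) * (2 * (m + m * m) + 4))"
proof -
  let ?a = "k\<^sup>2" and ?D = "gad_CV (k\<^sup>2) k"
  let ?B = "(5 * (m * (3 * m + 4)) + 40) * (2 * (m + m * m) + 4)"
  have m: "m = k\<^sup>2 * k + k\<^sup>2 + k + 1" by (simp add: m_def algebra_simps)
  have num_gates: "num_gates ?a k \<le> m" using num_gates_le[of ?a k] m by linarith
  have nodes: "k + num_gates ?a k \<le> m" using num_gates_le[of ?a k] m by linarith
  have addr: "addr_len ?a k \<le> m"
    using addr_len_le[of ?a k "?a + k"] m by (simp add: less_imp_le)
  have gates: "(?a + 1) * num_gates ?a k \<le> m * m" using num_gates m by (intro mult_mono) auto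
  moreover have "?a + (?a + 1) * k \<le> m" unfolding m by simp
  ultimately have atoms: "num_atoms ?D \<le> m + m * m" unfolding num_atoms_gad_CV by (rule add_mono[rotated])
  have "fm_size \<phi> \<le> ?B" if \<phi>: "\<phi> \<in> set (defs ?D) \<union> set (outs ?D)" for \<phi>
  proof -
    have "fm_size \<phi> \<le> num_symbols \<phi> * (2 * num_atoms ?D + 4)"
      using wf_defseq_gad_CV \<phi> by (intro fm_size_le_if_atoms_bounded) (auto simp: wf_defseq_def)
    also have "num_symbols \<phi> \<le> 5 * (m * (3 * m + 4)) + 40"
      by (rule order_trans[OF num_symbols_gad_CV_le[OF \<phi>]])
         (use nodes addr in \<open>intro add_mono mult_mono; simp\<close>)
    finally show ?thesis using atoms by (auto intro: mult_mono elim: order_trans)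
  qed
  then have "defseq_size ?D \<le> (\<Sum>\<phi>\<leftarrow>defs ?D. ?B) + (\<Sum>\<phi>\<leftarrow>outs ?D. ?B)"
    unfolding defseq_size_def by (intro add_mono sum_list_mono) auto
  also have "\<dots> = ((?a + 1) * num_gates ?a k + m) * ?B"
    by (simp only: sum_list_triv length_defs_gad_CV length_outs_gad_CV m_def add_mult_distrib of_nat_id)
  also have "\<dots> \<le> (m * m + m) * ?B" using gates by (intro mult_right_mono add_mono) auto
  finally show ?thesis .
qed

lemma generator_gad_CV: "generator (\<lambda>k. gad (k\<^sup>2) k (CV (k\<^sup>2) k)) (\<lambda>k. gad_CV (k\<^sup>2) k)"
proof -
  have "poly_bounded (\<lambda>m. (m * m + m) * ((5 * (m * (3 * m + 4)) + 40) * (2 * (m + m * m) + 4)))"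
    by (intro poly_bounded_intros)
  then obtain d where d: "\<And>m::nat. 2 \<le> m \<Longrightarrow>
      (m * m + m) * ((5 * (m * (3 * m + 4)) + 40) * (2 * (m + m * m) + 4)) \<le> m ^ d"
    using poly_boundedE by blast
  show ?thesis
    unfolding generator_def length_outs_gad_CV arity_gad_CV
  proof (intro conjI allI impI exI[of _ d])
    fix k :: nat assume k: "1 \<le> k"
    show "k\<^sup>2 + (k\<^sup>2 + 1) * k < (k\<^sup>2 + 1) * (k + 1)" by simp
    have "2 * 1 \<le> (k\<^sup>2 + 1) * (k + 1)" using k by (intro mult_mono) auto
    then have "2 \<le> (k\<^sup>2 + 1) * (k + 1)" by simp
    from order_trans[OF defseq_size_gad_CV_le[OF k] d[OF this]]
    show "defseq_size (gad_CV (k\<^sup>2) k) \<le> ((k\<^sup>2 + 1) * (k + 1)) ^ d" .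
  next
    fix k :: nat and x :: "bool list"
    assume "length x = k\<^sup>2 + (k\<^sup>2 + 1) * k"
    then show "defseq_eval (gad_CV (k\<^sup>2) k) x = gad (k\<^sup>2) k (CV (k\<^sup>2) k) x"
      by (rule defseq_eval_gad_CV)
  qed
qed

section \<open>Descriptions of circuits\<close>

definition addr_bits :: "nat \<Rightarrow> nat \<Rightarrow> bool list" where
  "addr_bits w j = map (\<lambda>t. odd (j div 2 ^ t)) [0..<w]"

fun gate_bits :: "nat \<Rightarrow> gate \<Rightarrow> bool list" where
  "gate_bits w (GConst b) = [True, True] @ addr_bits w (of_bool b) @ addr_bits w 0"
| "gate_bits w (GNot i) = [False, False] @ addr_bits w i @ addr_bits w 0"
| "gate_bits w (GAnd i j) = [False, True] @ addr_bits w i @ addr_bits w j"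
| "gate_bits w (GOr i j) = [True, False] @ addr_bits w i @ addr_bits w j"

definition describe :: "nat \<Rightarrow> circuit \<Rightarrow> bool list" where
  "describe w C = concat (map (addr_bits w) (outputs C)) @ concat (map (gate_bits w) (gates C))"

lemma length_addr_bits [simp]: "length (addr_bits w j) = w"
  by (simp add: addr_bits_def)

lemma length_gate_bits [simp]: "length (gate_bits w g) = 2 + 2 * w"
  by (cases g) auto

lemma length_concat_blocks: "(\<And>x. length (f x) = c) \<Longrightarrow> length (concat (map f xs)) = length xs * c"
  by (induction xs) auto

lemma length_describe:
  "length (describe w C) = length (outputs C) * w + length (gates C) * (2 + 2 * w)"
  by (simp add: describe_def length_concat_blocks)

lemma at0_append_left: "j < length xs \<Longrightarrow> at0 (xs @ ys) j = at0 xs j"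
  by (simp add: at0_def nth_append)

lemma at0_append_right: "at0 (xs @ ys) (length xs + j) = at0 ys j"
  by (simp add: at0_def)

lemma at0_concat_block:
  assumes "\<And>x. length (f x) = c"
  shows "i < length xs \<Longrightarrow> j < c \<Longrightarrow> at0 (concat (map f xs)) (i * c + j) = at0 (f (xs ! i)) j"
proof (induction xs arbitrary: i)
  case (Cons x xs)
  show ?case
  proof (cases i)
    case 0
    then show ?thesis using Cons.prems assms by (simp add: at0_append_left)
  next
    case (Suc i')
    then show ?thesis
      using Cons at0_append_right[of "f x" "concat (map f xs)" "i' * c + j"] assms by (simp add: add.assoc)
  qed
qed simp

lemma read_addr_cong:
  "(\<And>j. j < w \<Longrightarrow> at0 v (p + j) = at0 v' (p' + j)) \<Longrightarrow> read_addr v w p = read_addr v' w p'"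
  by (simp add: read_addr_def)

lemma read_addr_addr_bits:
  assumes "j < 2 ^ w"
  shows "read_addr (addr_bits w j) w 0 = j"
  using eq_read_addr_iff[OF assms, of "addr_bits w j" 0] by (auto simp: addr_bits_def at0_def)

lemma read_addr_output_bits:
  assumes "t < length (outputs C)" "outputs C ! t < 2 ^ w"
  shows "read_addr (describe w C) w (t * w) = outputs C ! t"
proof -
  have "read_addr (describe w C) w (t * w) = read_addr (addr_bits w (outputs C ! t)) w 0"
  proof (rule read_addr_cong)
    fix j assume j: "j < w"
    have "t * w + j < length (concat (map (addr_bits w) (outputs C)))"
      using mult_le_mono1[of "t + 1" "length (outputs C)" w] assms(1) j
      by (simp add: length_concat_blocks)
    then show "at0 (describe w C) (t * w + j) = at0 (addr_bits w (outputs C ! t)) (0 + j)"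
      using assms(1) j by (simp add: describe_def at0_append_left at0_concat_block)
  qed
  with read_addr_addr_bits[OF assms(2)] show ?thesis by simp
qed

lemma read_gate_cong:
  assumes "1 \<le> w" "\<And>j. j < 2 + 2 * w \<Longrightarrow> at0 v (p + j) = at0 v' (p' + j)"
  shows "read_gate v w p = read_gate v' w p'"
proof -
  have "read_addr v w (p + 2) = read_addr v' w (p' + 2)"
    using assms(2)[of "2 + _"] by (intro read_addr_cong) (simp add: add.assoc)
  moreover have "read_addr v w (p + 2 + w) = read_addr v' w (p' + 2 + w)"
    using assms(2)[of "2 + w + _"] by (intro read_addr_cong) (simp add: add.assoc)
  ultimately show ?thesis
    using assms(1) assms(2)[of 0] assms(2)[of 1] assms(2)[of 2] by (simp add: read_gate_def Let_def)
qed

lemma read_gate_gate_bits: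
  assumes "1 \<le> w" "\<And>j. j \<in> set (gate_refs g) \<Longrightarrow> j < 2 ^ w"
  shows "read_gate (gate_bits w g) w 0 = g"
proof -
  have first: "read_addr (b # b' # addr_bits w x @ addr_bits w y) w 2 = x" if "x < 2 ^ w" for b b' x y
    using read_addr_addr_bits[OF that]
    by (subst read_addr_cong[where v' = "addr_bits w x" and p' = 0]) (auto simp: at0_def nth_append)
  have second: "read_addr (b # b' # addr_bits w x @ addr_bits w y) w (2 + w) = y" if "y < 2 ^ w" for b b' x y
    using read_addr_addr_bits[OF that]
    by (subst read_addr_cong[where v' = "addr_bits w y" and p' = 0]) (auto simp: at0_def nth_append)
  have "at0 (b # b' # addr_bits w (of_bool c) @ addr_bits w y) 2 = c" for b b' c y
    using assms(1) by (auto simp: at0_def nth_append addr_bits_def)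
  with first second assms show ?thesis
    by (cases g) (simp_all add: read_gate_def Let_def at0_def[of _ 0] at0_def[of _ "Suc 0"] numeral_2_eq_2)
qed

lemma decode_describe:
  assumes "inputs C = k" "length (outputs C) = k + 1" "length (gates C) = num_gates a k"
    and "1 \<le> addr_len a k"
    and "\<And>g j. g \<in> set (gates C) \<Longrightarrow> j \<in> set (gate_refs g) \<Longrightarrow> j < 2 ^ addr_len a k"
    and "\<And>j. j \<in> set (outputs C) \<Longrightarrow> j < 2 ^ addr_len a k"
  shows "decode a k (describe (addr_len a k) C) = C"
proof -
  let ?w = "addr_len a k"
  have read_gate: "read_gate (describe ?w C) ?w (gate_pos a k i) = gates C ! i"
    if i: "i < length (gates C)" for i
  proof -
    have "read_gate (describe ?w C) ?w (gate_pos a k i) = read_gate (gate_bits ?w (gates C ! i)) ?w 0"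
    proof (rule read_gate_cong[OF assms(4)])
      fix j assume j: "j < 2 + 2 * ?w"
      have "gate_pos a k i + j =
          length (concat (map (addr_bits ?w) (outputs C))) + (i * (2 + 2 * ?w) + j)"
        by (simp add: gate_pos_def length_concat_blocks assms(2))
      then show "at0 (describe ?w C) (gate_pos a k i + j) = at0 (gate_bits ?w (gates C ! i)) (0 + j)"
        unfolding describe_def using i j
        by (simp only: at0_append_right at0_concat_block length_gate_bits) simp
    qed
    also have "\<dots> = gates C ! i"
      by (rule read_gate_gate_bits[OF assms(4) assms(5)[OF nth_mem[OF i]]])
    finally show ?thesis .
  qed
  have "map (\<lambda>t. read_addr (describe ?w C) ?w (t * ?w)) [0..<k + 1] = outputs C"
    using assms(2,6) by (intro nth_equalityI) (auto simp: read_addr_output_bits simp del: upt_Suc)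
  moreover have "map (\<lambda>i. read_gate (describe ?w C) ?w (gate_pos a k i)) [0..<num_gates a k] = gates C"
    using assms(3) by (intro nth_equalityI) (simp_all add: read_gate)
  ultimately show ?thesis unfolding decode_def by (cases C) (use assms(1) in simp)
qed

section \<open>Embedding a circuit into the gadget\<close>

fun map_gate :: "(nat \<Rightarrow> nat) \<Rightarrow> gate \<Rightarrow> gate" where
  "map_gate r (GConst b) = GConst b"
| "map_gate r (GNot i) = GNot (r i)"
| "map_gate r (GAnd i j) = GAnd (r i) (r j)"
| "map_gate r (GOr i j) = GOr (r i) (r j)"

lemma gate_refs_map_gate [simp]: "gate_refs (map_gate r g) = map r (gate_refs g)"
  by (cases g) auto

lemma gate_eval_map_gate: "gate_eval e (map_gate r g) = gate_eval (\<lambda>j. e (r j)) g"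
  by (cases g) auto

lemma length_gate_refs_le: "length (gate_refs g) \<le> 2"
  by (cases g) auto

definition gad_def_fm :: "nat \<Rightarrow> nat \<Rightarrow> nat \<Rightarrow> nat \<Rightarrow> fm" where
  "gad_def_fm a k s i = Iff (At (cv_atom a k s (k + i)))
     (cv_gate_fm a (addr_len a k) (gate_pos a k i) (k + i) (cv_node a k s))"

definition gad_out_fm :: "nat \<Rightarrow> nat \<Rightarrow> nat \<Rightarrow> nat \<Rightarrow> fm" where
  "gad_out_fm a k s t =
     select_fm a (addr_len a k) (t * addr_len a k) (k + num_gates a k) (cv_node a k s)"

lemma def_fms_gad_CV:
  "def_fms (gad_CV a k) =
     map (\<lambda>q. gad_def_fm a k (q div num_gates a k) (q mod num_gates a k)) [0..<(a + 1) * num_gates a k]"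
  unfolding def_fms_def length_defs_gad_CV
  by (intro map_cong refl)
     (simp add: defs_gad_CV gad_def_fm_def cv_atom_def add.assoc div_mult_mod_eq del: mult_Suc upt_Suc)

lemma out_fms_gad_CV:
  assumes "length b = (a + 1) * (k + 1)"
  shows "out_fms (gad_CV a k) b =
     map (\<lambda>q. literal (\<not> b ! q) (gad_out_fm a k (q div (k + 1)) (q mod (k + 1)))) [0..<(a + 1) * (k + 1)]"
  using assms unfolding out_fms_def outs_gad_CV gad_out_fm_def
  by (intro nth_equalityI) (simp_all del: upt_Suc mult_Suc mult_Suc_right)

lemma def_fms_defseq_of:
  "def_fms (defseq_of C) =
     map (\<lambda>i. Iff (At (inputs C + i)) (gate_fm (inputs C + i) (gates C ! i))) [0..<length (gates C)]"
  by (simp add: def_fms_def defseq_of_def)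

lemma out_fms_defseq_of:
  assumes "length b = length (outputs C)"
  shows "out_fms (defseq_of C) b =
     map (\<lambda>t. literal (\<not> b ! t) (node_fm (inputs C + length (gates C)) (outputs C ! t)))
       [0..<length (outputs C)]"
  using assms unfolding out_fms_def defseq_of_def by (intro nth_equalityI) simp_all

lemma num_atoms_defseq_of: "num_atoms (defseq_of C) = inputs C + length (gates C)"
  by (simp add: num_atoms_def defseq_of_def)

lemma wf_defseq_defseq_of: "wf_defseq (defseq_of C)"
proof -
  have node: "atoms (node_fm l j) \<subseteq> {..<l}" for l j by (simp add: node_fm_def)
  then have gate: "atoms (gate_fm l g) \<subseteq> {..<l}" for l g by (cases g) simp_all
  have "atoms (gate_fm (inputs C + i) (gates C ! i)) \<subseteq> {..<inputs C + length (gates C)}"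
    if "i < length (gates C)" for i
    using gate[of "inputs C + i" "gates C ! i"] that by fastforce
  with node show ?thesis
    unfolding wf_defseq_def num_atoms_defseq_of by (simp add: defseq_of_def ball_Un)
qed

lemma cv_atom_in_atoms_tau:
  assumes "s \<le> a" "j < k + num_gates a k" "length b = (a + 1) * (k + 1)"
  shows "cv_atom a k s j \<in> atoms (tau (gad_CV a k) b)"
proof -
  let ?q = "s * (k + 1)"
  have "?q < (a + 1) * (k + 1)" using block_less[OF assms(1), of 0 "k + 1"] by simp
  then have "literal (\<not> b ! ?q) (gad_out_fm a k (?q div (k + 1)) (?q mod (k + 1))) \<in>
      set (out_fms (gad_CV a k) b)"
    unfolding out_fms_gad_CV[OF assms(3)] set_map
    by (intro imageI) (simp only: set_upt atLeastLessThan_iff zero_le simp_thms)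
  moreover have "cv_atom a k s j \<in> atoms (gad_out_fm a k s 0)"
    unfolding gad_out_fm_def select_fm_def atoms_Disj using assms(2) by (force simp: cv_node_eq)
  moreover have "?q div (k + 1) = s" "?q mod (k + 1) = 0" by (simp_all del: mult_Suc_right)
  ultimately show ?thesis
    unfolding tau_eq form.set atoms_Disj by (metis UN_I UnI2 atoms_literal)
qed

locale embedding =
  fixes C :: circuit and a k :: nat
  assumes a_pos: "1 \<le> a" and k_pos: "1 \<le> k" and inputs_le: "inputs C \<le> k"
    and gates_le: "length (gates C) \<le> num_gates a k"
    and room: "(k + 1) * addr_len a k \<le> a"
    and inputs_less_outputs: "inputs C < length (outputs C)"
begin

abbreviation "n \<equiv> inputs C"
abbreviation "S \<equiv> length (gates C)"
abbreviation "w \<equiv> addr_len a k"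
abbreviation "N \<equiv> num_gates a k"

text \<open>The inputs of \<^term>\<open>C\<close> come first among the \<^term>\<open>k\<close> inputs; the address \<^term>\<open>k + N\<close> is never
  available, and stands for all references beyond the last node.\<close>

definition relocate :: "nat \<Rightarrow> nat" where
  "relocate j = (if j < n then j else min (k + (j - n)) (k + N))"

definition padded :: circuit where
  "padded = Circuit k (map (map_gate relocate) (gates C) @ replicate (N - S) (GConst False))
     (map relocate (take (n + 1) (outputs C)) @ [n..<k])"

definition source_atom :: "nat \<Rightarrow> nat \<Rightarrow> nat" where
  "source_atom s j = cv_atom a k s (relocate j)"

text \<open>Output \<^term>\<open>t\<close> of the padded circuit is a copy of input \<^term>\<open>t - 1\<close> if \<^term>\<open>n < t\<close>; the bit of \<^term>\<open>b\<close>
  prescribed for the output is substituted for the input.\<close>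

definition restriction :: "bool list \<Rightarrow> nat \<Rightarrow> bool option" where
  "restriction b x =
     (if x < a then Some (at0 (describe w padded) x)
      else if x < a + (a + 1) * k
      then if (x - a) mod k < n then None else Some (b ! ((x - a) div k * (k + 1) + ((x - a) mod k + 1)))
      else if (x - (a + (a + 1) * k)) mod N < S then None else Some False)"

text \<open>The outputs of \<^term>\<open>C\<close> beyond the first \<^term>\<open>n + 1\<close> are not computed in the gadget; prescribing any
  values for them, here \<^term>\<open>False\<close>, only weakens the formula \<open>\<tau>\<close>.\<close>

definition block_target :: "bool list \<Rightarrow> nat \<Rightarrow> bool list" where
  "block_target b s =
     take (n + 1) (drop (s * (k + 1)) b) @ replicate (length (outputs C) - (n + 1)) False"

lemma addr_len_pos: "1 \<le> w"
  using addr_len_ge[of a k] a_pos k_pos by (cases w) auto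

lemma gate_room: "(k + 1) * w + N * (2 + 2 * w) \<le> a"
proof -
  have "N * (2 + 2 * w) \<le> a - (k + 1) * w"
    unfolding num_gates_def by (rule div_times_less_eq_dividend)
  then show ?thesis using room by linarith
qed

lemma num_nodes_less: "k + N < 2 ^ w"
proof -
  have "N * 2 \<le> N * (2 + 2 * w)" by simp
  then have "N < a" using gate_room a_pos by linarith
  then show ?thesis using addr_len_ge[of a k] by simp
qed

lemma relocate_less: "relocate j < 2 ^ w"
  using num_nodes_less inputs_le by (auto simp: relocate_def)

lemma relocate_less_iff: "i \<le> N \<Longrightarrow> relocate j < k + i \<longleftrightarrow> j < n + i"
  using inputs_le by (auto simp: relocate_def)

lemma relocate_inject: "j < n + S \<Longrightarrow> j' < n + S \<Longrightarrow> relocate j = relocate j' \<Longrightarrow> j = j'"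
  using inputs_le gates_le by (auto simp: relocate_def split: if_splits)

lemma source_atom_gate: "i < S \<Longrightarrow> source_atom s (n + i) = cv_atom a k s (k + i)"
  using gates_le by (simp add: source_atom_def relocate_def)

lemma decode_padded: "decode a k (describe w padded) = padded"
proof (rule decode_describe)
  show "j < 2 ^ w" if "g \<in> set (gates padded)" "j \<in> set (gate_refs g)" for g j
    using that relocate_less by (auto simp: padded_def)
  show "j < 2 ^ w" if "j \<in> set (outputs padded)" for j
    using that relocate_less num_nodes_less by (auto simp: padded_def)
qed (use inputs_le gates_le inputs_less_outputs addr_len_pos in \<open>auto simp: padded_def\<close>)

lemma read_gate_padded:
  assumes "i < N"
  shows "read_gate (describe w padded) w (gate_pos a k i) =
    (if i < S then map_gate relocate (gates C ! i) else GConst False)"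
proof -
  have "read_gate (describe w padded) w (gate_pos a k i) = gates (decode a k (describe w padded)) ! i"
    using assms by (simp add: decode_def)
  then show ?thesis unfolding decode_padded using assms by (simp add: padded_def nth_append)
qed

lemma read_output_padded:
  assumes "t \<le> k"
  shows "read_addr (describe w padded) w (t * w) = (if t \<le> n then relocate (outputs C ! t) else t - 1)"
proof -
  have "read_addr (describe w padded) w (t * w) = outputs (decode a k (describe w padded)) ! t"
    using assms by (simp add: decode_def del: upt_Suc)
  then show ?thesis
    unfolding decode_padded using assms inputs_less_outputs by (simp add: padded_def nth_append)
qed

lemma length_describe_padded: "length (describe w padded) \<le> a"
  using gate_room inputs_le gates_le inputs_less_outputs
  unfolding length_describe by (simp add: padded_def)

lemma restriction_cv_atom:
  assumes "s \<le> a" "j < k + N"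
  shows "restriction b (cv_atom a k s j) =
    (if j < k then if j < n then None else Some (b ! (s * (k + 1) + (j + 1)))
     else if j - k < S then None else Some False)"
proof (cases "j < k")
  case True
  then show ?thesis
    using block_less[OF assms(1) True] block_div_mod[OF True, of s]
    by (simp add: restriction_def cv_atom_def add.assoc del: mult_Suc)
next
  case False
  then have "j - k < N" using assms(2) by linarith
  with False show ?thesis
    using block_div_mod(2)[of "j - k" N s]
    by (simp add: restriction_def cv_atom_def add.assoc del: mult_Suc add_diff_assoc add_diff_assoc2)
qed

lemma kleene_eval_inst_map_add: "kleene_eval e (inst \<theta> \<phi>) = kleene_eval (e ++ \<theta>) \<phi>"
  unfolding kleene_eval_inst map_add_def ..

lemma kleene_eval_desc_fm_restriction:
  "kleene_eval (e ++ restriction b) (desc_fm a p) = Some (at0 (describe w padded) p)"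
  using length_describe_padded by (auto simp: desc_fm_def restriction_def map_add_def at0_def)

lemma kleene_eval_relocated_node:
  assumes "s \<le> a" "relocate j < k + N" "j < n + S \<Longrightarrow> e (source_atom s j) = Some (f j)"
  shows "kleene_eval (e ++ restriction b) (cv_node a k s (relocate j)) = Some (j < n + S \<and> f j)"
proof (cases "j < n + S")
  case True
  then have "restriction b (source_atom s j) = None"
    using restriction_cv_atom[OF assms(1,2)] inputs_le gates_le
    by (auto simp: source_atom_def relocate_def)
  with True assms(3) show ?thesis by (simp add: cv_node_eq source_atom_def map_add_def)
next
  case False
  then have "restriction b (cv_atom a k s (relocate j)) = Some False"
    using restriction_cv_atom[OF assms(1,2)] assms(2) by (auto simp: relocate_def split: if_splits)
  with False show ?thesis by (simp add: cv_node_eq map_add_def)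
qed

lemma kleene_eval_relocated_gate:
  assumes "s \<le> a" "i < S"
    and refs: "\<And>j. j \<in> set (gate_refs (gates C ! i)) \<Longrightarrow> e (source_atom s j) = Some (f j)"
  shows "kleene_eval (e ++ restriction b) (cv_gate_fm a w (gate_pos a k i) (k + i) (cv_node a k s)) =
    Some (gate_eval (\<lambda>j. j < n + i \<and> f j) (gates C ! i))"
proof -
  let ?e = "e ++ restriction b" and ?g = "gates C ! i"
  define val where "val j \<longleftrightarrow> kleene_eval ?e (cv_node a k s j) = Some True" for j
  have i: "i < N" using assms(2) gates_le by simp
  have node: "kleene_eval ?e (cv_node a k s (relocate j)) = Some (f j)"
    if "j \<in> set (gate_refs ?g)" "relocate j < k + i" for j
    using kleene_eval_relocated_node[OF assms(1), of j e f b] refs[OF that(1)] that i assms(2)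
      relocate_less_iff[of i j] by simp
  have "kleene_eval ?e (cv_gate_fm a w (gate_pos a k i) (k + i) (cv_node a k s)) =
      Some (gate_eval (\<lambda>j. j < k + i \<and> val j) (map_gate relocate ?g))"
    using assms(2) i nodes_le_addr[of k a] node
    by (subst kleene_eval_cv_gate_fm[OF kleene_eval_desc_fm_restriction, where f = val])
       (auto simp: read_gate_padded val_def)
  also have "gate_eval (\<lambda>j. j < k + i \<and> val j) (map_gate relocate ?g) =
      gate_eval (\<lambda>j. j < n + i \<and> f j) ?g"
    unfolding gate_eval_map_gate
    using node i relocate_less_iff[of i] by (intro gate_eval_cong) (auto simp: val_def)
  finally show ?thesis .
qed

lemma kleene_eval_gad_out_fm:
  assumes "t \<le> k" "read_addr (describe w padded) w (t * w) = j"
    and "j < k + N \<Longrightarrow> kleene_eval (e ++ restriction b) (cv_node a k s j) = Some c"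
  shows "kleene_eval (e ++ restriction b) (gad_out_fm a k s t) = Some (j < k + N \<and> c)"
  unfolding gad_out_fm_def using assms nodes_le_addr[of k a]
  by (subst kleene_eval_select_fm[OF kleene_eval_desc_fm_restriction, where b = c]) auto

subsection \<open>Conjuncts and disjuncts\<close>

lemma entails_relocated_def_fm:
  assumes s: "s \<le> a" and i: "i < S"
  defines "\<phi> \<equiv> Iff (At (n + i)) (gate_fm (n + i) (gates C ! i))"
  assumes size: "num_symbols (Imp \<phi> (gad_def_fm a k s i)) + 10 \<le> M"
  shows "entails M (64 * M) (rename (source_atom s) \<phi>) (inst (restriction b) (gad_def_fm a k s i))"
proof (rule entails_if_kleene)
  let ?g = "gates C ! i"
  let ?xs = "map (source_atom s) ((n + i) # gate_refs ?g)"
  show "length ?xs \<le> 3" using length_gate_refs_le[of ?g] by simp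
  show "num_symbols (Imp (rename (source_atom s) \<phi>) (inst (restriction b) (gad_def_fm a k s i))) + 10 \<le> M"
    using size by simp
  fix f :: "nat \<Rightarrow> bool"
  let ?e = "\<lambda>a. if a \<in> set ?xs then Some (f a) else None"
  let ?c = "gate_eval (\<lambda>j. j < n + i \<and> f (source_atom s j)) ?g"
  have "kleene_eval ?e (rename (source_atom s) \<phi>) = Some (f (source_atom s (n + i)) = ?c)"
    unfolding \<phi>_def kleene_eval_rename by (intro kleene_eval_Iff kleene_eval_gate_fm) auto
  moreover have "kleene_eval ?e (inst (restriction b) (gad_def_fm a k s i)) =
      Some (f (source_atom s (n + i)) = ?c)"
    unfolding kleene_eval_inst_map_add gad_def_fm_def
  proof (intro kleene_eval_Iff kleene_eval_relocated_gate s i)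
    have "i < N" using i gates_le by simp
    then have "restriction b (source_atom s (n + i)) = None"
      using restriction_cv_atom[OF s, of "k + i"] i by (simp add: source_atom_gate)
    then show "kleene_eval (?e ++ restriction b) (At (cv_atom a k s (k + i))) =
        Some (f (source_atom s (n + i)))"
      using i by (simp add: map_add_def source_atom_gate)
  qed auto
  ultimately show "kleene_eval ?e
      (Imp (rename (source_atom s) \<phi>) (inst (restriction b) (gad_def_fm a k s i))) = Some True"
    by (cases "f (source_atom s (n + i)) = ?c") simp_all
qed

lemma entails_spare_def_fm:
  assumes "s \<le> a" "S \<le> i" "i < N" "num_symbols (gad_def_fm a k s i) + 12 \<le> M"
  shows "entails M (64 * M) (Cst True) (inst (restriction b) (gad_def_fm a k s i))"
proof (rule entails_if_kleene[where xs = "[]"])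
  fix f :: "nat \<Rightarrow> bool"
  let ?e = "\<lambda>a::nat. if a \<in> set [] then Some (f a) else None"
  have "restriction b (cv_atom a k s (k + i)) = Some False"
    using restriction_cv_atom[OF assms(1), of "k + i"] assms(2,3) by simp
  then have "kleene_eval (?e ++ restriction b) (At (cv_atom a k s (k + i))) = Some False"
    by (simp add: map_add_def)
  moreover have "kleene_eval (?e ++ restriction b)
      (cv_gate_fm a w (gate_pos a k i) (k + i) (cv_node a k s)) = Some False"
    using assms(2,3) nodes_le_addr[of k a]
    by (subst kleene_eval_cv_gate_fm[OF kleene_eval_desc_fm_restriction]) (auto simp: read_gate_padded)
  ultimately have "kleene_eval ?e (inst (restriction b) (gad_def_fm a k s i)) = Some (False = False)"
    unfolding kleene_eval_inst_map_add gad_def_fm_def by (rule kleene_eval_Iff)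
  then show "kleene_eval ?e (Imp (Cst True) (inst (restriction b) (gad_def_fm a k s i))) = Some True"
    by simp
qed (use assms(4) in simp_all)

lemma entails_relocated_out_fm:
  assumes s: "s \<le> a" and t: "t \<le> n"
  defines "\<phi> \<equiv> node_fm (n + S) (outputs C ! t)"
  assumes size: "num_symbols (Imp (literal \<beta> (gad_out_fm a k s t)) (literal \<beta> \<phi>)) + 10 \<le> M"
  shows "entails M (64 * M)
    (inst (restriction b) (literal \<beta> (gad_out_fm a k s t))) (rename (source_atom s) (literal \<beta> \<phi>))"
proof (rule entails_if_kleene[where xs = "[source_atom s (outputs C ! t)]"])
  let ?j = "outputs C ! t"
  fix f :: "nat \<Rightarrow> bool"
  let ?e = "\<lambda>a. if a \<in> set [source_atom s ?j] then Some (f a) else None"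
  let ?c = "?j < n + S \<and> f (source_atom s ?j)"
  have tk: "t \<le> k" using t inputs_le by simp
  have "kleene_eval (?e ++ restriction b) (gad_out_fm a k s t) = Some (relocate ?j < k + N \<and> ?c)"
    using t read_output_padded[OF tk]
    by (intro kleene_eval_gad_out_fm[OF tk] kleene_eval_relocated_node s) auto
  also have "relocate ?j < k + N \<and> ?c \<longleftrightarrow> ?c"
    using relocate_less_iff[of N ?j] gates_le by auto
  finally have "kleene_eval ?e (inst (restriction b) (literal \<beta> (gad_out_fm a k s t))) = Some (?c = \<beta>)"
    unfolding kleene_eval_inst_map_add by (rule kleene_eval_literal)
  moreover have "kleene_eval ?e (rename (source_atom s) (literal \<beta> \<phi>)) = Some (?c = \<beta>)"
    unfolding kleene_eval_rename \<phi>_def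
    by (rule kleene_eval_literal) (auto simp: node_fm_def)
  ultimately show "kleene_eval ?e (Imp (inst (restriction b) (literal \<beta> (gad_out_fm a k s t)))
      (rename (source_atom s) (literal \<beta> \<phi>))) = Some True"
    by (cases "?c = \<beta>") simp_all
qed (use size in simp_all)

lemma entails_copied_out_fm:
  assumes s: "s \<le> a" and t: "n < t" "t \<le> k" and \<beta>: "\<beta> = b ! (s * (k + 1) + t)"
    and size: "num_symbols (literal (\<not> \<beta>) (gad_out_fm a k s t)) + 12 \<le> M"
  shows "entails M (64 * M) (inst (restriction b) (literal (\<not> \<beta>) (gad_out_fm a k s t))) (Cst False)"
proof (rule entails_if_kleene[where xs = "[]"])
  fix f :: "nat \<Rightarrow> bool"
  let ?e = "\<lambda>a::nat. if a \<in> set [] then Some (f a) else None"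
  have "restriction b (cv_atom a k s (t - 1)) = Some \<beta>"
    using restriction_cv_atom[OF s, of "t - 1" b] t \<beta> by auto
  then have "kleene_eval (?e ++ restriction b) (gad_out_fm a k s t) = Some (t - 1 < k + N \<and> \<beta>)"
    using t read_output_padded[OF t(2)]
    by (intro kleene_eval_gad_out_fm) (auto simp: cv_node_eq map_add_def)
  then have "kleene_eval ?e (inst (restriction b) (literal (\<not> \<beta>) (gad_out_fm a k s t))) =
      Some (\<beta> = (\<not> \<beta>))"
    unfolding kleene_eval_inst_map_add using t by (intro kleene_eval_literal) auto
  then show "kleene_eval ?e
      (Imp (inst (restriction b) (literal (\<not> \<beta>) (gad_out_fm a k s t))) (Cst False)) = Some True"
    by simp
qed (use size in simp_all)

lemma
  assumes "s \<le> a" "length b = (a + 1) * (k + 1)"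
  shows length_block_target: "length (block_target b s) = length (outputs C)"
    and nth_block_target: "t \<le> n \<Longrightarrow> block_target b s ! t = b ! (s * (k + 1) + t)"
proof -
  have len: "s * (k + 1) + n < length b"
    using block_less[OF assms(1), of n "k + 1"] inputs_le assms(2) by simp
  then have "length (take (n + 1) (drop (s * (k + 1)) b)) = n + 1" by simp
  with len show "length (block_target b s) = length (outputs C)"
    "t \<le> n \<Longrightarrow> block_target b s ! t = b ! (s * (k + 1) + t)"
    using inputs_less_outputs by (auto simp: block_target_def nth_append)
qed

lemma entails_restricted_conjunct:
  assumes mem: "\<delta> \<in> set (def_fms (gad_CV a k))"
    and size: "num_symbols (Conj (def_fms (gad_CV a k))) +
      num_symbols (Conj (def_fms (defseq_of C))) + 12 \<le> M"
  shows "entails M (64 * M) (Cst True) (inst (restriction b) \<delta>) \<or>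
    (\<exists>s \<le> a. \<exists>\<delta>' \<in> set (def_fms (defseq_of C)).
       entails M (64 * M) (rename (source_atom s) \<delta>') (inst (restriction b) \<delta>))"
proof -
  obtain q where q: "q < (a + 1) * N" and "\<delta> = gad_def_fm a k (q div N) (q mod N)"
    using mem unfolding def_fms_gad_CV by (auto simp del: mult_Suc)
  then obtain s i where s: "s \<le> a" and i: "i < N" and \<delta>: "\<delta> = gad_def_fm a k s i"
    using div_mod_block by blast
  have size_\<delta>: "num_symbols \<delta> \<le> num_symbols (Conj (def_fms (gad_CV a k)))"
    by (rule num_symbols_le_Conj[OF mem])
  show ?thesis
  proof (cases "i < S")
    case True
    let ?\<phi> = "Iff (At (n + i)) (gate_fm (n + i) (gates C ! i))"
    have mem': "?\<phi> \<in> set (def_fms (defseq_of C))" using True by (auto simp: def_fms_defseq_of)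
    have "entails M (64 * M) (rename (source_atom s) ?\<phi>) (inst (restriction b) \<delta>)"
      unfolding \<delta> using size size_\<delta>[unfolded \<delta>] num_symbols_le_Conj[OF mem']
      by (intro entails_relocated_def_fm[OF s True]) simp
    with mem' s show ?thesis by blast
  next
    case False
    then show ?thesis
      unfolding \<delta> using size size_\<delta>[unfolded \<delta>] i by (intro disjI1 entails_spare_def_fm[OF s]) auto
  qed
qed

lemma entails_restricted_disjunct:
  assumes b: "length b = (a + 1) * (k + 1)" and mem: "\<omega> \<in> set (out_fms (gad_CV a k) b)"
    and size: "\<And>s. s \<le> a \<Longrightarrow> num_symbols (Disj (out_fms (gad_CV a k) b)) +
      num_symbols (Disj (out_fms (defseq_of C) (block_target b s))) + 12 \<le> M"
  shows "entails M (64 * M) (inst (restriction b) \<omega>) (Cst False) \<or>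
    (\<exists>s \<le> a. \<exists>\<omega>' \<in> set (out_fms (defseq_of C) (block_target b s)).
       entails M (64 * M) (inst (restriction b) \<omega>) (rename (source_atom s) \<omega>'))"
proof -
  obtain q where q: "q < (a + 1) * (k + 1)"
    and \<omega>_q: "\<omega> = literal (\<not> b ! q) (gad_out_fm a k (q div (k + 1)) (q mod (k + 1)))"
    using mem unfolding out_fms_gad_CV[OF b] by (auto simp del: mult_Suc mult_Suc_right upt_Suc)
  define s t where "s = q div (k + 1)" and "t = q mod (k + 1)"
  have s: "s \<le> a" and t: "t \<le> k" and bq: "b ! q = b ! (s * (k + 1) + t)"
    using div_mod_block[OF q] by (simp_all add: s_def t_def div_mult_mod_eq del: mult_Suc_right)
  have \<omega>: "\<omega> = literal (\<not> b ! q) (gad_out_fm a k s t)" unfolding s_def t_def by (rule \<omega>_q)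
  have size_\<omega>: "num_symbols \<omega> \<le> num_symbols (Disj (out_fms (gad_CV a k) b))"
    by (rule num_symbols_le_Disj[OF mem])
  show ?thesis
  proof (cases "t \<le> n")
    case True
    let ?\<phi> = "literal (\<not> b ! q) (node_fm (n + S) (outputs C ! t))"
    have mem': "?\<phi> \<in> set (out_fms (defseq_of C) (block_target b s))"
      unfolding out_fms_defseq_of[OF length_block_target[OF s b]] set_map
      using True inputs_less_outputs nth_block_target[OF s b True]
      by (intro image_eqI[of _ _ t]) (simp_all add: bq)
    have "entails M (64 * M) (inst (restriction b) \<omega>) (rename (source_atom s) ?\<phi>)"
      unfolding \<omega> using size[OF s] size_\<omega>[unfolded \<omega>] num_symbols_le_Disj[OF mem']
      by (intro entails_relocated_out_fm[OF s True]) simp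
    with mem' s show ?thesis by blast
  next
    case False
    then show ?thesis
      unfolding \<omega> using size[OF s] size_\<omega>[unfolded \<omega>] t
      by (intro disjI1 entails_copied_out_fm[OF s _ _ bq]) auto
  qed
qed

lemma entails_restricted_tau:
  fixes \<rho> :: "nat \<Rightarrow> nat"
  assumes b: "length b = (a + 1) * (k + 1)"
    and Y: "\<And>s. s \<le> a \<Longrightarrow> entails M (64 * M)
      (rename \<rho> (rename (source_atom s) (tau (defseq_of C) (block_target b s)))) Y"
    and sizes: "\<And>s. s \<le> a \<Longrightarrow>
      num_symbols (tau (gad_CV a k) b) + num_symbols (tau (defseq_of C) (block_target b s)) + 10 \<le> M"
      "num_symbols (Neg Y) \<le> M"
  shows "entails M (M * (129 * M + 4)) (rename \<rho> (inst (restriction b) (tau (gad_CV a k) b))) Y"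
proof -
  let ?G = "gad_CV a k" and ?D = "defseq_of C"
  define restricted where "restricted \<phi> = rename \<rho> (inst (restriction b) \<phi>)" for \<phi>
  define relocated where "relocated s \<phi> = rename \<rho> (rename (source_atom s) \<phi>)" for s \<phi>
  let ?\<Delta> = "map restricted (def_fms ?G)" and ?\<Omega> = "map restricted (out_fms ?G b)"
  let ?D' = "\<lambda>s. map (relocated s) (def_fms ?D)"
  let ?E' = "\<lambda>s. map (relocated s) (out_fms ?D (block_target b s))"
  have restricted_tau: "rename \<rho> (inst (restriction b) (tau ?G b)) = Imp (Conj ?\<Delta>) (Disj ?\<Omega>)"
    by (simp add: tau_eq restricted_def[abs_def] inst_Conj inst_Disj rename_Conj rename_Disj comp_def)
  have "entails M (M * (2 * (64 * M) + M + 4)) (Imp (Conj ?\<Delta>) (Disj ?\<Omega>)) Y"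
  proof (rule entails_Imp_Conj_Disj[where S = "{..a}" and D = ?D' and E = ?E'])
    show "num_symbols (Imp (Conj ?\<Delta>) (Disj ?\<Omega>)) \<le> M"
      unfolding restricted_tau[symmetric] using sizes(1)[of 0] by simp
    show "num_symbols (Neg Y) \<le> M" by (rule sizes(2))
    show "entails M (64 * M) (Imp (Conj (?D' s)) (Disj (?E' s))) Y" if "s \<in> {..a}" for s
      using Y[of s] that
      by (simp add: tau_eq relocated_def[abs_def] rename_Conj rename_Disj comp_def)
    show "entails M (64 * M) (Cst True) \<delta> \<or> (\<exists>s \<in> {..a}. \<exists>\<delta>' \<in> set (?D' s). entails M (64 * M) \<delta>' \<delta>)"
      if \<delta>: "\<delta> \<in> set ?\<Delta>" for \<delta>
    proof -
      obtain \<delta>\<^sub>0 where "\<delta>\<^sub>0 \<in> set (def_fms ?G)" "\<delta> = restricted \<delta>\<^sub>0" using \<delta> by auto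
      then consider "entails M (64 * M) (rename \<rho> (Cst True)) \<delta>"
        | s \<delta>' where "s \<le> a" "\<delta>' \<in> set (def_fms ?D)" "entails M (64 * M) (relocated s \<delta>') \<delta>"
        using entails_restricted_conjunct[of \<delta>\<^sub>0 M b] sizes(1)[of 0] entails_rename
        unfolding restricted_def relocated_def by (fastforce simp: tau_eq)
      then show ?thesis by cases auto
    qed
    show "entails M (64 * M) \<omega> (Cst False) \<or> (\<exists>s \<in> {..a}. \<exists>\<omega>' \<in> set (?E' s). entails M (64 * M) \<omega> \<omega>')"
      if \<omega>: "\<omega> \<in> set ?\<Omega>" for \<omega>
    proof -
      obtain \<omega>\<^sub>0 where "\<omega>\<^sub>0 \<in> set (out_fms ?G b)" "\<omega> = restricted \<omega>\<^sub>0" using \<omega> by auto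
      then consider "entails M (64 * M) \<omega> (rename \<rho> (Cst False))"
        | s \<omega>' where "s \<le> a" "\<omega>' \<in> set (out_fms ?D (block_target b s))"
          "entails M (64 * M) \<omega> (relocated s \<omega>')"
        using entails_restricted_disjunct[OF b, of \<omega>\<^sub>0 M] sizes(1) entails_rename
        unfolding restricted_def relocated_def by (fastforce simp: tau_eq)
      then show ?thesis by cases auto
    qed
  qed
  then show ?thesis unfolding restricted_tau by simp
qed

subsection \<open>Disjunctions\<close>

definition source_targets :: "bool list list \<Rightarrow> bool list list" where
  "source_targets bs =
     map (\<lambda>q. block_target (bs ! (q div (a + 1))) (q mod (a + 1))) [0..<length bs * (a + 1)]"

definition source_names :: "(nat \<Rightarrow> nat \<Rightarrow> nat) \<Rightarrow> nat \<Rightarrow> nat \<Rightarrow> nat" where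
  "source_names \<rho> q x = \<rho> (q div (a + 1)) (source_atom (q mod (a + 1)) x)"

definition source_disj :: "bool list list \<Rightarrow> (nat \<Rightarrow> nat \<Rightarrow> nat) \<Rightarrow> fm" where
  "source_disj bs \<rho> = tau_disj (defseq_of C) (source_targets bs) (source_names \<rho>)"

lemma source_atom_less:
  assumes "s \<le> a" "x < n + S"
  shows "source_atom s x < num_atoms (gad_CV a k)"
proof -
  have "relocate x < k + N" using relocate_less_iff[of N x] gates_le assms(2) by simp
  then show ?thesis unfolding source_atom_def by (rule cv_atom_less_num_atoms[OF assms(1)])
qed

lemma source_atom_inject:
  assumes "s \<le> a" "s' \<le> a" "x < n + S" "x' < n + S" "source_atom s x = source_atom s' x'"
  shows "s = s' \<and> x = x'"
proof -
  have "relocate x < k + N" "relocate x' < k + N"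
    using relocate_less_iff[of N x] relocate_less_iff[of N x'] gates_le assms(3,4) by simp_all
  with assms have "s = s' \<and> relocate x = relocate x'"
    unfolding source_atom_def by (intro cv_atom_inject)
  with assms(3,4) relocate_inject show ?thesis by blast
qed

lemma source_index_bounds:
  assumes "q < length bs * (a + 1)"
  shows "q div (a + 1) < length bs" "q mod (a + 1) \<le> a"
  using less_mult_imp_div_less[OF assms] by (simp_all add: less_Suc_eq_le[symmetric])

lemma nth_source_targets:
  "q < length bs * (a + 1) \<Longrightarrow>
   source_targets bs ! q = block_target (bs ! (q div (a + 1))) (q mod (a + 1))"
  by (simp add: source_targets_def)

lemma length_source_targets: "length (source_targets bs) = length bs * (a + 1)"
  by (simp add: source_targets_def)

lemma num_symbols_source_disj_le:
  assumes "\<And>b. num_symbols (tau (defseq_of C) b) \<le> T"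
  shows "num_symbols (source_disj bs \<rho>) \<le> length bs * (a + 1) * (T + 1) + 1"
  unfolding source_disj_def tau_disj_def
  by (rule order_trans[OF num_symbols_Disj_le[where B = T]])
     (use assms in \<open>auto simp: length_source_targets\<close>)

lemma source_disjunct:
  assumes "i < length bs" "s \<le> a"
  shows "rename (\<rho> i) (rename (source_atom s) (tau (defseq_of C) (block_target (bs ! i) s))) \<in>
    set (map (\<lambda>q. rename (source_names \<rho> q) (tau (defseq_of C) (source_targets bs ! q)))
      [0..<length (source_targets bs)])" (is "?\<phi> \<in> set (map ?disjunct _)")
proof -
  let ?q = "i * (a + 1) + s"
  have q: "?q div (a + 1) = i" "?q mod (a + 1) = s"
    using block_div_mod[of s "a + 1" i] assms(2) by simp_all
  have less: "?q < length bs * (a + 1)"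
    using mult_le_mono1[of "i + 1" "length bs" "a + 1"] assms by simp
  have "?\<phi> = ?disjunct ?q"
    unfolding nth_source_targets[OF less] source_names_def q form.map_comp comp_def ..
  with less show ?thesis
    unfolding length_source_targets set_map by (intro image_eqI[of _ _ ?q]) auto
qed

context
  fixes bs :: "bool list list" and \<rho> :: "nat \<Rightarrow> nat \<Rightarrow> nat"
  assumes names: "disjoint_names (gad_CV a k) bs \<rho>"
begin

lemma length_target: "i < length bs \<Longrightarrow> length (bs ! i) = (a + 1) * (k + 1)"
  using names unfolding disjoint_names_def length_outs_gad_CV by auto

lemma disjoint_names_source:
  "disjoint_names (defseq_of C) (source_targets bs) (source_names \<rho>)"
  unfolding disjoint_names_def
proof (intro conjI ballI)
  show "source_targets bs \<noteq> []"
    using names by (simp add: source_targets_def disjoint_names_def)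
  show "length b = length (outs (defseq_of C))" if b: "b \<in> set (source_targets bs)" for b
  proof -
    obtain q where q: "q < length bs * (a + 1)" "b = block_target (bs ! (q div (a + 1))) (q mod (a + 1))"
      using b by (auto simp: source_targets_def)
    then show ?thesis
      using length_block_target[OF source_index_bounds(2) length_target[OF source_index_bounds(1)]]
      by (simp add: defseq_of_def)
  qed
  have inj: "inj_on (\<lambda>(i, x). \<rho> i x) ({..<length bs} \<times> {..<num_atoms (gad_CV a k)})"
    using names by (simp add: disjoint_names_def)
  show "inj_on (\<lambda>(q, x). source_names \<rho> q x)
      ({..<length (source_targets bs)} \<times> {..<num_atoms (defseq_of C)})"
    unfolding length_source_targets num_atoms_defseq_of
  proof (rule inj_onI, clarify)
    fix q x q' x'
    assume q: "q < length bs * (a + 1)" "q' < length bs * (a + 1)" and x: "x < n + S" "x' < n + S"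
      and "source_names \<rho> q x = source_names \<rho> q' x'"
    then have "q div (a + 1) = q' div (a + 1)"
      "source_atom (q mod (a + 1)) x = source_atom (q' mod (a + 1)) x'"
      using inj_onD[OF inj, of "(q div (a + 1), source_atom (q mod (a + 1)) x)"
          "(q' div (a + 1), source_atom (q' mod (a + 1)) x')"]
        source_index_bounds[OF q(1)] source_index_bounds[OF q(2)] source_atom_less
      by (simp_all add: source_names_def)
    moreover from this(2) have "q mod (a + 1) = q' mod (a + 1) \<and> x = x'"
      by (intro source_atom_inject source_index_bounds[OF q(1)] source_index_bounds[OF q(2)] x)
    ultimately show "q = q' \<and> x = x'" by (metis div_mult_mod_eq)
  qed
qed

lemma atoms_source_disj: "atoms (source_disj bs \<rho>) \<subseteq> atoms (tau_disj (gad_CV a k) bs \<rho>)"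
proof
  fix y assume "y \<in> atoms (source_disj bs \<rho>)"
  then obtain q where q: "q < length bs * (a + 1)"
    and "y \<in> atoms (rename (source_names \<rho> q) (tau (defseq_of C) (source_targets bs ! q)))"
    unfolding source_disj_def tau_disj_def atoms_Disj length_source_targets by auto
  then obtain x where x: "x \<in> atoms (tau (defseq_of C) (source_targets bs ! q))"
    and y: "y = source_names \<rho> q x"
    by (auto simp: form.set_map)
  let ?i = "q div (a + 1)"
  have "relocate x < k + N"
    using atoms_tau[OF wf_defseq_defseq_of] x gates_le relocate_less_iff[of N x]
    by (fastforce simp: num_atoms_defseq_of)
  then have "source_atom (q mod (a + 1)) x \<in> atoms (tau (gad_CV a k) (bs ! ?i))"
    unfolding source_atom_def using source_index_bounds[OF q] length_target
    by (intro cv_atom_in_atoms_tau) auto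
  then have "y \<in> atoms (rename (\<rho> ?i) (tau (gad_CV a k) (bs ! ?i)))"
    unfolding y source_names_def form.set_map by (rule imageI)
  with source_index_bounds(1)[OF q] show "y \<in> atoms (tau_disj (gad_CV a k) bs \<rho>)"
    unfolding tau_disj_def atoms_Disj by auto
qed

lemma entails_source_disj:
  assumes size: "num_symbols (tau_disj (gad_CV a k) bs \<rho>) + num_symbols (source_disj bs \<rho>) + 10 \<le> M"
  obtains \<theta> where "entails M (M * (M * (129 * M + 4) + 1))
    (inst \<theta> (tau_disj (gad_CV a k) bs \<rho>)) (source_disj bs \<rho>)"
proof -
  let ?\<phi> = "tau_disj (gad_CV a k) bs \<rho>" and ?\<psi> = "source_disj bs \<rho>"
  let ?D = "\<lambda>i s. rename (\<rho> i) (rename (source_atom s) (tau (defseq_of C) (block_target (bs ! i) s)))"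
  obtain \<theta> where \<theta>: "inst \<theta> ?\<phi> =
      Disj (map (\<lambda>i. rename (\<rho> i) (inst (restriction (bs ! i)) (tau (gad_CV a k) (bs ! i)))) [0..<length bs])"
    using inst_tau_disj[OF wf_defseq_gad_CV names, of "\<lambda>i. restriction (bs ! i)"] by blast
  have "entails M (M * (129 * M + 4))
      (rename (\<rho> i) (inst (restriction (bs ! i)) (tau (gad_CV a k) (bs ! i)))) ?\<psi>" if i: "i < length bs" for i
  proof (rule entails_restricted_tau[OF length_target[OF i]])
    have "num_symbols (rename (\<rho> i) (tau (gad_CV a k) (bs ! i))) \<le> num_symbols ?\<phi>"
      unfolding tau_disj_def using i by (intro num_symbols_le_Disj) auto
    moreover have "num_symbols (?D i s) \<le> num_symbols ?\<psi>" if "s \<le> a" for s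
      unfolding source_disj_def tau_disj_def by (rule num_symbols_le_Disj[OF source_disjunct[OF i that]])
    ultimately show "num_symbols (tau (gad_CV a k) (bs ! i)) +
        num_symbols (tau (defseq_of C) (block_target (bs ! i) s)) + 10 \<le> M" if "s \<le> a" for s
      using size that by fastforce
    show "entails M (64 * M) (?D i s) ?\<psi>" if "s \<le> a" for s
    proof (rule entails_mono)
      show "entails M (num_symbols ?\<psi>) (?D i s) ?\<psi>"
        using entails_DisjI[OF source_disjunct[OF i that], of \<rho> M] size
        by (simp add: source_disj_def tau_disj_def)
    qed (use size in simp)
  qed (use size in simp)
  then have "entails M (num_symbols (inst \<theta> ?\<phi>) * (M * (129 * M + 4) + 1)) (inst \<theta> ?\<phi>) ?\<psi>"
    using size num_symbols_inst[of \<theta> ?\<phi>] unfolding \<theta> by (intro entails_DisjE) auto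
  then have "entails M (M * (M * (129 * M + 4) + 1)) (inst \<theta> ?\<phi>) ?\<psi>"
    by (rule entails_mono) (use size in \<open>intro mult_le_mono1; simp\<close>)
  then show ?thesis by (rule that)
qed

end

end

section \<open>Proof systems closed under restriction and modus ponens\<close>

locale closed_pps =
  fixes P :: "bool list \<Rightarrow> bool list \<Rightarrow> bool" and c :: nat
  assumes pps: "pps P"
    and simulates_EF: "simulates P EF"
    and min_size_inst: "\<And>\<sigma> \<theta>. tautology \<sigma> \<Longrightarrow> min_size P (inst \<theta> \<sigma>) \<le> min_size P \<sigma> ^ c"
    and min_size_mp: "\<And>\<alpha> \<beta>. min_size P \<beta> \<le> (min_size P \<alpha> + min_size P (Imp \<alpha> \<beta>)) ^ c"
begin

lemma fm_size_if_min_size_le: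
  obtains d where "\<And>\<phi> B. min_size P \<phi> \<le> enat B \<Longrightarrow> fm_size \<phi> \<le> B ^ d + d"
proof -
  obtain d where d: "\<forall>\<phi> x. P x (enc \<phi>) \<longrightarrow> fm_size \<phi> \<le> length x ^ d + d"
    using pps_fm_size[OF pps] by blast
  have "fm_size \<phi> \<le> B ^ d + d" if min: "min_size P \<phi> \<le> enat B" for \<phi> B
  proof -
    obtain x where x: "P x (enc \<phi>)" "length x \<le> B" using min by (rule min_size_leE)
    from power_mono[OF x(2), of d] d x(1) show ?thesis by fastforce
  qed
  then show ?thesis by (rule that)
qed

lemma tautology_if_min_size_le:
  assumes "min_size P \<phi> \<le> enat B"
  shows "tautology \<phi>"
proof -
  obtain x where "P x (enc \<phi>)" using assms min_size_leE by blast
  with pps show ?thesis by (auto simp: pps_def enc_in_TAUT_iff[symmetric])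
qed

lemma min_size_if_entails:
  obtains e where "\<And>M n L B \<theta> \<phi> \<psi>. entails M n (inst \<theta> \<phi>) \<psi> \<Longrightarrow> atoms \<psi> \<subseteq> atoms \<phi> \<Longrightarrow>
    fm_size \<phi> \<le> L \<Longrightarrow> min_size P \<phi> \<le> enat B \<Longrightarrow>
    min_size P \<psi> \<le> enat ((B ^ c + (scheme_cost * n * (scheme_cost * M * (L + 3))) ^ e) ^ c)"
proof -
  obtain e where e: "\<And>\<sigma>. tautology \<sigma> \<Longrightarrow> min_size P \<sigma> \<le> min_size EF \<sigma> ^ e"
    using simulates_EF by (auto simp: simulates_def)
  have "min_size P \<psi> \<le> enat ((B ^ c + (scheme_cost * n * (scheme_cost * M * (L + 3))) ^ e) ^ c)"
    if entails: "entails M n (inst \<theta> \<phi>) \<psi>" and atoms: "atoms \<psi> \<subseteq> atoms \<phi>"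
      and L: "fm_size \<phi> \<le> L" and B: "min_size P \<phi> \<le> enat B" for M n L B \<theta> \<phi> \<psi>
  proof -
    let ?imp = "Imp (inst \<theta> \<phi>) \<psi>" and ?Q = "scheme_cost * n * (scheme_cost * M * (L + 3))"
    have "length (enc_nat y) \<le> L" if "y \<in> atoms ?imp" for y
      using that atoms atoms_inst[of \<theta> \<phi>] length_enc_nat_le_fm_size[of y \<phi>] L by fastforce
    with entails have "min_size EF ?imp \<le> enat ?Q"
      unfolding entails_def by (intro min_size_EF_le) auto
    from order_trans[OF e[OF entails_sound[OF entails]] enat_power_le[OF this]]
    have "min_size P ?imp \<le> enat (?Q ^ e)" .
    moreover have "min_size P (inst \<theta> \<phi>) \<le> enat (B ^ c)"
      using order_trans[OF min_size_inst[OF tautology_if_min_size_le[OF B]] enat_power_le[OF B]] .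
    ultimately have "min_size P (inst \<theta> \<phi>) + min_size P ?imp \<le> enat (B ^ c + ?Q ^ e)"
      unfolding plus_enat_simps(1)[symmetric] by (intro add_mono)
    from order_trans[OF min_size_mp enat_power_le[OF this]] show ?thesis .
  qed
  then show ?thesis by (rule that)
qed

end

section \<open>The reduction\<close>

lemma quadratic_le_exp: "12 \<le> j \<Longrightarrow> (4 * j + 5) * (4 * j + 6) \<le> (2::nat) ^ j"
proof (induction j rule: dec_induct)
  case (step j)
  have "12 * j \<le> j * j" using step by (intro mult_right_mono) auto
  then have "(4 * Suc j + 5) * (4 * Suc j + 6) \<le> 2 * ((4 * j + 5) * (4 * j + 6))"
    using step by (simp add: algebra_simps)
  with step show ?case by simp
qed simp

lemma room_for_description:
  assumes "50 \<le> k"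
  shows "(k + 1) * addr_len (k\<^sup>2) k + k * (2 + 2 * addr_len (k\<^sup>2) k) \<le> k\<^sup>2"
proof -
  define j where "j = (k - 2) div 4"
  have j: "4 * j + 2 \<le> k" "k \<le> 4 * j + 5" "12 \<le> j" using assms by (auto simp: j_def)
  have "k\<^sup>2 + k = k * (k + 1)" by (simp add: power2_eq_square)
  also have "\<dots> \<le> (4 * j + 5) * (4 * j + 6)" using j by (intro mult_mono) auto
  also have "\<dots> \<le> 2 ^ j" using quadratic_le_exp[OF j(3)] .
  finally have w: "addr_len (k\<^sup>2) k \<le> j" by (rule addr_len_le)
  have "(k + 1) * addr_len (k\<^sup>2) k + k * (2 + 2 * addr_len (k\<^sup>2) k) \<le> (2 * k) * j + k * (2 + 2 * j)"
    using w assms by (intro add_mono mult_mono) auto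
  also have "\<dots> = k * (4 * j + 2)" by (simp add: algebra_simps)
  also have "\<dots> \<le> k * k" using j by (intro mult_left_mono) auto
  finally show ?thesis by (simp add: power2_eq_square)
qed

lemma le_num_gates:
  assumes "50 \<le> k"
  shows "k \<le> num_gates (k\<^sup>2) k"
proof -
  have "k * (2 + 2 * addr_len (k\<^sup>2) k) \<le> k\<^sup>2 - (k + 1) * addr_len (k\<^sup>2) k"
    using room_for_description[OF assms] by linarith
  then show ?thesis
    unfolding num_gates_def by (subst less_eq_div_iff_mult_less_eq) auto
qed

lemma nat_root_exists:
  assumes "1 \<le> e"
  obtains n :: nat where "n ^ e \<le> k" "k < (n + 1) ^ e"
proof -
  let ?n = "LEAST n. k < (n + 1) ^ e"
  have "k < (k + 1) ^ e" using assms self_le_power[of "k + 1" e] by simp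
  then have "k < (?n + 1) ^ e" by (rule LeastI)
  moreover have "?n ^ e \<le> k"
  proof (cases ?n)
    case 0
    then show ?thesis using assms by (simp add: zero_power)
  next
    case (Suc n')
    then show ?thesis using not_less_Least[of n' "\<lambda>n. k < (n + 1) ^ e"] by simp
  qed
  ultimately show ?thesis using that by blast
qed

locale ptime_generator =
  fixes g :: "bool list \<Rightarrow> bool list" and m :: "nat \<Rightarrow> nat" and C :: "nat \<Rightarrow> circuit"
  assumes ptime: "ptime_fun g"
    and length_g: "\<And>x. length (g x) = m (length x)"
    and stretch: "\<And>n. m n > n"
    and inputs_C: "\<And>n. inputs (C n) = n"
    and computes: "generator (\<lambda>n. g) (\<lambda>n. defseq_of (C n))"
begin

lemma length_outputs:
  assumes "1 \<le> n"
  shows "length (outputs (C n)) = m n"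
proof -
  have "defseq_eval (defseq_of (C n)) (replicate n False) = g (replicate n False)"
    using computes assms by (auto simp: generator_def defseq_of_def inputs_C)
  from arg_cong[OF this, of length] show ?thesis
    by (simp add: defseq_eval_def length_g defseq_of_def)
qed

lemma length_outs: "1 \<le> n \<Longrightarrow> length (outs (defseq_of (C n))) = m n"
  using length_outputs by (simp add: defseq_of_def)

lemma poly_bounded_stretch: "poly_bounded m"
proof -
  obtain d where d: "\<forall>x. length (g x) \<le> length x + (length x ^ d + d)"
    using ptime_fun_length[OF ptime] by blast
  have "m n \<le> n + (n ^ d + d)" for n
    using d[rule_format, of "replicate n False"] by (simp add: length_g)
  then show ?thesis
    by (rule poly_bounded_mono[rotated]) (intro poly_bounded_intros)
qed

lemma poly_bounded_gates: "poly_bounded (\<lambda>n. length (gates (C n)))"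
proof -
  obtain d where d: "\<And>n. 1 \<le> n \<Longrightarrow> defseq_size (defseq_of (C n)) \<le> m n ^ d"
    using computes length_outs by (auto simp: generator_def)
  have "length (gates (C n)) \<le> m n ^ d" if "2 \<le> n" for n
  proof -
    have "length (gates (C n)) = length (defs (defseq_of (C n)))" by (simp add: defseq_of_def)
    also have "\<dots> \<le> defseq_size (defseq_of (C n))"
      using length_le_sum_list_fm_size[of "defs (defseq_of (C n))"] by (simp add: defseq_size_def)
    also have "\<dots> \<le> m n ^ d" using d that by simp
    finally show ?thesis .
  qed
  from poly_bounded_mono[OF poly_bounded_power[OF poly_bounded_stretch] this] show ?thesis .
qed

text \<open>From \<open>50\<close> on, circuits with \<^term>\<open>k\<close> gates have descriptions of \<open>k\<^sup>2\<close> bits; the last condition makes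
  \<^term>\<open>k\<close> polynomial in \<^term>\<open>n\<close>.\<close>

definition admissible :: "nat \<Rightarrow> nat \<Rightarrow> nat \<Rightarrow> bool" where
  "admissible e n k \<longleftrightarrow>
     50 \<le> k \<and> 2 \<le> n \<and> n \<le> k \<and> length (gates (C n)) \<le> k \<and> k \<le> (n + 1) ^ e"

lemma embedding_if_admissible:
  assumes "admissible e n k"
  shows "embedding (C n) (k\<^sup>2) k"
proof
  have k: "50 \<le> k" "1 \<le> n" "n \<le> k" "length (gates (C n)) \<le> k"
    using assms by (auto simp: admissible_def)
  then show "1 \<le> k\<^sup>2" "1 \<le> k" "inputs (C n) \<le> k" by (simp_all add: inputs_C)
  show "length (gates (C n)) \<le> num_gates (k\<^sup>2) k"
    using k(4) le_num_gates[OF k(1)] by (rule order_trans)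
  show "(k + 1) * addr_len (k\<^sup>2) k \<le> k\<^sup>2"
    using room_for_description[OF k(1)] by linarith
  show "inputs (C n) < length (outputs (C n))"
    using stretch length_outputs[OF k(2)] by (simp add: inputs_C)
qed

lemma admissible_exists:
  obtains e K where "\<And>k. K < k \<Longrightarrow> \<exists>n. admissible e n k"
proof -
  obtain e where e: "1 \<le> e" "\<And>n. 2 \<le> n \<Longrightarrow> length (gates (C n)) \<le> n ^ e"
    using poly_boundedE[OF poly_bounded_gates] by blast
  have "\<exists>n. admissible e n k" if k: "max 50 (2 ^ e) < k" for k
  proof -
    obtain n where n: "n ^ e \<le> k" "k < (n + 1) ^ e" using nat_root_exists[OF e(1)] by blast
    have "(2::nat) ^ e < (n + 1) ^ e" using k n(2) by simp
    then have "2 < n + 1" by (rule power_less_imp_less_base) simp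
    then have "2 \<le> n" by simp
    moreover from this have "n \<le> k" using self_le_power[of n e] e(1) n(1) by linarith
    moreover have "length (gates (C n)) \<le> k" using e(2)[OF \<open>2 \<le> n\<close>] n(1) by (rule order_trans)
    ultimately show ?thesis using k n(2) unfolding admissible_def by auto
  qed
  then show ?thesis by (rule that)
qed

end

locale gadget_reduction = closed_pps P c + ptime_generator g m C
  for P :: "bool list \<Rightarrow> bool list \<Rightarrow> bool" and c :: nat
    and g :: "bool list \<Rightarrow> bool list" and m :: "nat \<Rightarrow> nat" and C :: "nat \<Rightarrow> circuit"
begin

abbreviation gad_disj :: "nat \<Rightarrow> bool list list \<Rightarrow> (nat \<Rightarrow> nat \<Rightarrow> nat) \<Rightarrow> fm" where
  "gad_disj k \<equiv> tau_disj (gad_CV (k\<^sup>2) k)"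

abbreviation gad_length :: "nat \<Rightarrow> nat" where
  "gad_length k \<equiv> (k\<^sup>2 + 1) * (k + 1)"

definition easy_gad_disj :: "nat \<Rightarrow> nat \<Rightarrow> bool list list \<Rightarrow> (nat \<Rightarrow> nat \<Rightarrow> nat) \<Rightarrow> bool" where
  "easy_gad_disj c' k bs \<rho> \<longleftrightarrow> disjoint_names (gad_CV (k\<^sup>2) k) bs \<rho> \<and>
     min_size P (gad_disj k bs \<rho>) \<le> enat (gad_length k ^ c')"

lemma fm_size_if_easy:
  obtains d where
    "\<And>k bs \<rho>. easy_gad_disj c' k bs \<rho> \<Longrightarrow> fm_size (gad_disj k bs \<rho>) \<le> (gad_length k ^ c') ^ d + d"
  using fm_size_if_min_size_le unfolding easy_gad_disj_def by metis

lemma reduction_size: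
  obtains M where "poly_bounded M"
    and "\<And>n k bs \<rho>. admissible e n k \<Longrightarrow> easy_gad_disj c' k bs \<rho> \<Longrightarrow>
      gad_length k ^ c' \<le> M n \<and> fm_size (gad_disj k bs \<rho>) \<le> M n \<and>
      num_symbols (gad_disj k bs \<rho>) +
        num_symbols (embedding.source_disj (C n) (k\<^sup>2) k bs \<rho>) + 10 \<le> M n"
proof -
  obtain d where d: "\<And>k bs \<rho>. easy_gad_disj c' k bs \<rho> \<Longrightarrow>
      fm_size (gad_disj k bs \<rho>) \<le> (gad_length k ^ c') ^ d + d"
    using fm_size_if_easy by blast
  obtain t where t: "\<And>n b. 1 \<le> n \<Longrightarrow> fm_size (tau (defseq_of (C n)) b) \<le> m n ^ t"
    using generator_fm_size_tau[OF computes] length_outs by metis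
  define \<kappa> where "\<kappa> n = (n + 1) ^ e" for n :: nat
  define B where "B n = (((\<kappa> n)\<^sup>2 + 1) * (\<kappa> n + 1)) ^ c'" for n
  define L where "L n = B n ^ d + d" for n
  define M where "M n = B n + L n + (L n * ((\<kappa> n)\<^sup>2 + 1) * (m n ^ t + 1) + 1) + 10" for n
  have "poly_bounded M"
    unfolding M_def L_def B_def \<kappa>_def by (intro poly_bounded_intros poly_bounded_stretch)
  moreover have "gad_length k ^ c' \<le> M n \<and> fm_size (gad_disj k bs \<rho>) \<le> M n \<and>
      num_symbols (gad_disj k bs \<rho>) +
        num_symbols (embedding.source_disj (C n) (k\<^sup>2) k bs \<rho>) + 10 \<le> M n"
    if adm: "admissible e n k" and easy: "easy_gad_disj c' k bs \<rho>" for n k bs \<rho>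
  proof -
    let ?\<phi> = "gad_disj k bs \<rho>"
    interpret embedding "C n" "k\<^sup>2" k by (rule embedding_if_admissible[OF adm])
    have k: "k \<le> \<kappa> n" and n: "1 \<le> n" using adm by (auto simp: admissible_def \<kappa>_def)
    then have B: "gad_length k ^ c' \<le> B n"
      unfolding B_def by (intro power_mono mult_mono add_mono) auto
    then have "(gad_length k ^ c') ^ d + d \<le> L n"
      unfolding L_def by (intro add_mono power_mono) auto
    with d[OF easy] have size: "fm_size ?\<phi> \<le> L n" by (rule order_trans)
    moreover have "length bs \<le> num_symbols ?\<phi>"
      unfolding tau_disj_def by (rule order_trans[OF _ length_le_num_symbols_Disj]) simp
    ultimately have symbols: "num_symbols ?\<phi> \<le> L n" "length bs \<le> L n"
      using num_symbols_le_fm_size[of ?\<phi>] by simp_all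
    have "num_symbols (tau (defseq_of (C n)) b) \<le> m n ^ t" for b
      using num_symbols_le_fm_size t[OF n] by (rule order_trans)
    then have "num_symbols (source_disj bs \<rho>) \<le> length bs * (k\<^sup>2 + 1) * (m n ^ t + 1) + 1"
      by (rule num_symbols_source_disj_le)
    also have "\<dots> \<le> L n * ((\<kappa> n)\<^sup>2 + 1) * (m n ^ t + 1) + 1"
      using symbols(2) k by (intro add_mono mult_mono power_mono) auto
    finally show ?thesis using B size symbols(1) by (simp add: M_def)
  qed
  ultimately show ?thesis by (rule that)
qed

lemma min_size_source_disj:
  obtains E where "1 \<le> E"
    "\<And>n k bs \<rho>. admissible e n k \<Longrightarrow> easy_gad_disj c' k bs \<rho> \<Longrightarrow>
      min_size P (embedding.source_disj (C n) (k\<^sup>2) k bs \<rho>) \<le> enat (m n ^ E)"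
proof -
  obtain M where "poly_bounded M"
    and M: "\<And>n k bs \<rho>. admissible e n k \<Longrightarrow> easy_gad_disj c' k bs \<rho> \<Longrightarrow>
      gad_length k ^ c' \<le> M n \<and> fm_size (gad_disj k bs \<rho>) \<le> M n \<and>
      num_symbols (gad_disj k bs \<rho>) +
        num_symbols (embedding.source_disj (C n) (k\<^sup>2) k bs \<rho>) + 10 \<le> M n"
    using reduction_size by blast
  obtain d where d: "\<And>M n L B \<theta> \<phi> \<psi>. entails M n (inst \<theta> \<phi>) \<psi> \<Longrightarrow> atoms \<psi> \<subseteq> atoms \<phi> \<Longrightarrow>
      fm_size \<phi> \<le> L \<Longrightarrow> min_size P \<phi> \<le> enat B \<Longrightarrow>
      min_size P \<psi> \<le> enat ((B ^ c + (scheme_cost * n * (scheme_cost * M * (L + 3))) ^ d) ^ c)"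
    using min_size_if_entails by blast
  define R where "R n = (M n ^ c + (scheme_cost * (M n * (M n * (129 * M n + 4) + 1)) *
      (scheme_cost * M n * (M n + 3))) ^ d) ^ c" for n
  have "poly_bounded R"
    unfolding R_def by (intro poly_bounded_intros \<open>poly_bounded M\<close>)
  then obtain E where E: "1 \<le> E" "\<And>n. 2 \<le> n \<Longrightarrow> R n \<le> n ^ E" using poly_boundedE by blast
  have "min_size P (embedding.source_disj (C n) (k\<^sup>2) k bs \<rho>) \<le> enat (m n ^ E)"
    if adm: "admissible e n k" and easy: "easy_gad_disj c' k bs \<rho>" for n k bs \<rho>
  proof -
    let ?\<phi> = "gad_disj k bs \<rho>"
    interpret embedding "C n" "k\<^sup>2" k by (rule embedding_if_admissible[OF adm])
    have names: "disjoint_names (gad_CV (k\<^sup>2) k) bs \<rho>" using easy by (simp add: easy_gad_disj_def)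
    have min: "min_size P ?\<phi> \<le> enat (M n)"
      using easy M[OF adm easy] unfolding easy_gad_disj_def by (meson enat_ord_simps(1) order_trans)
    obtain \<theta> where "entails (M n) (M n * (M n * (129 * M n + 4) + 1)) (inst \<theta> ?\<phi>) (source_disj bs \<rho>)"
      using entails_source_disj[OF names] M[OF adm easy] by blast
    from d[OF this atoms_source_disj[OF names] _ min, of "M n"]
    have "min_size P (source_disj bs \<rho>) \<le> enat (R n)"
      using M[OF adm easy] by (simp add: R_def)
    also have "R n \<le> m n ^ E"
      using E(2)[of n] power_mono[OF less_imp_le[OF stretch[of n]], of E] adm
      by (simp add: admissible_def)
    finally show ?thesis by simp
  qed
  with E(1) show ?thesis by (rule that)
qed

lemma large_easy_gad_disj_reduces:
  obtains E e K where "1 \<le> E"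
    "\<And>k bs \<rho>. K < k \<Longrightarrow> easy_gad_disj c' k bs \<rho> \<Longrightarrow>
      \<exists>\<psi> \<in> easy_tau_disjs P (\<lambda>n. defseq_of (C n)) E. k \<le> (num_symbols \<psi> + 1) ^ e"
proof -
  obtain e K where admissible: "\<And>k. K < k \<Longrightarrow> \<exists>n. admissible e n k"
    using admissible_exists by blast
  obtain E where E: "1 \<le> E" "\<And>n k bs \<rho>. admissible e n k \<Longrightarrow> easy_gad_disj c' k bs \<rho> \<Longrightarrow>
      min_size P (embedding.source_disj (C n) (k\<^sup>2) k bs \<rho>) \<le> enat (m n ^ E)"
    using min_size_source_disj by blast
  have "\<exists>\<psi> \<in> easy_tau_disjs P (\<lambda>n. defseq_of (C n)) E. k \<le> (num_symbols \<psi> + 1) ^ e"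
    if "K < k" and easy: "easy_gad_disj c' k bs \<rho>" for k bs \<rho>
  proof -
    obtain n where adm: "admissible e n k" using admissible[OF \<open>K < k\<close>] by blast
    then have n: "1 \<le> n" "k \<le> (n + 1) ^ e" by (auto simp: admissible_def)
    interpret embedding "C n" "k\<^sup>2" k by (rule embedding_if_admissible[OF adm])
    have names: "disjoint_names (defseq_of (C n)) (source_targets bs) (source_names \<rho>)"
      using easy by (intro disjoint_names_source) (simp add: easy_gad_disj_def)
    have "source_disj bs \<rho> \<in> easy_tau_disjs P (\<lambda>n. defseq_of (C n)) E"
      unfolding easy_tau_disjs_def using names E(2)[OF adm easy] n(1) length_outs[OF n(1)]
      by (intro CollectI exI[of _ n] exI[of _ "source_targets bs"] exI[of _ "source_names \<rho>"])
         (simp add: source_disj_def)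
    moreover have "n \<le> num_symbols (source_disj bs \<rho>)"
      using length_outs_le_num_symbols_tau_disj[OF names] length_outs[OF n(1)] stretch[of n]
      by (simp add: source_disj_def)
    then have "(n + 1) ^ e \<le> (num_symbols (source_disj bs \<rho>) + 1) ^ e" by (intro power_mono) auto
    with n(2) have "k \<le> (num_symbols (source_disj bs \<rho>) + 1) ^ e" by (rule order_trans)
    ultimately show ?thesis by blast
  qed
  with E(1) show ?thesis by (rule that)
qed

theorem vee_hard_gad_CV:
  assumes "vee_hard P (\<lambda>n. defseq_of (C n))"
  shows "vee_hard P (\<lambda>k. gad_CV (k\<^sup>2) k)"
  using assms
proof (rule vee_hard_if_reduces)
  fix c' :: nat
  obtain E e K where E: "1 \<le> E" and reduces: "\<And>k bs \<rho>. K < k \<Longrightarrow> easy_gad_disj c' k bs \<rho> \<Longrightarrow>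
      \<exists>\<psi> \<in> easy_tau_disjs P (\<lambda>n. defseq_of (C n)) E. k \<le> (num_symbols \<psi> + 1) ^ e"
    by (rule large_easy_gad_disj_reduces[of c']) blast
  obtain d where d: "\<And>k bs \<rho>. easy_gad_disj c' k bs \<rho> \<Longrightarrow> fm_size (gad_disj k bs \<rho>) \<le> (gad_length k ^ c') ^ d + d"
    using fm_size_if_easy by blast
  define F where "F k = (gad_length k ^ c') ^ d + d" for k
  have F_mono: "F k \<le> F k'" if "k \<le> k'" for k k'
    unfolding F_def using that by (intro add_mono power_mono mult_mono) auto
  have "fm_size \<phi> \<le> F K \<or> (\<exists>\<psi> \<in> easy_tau_disjs P (\<lambda>n. defseq_of (C n)) E.
      fm_size \<phi> \<le> F ((num_symbols \<psi> + 1) ^ e))"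
    if mem: "\<phi> \<in> easy_tau_disjs P (\<lambda>k. gad_CV (k\<^sup>2) k) c'" for \<phi>
  proof -
    obtain k bs \<rho> where easy: "easy_gad_disj c' k bs \<rho>" and \<phi>: "\<phi> = gad_disj k bs \<rho>"
      using mem unfolding easy_tau_disjs_def length_outs_gad_CV easy_gad_disj_def by blast
    have "fm_size \<phi> \<le> F k" unfolding F_def \<phi> by (rule d[OF easy])
    then have size: "fm_size \<phi> \<le> F k'" if "k \<le> k'" for k'
      using F_mono[OF that] by (rule order_trans)
    show ?thesis
    proof (cases "k \<le> K")
      case True
      then show ?thesis by (intro disjI1 size)
    next
      case False
      then show ?thesis using reduces[OF _ easy] size by (meson linorder_not_le)
    qed
  qed
  with E show "\<exists>c'' \<ge> 1. \<exists>B h. \<forall>\<phi> \<in> easy_tau_disjs P (\<lambda>k. gad_CV (k\<^sup>2) k) c'.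
      fm_size \<phi> \<le> B \<or> (\<exists>\<psi> \<in> easy_tau_disjs P (\<lambda>n. defseq_of (C n)) c''. fm_size \<phi> \<le> h \<psi>)"
    by (intro exI[of _ E] conjI exI[of _ "F K"] exI[of _ "\<lambda>\<psi>. F ((num_symbols \<psi> + 1) ^ e)"] ballI) blast+
qed

end

theorem theorem1p7:
  fixes P :: "bool list \<Rightarrow> bool list \<Rightarrow> bool"
    and c :: nat
    and g :: "bool list \<Rightarrow> bool list"
    and m :: "nat \<Rightarrow> nat"
    and C :: "nat \<Rightarrow> circuit"
  assumes pps: "pps P"
    and sim: "simulates P EF"
    and c: "c \<ge> 1"
    and subst: "\<And>\<sigma> \<theta>. tautology \<sigma> \<Longrightarrow> min_size P (inst \<theta> \<sigma>) \<le> min_size P \<sigma> ^ c"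
    and mp: "\<And>\<alpha> \<beta>. min_size P \<beta> \<le> (min_size P \<alpha> + min_size P (Imp \<alpha> \<beta>)) ^ c"
    and g_ptime: "ptime_fun g"
    and g_stretch: "\<And>x. length (g x) = m (length x)" "\<And>n. m n > n"
    and C_inputs: "\<And>n. inputs (C n) = n"
    and C_computes: "generator (\<lambda>n. g) (\<lambda>n. defseq_of (C n))"
    and g_hard: "vee_hard P (\<lambda>n. defseq_of (C n))"
  shows "generator (\<lambda>k. gad (k\<^sup>2) k (CV (k\<^sup>2) k)) (\<lambda>k. gad_CV (k\<^sup>2) k)
       \<and> vee_hard P (\<lambda>k. gad_CV (k\<^sup>2) k)
       \<and> hard P (\<lambda>k. gad_CV (k\<^sup>2) k)"
proof -
  interpret gadget_reduction P c g m C
    using assms by unfold_locales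
  note generator_gad_CV
  moreover have "vee_hard P (\<lambda>k. gad_CV (k\<^sup>2) k)"
    using g_hard by (rule vee_hard_gad_CV)
  moreover from this have "hard P (\<lambda>k. gad_CV (k\<^sup>2) k)"
    by (rule vee_hard_imp_hard[OF generator_gad_CV])
  ultimately show ?thesis by simp
qed

end
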